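(* The Calapso transforms of $L$-isothermic surfaces are $L$-isothermic. That is: let $f:\Sigma\to\mathcal{Z}$ be an umbilic-free $\Omega$-surface that is the Legendre lift of an $L$-isothermic surface, so that its middle pencil admits a degree $1$ polynomial conserved quantity $p$ with $p(0)=\mathfrak{q}_\infty$ and $(p(t),p(t))=0$ for all $t$. Then for each $t\in\mathbb{R}$, the Calapso transform $f^t=T(t)f$, where $T(t)$ is premultiplied by a constant Lie sphere transformation so that $T(t)p(t)=\mathfrak{q}_\infty$, projects to an $L$-isothermic surface in the Laguerre geometry defined by $\mathfrak{q}_\infty$.
   Context: $\mathbb{R}^{4,2}$ is a 6-dimensional real vector space with a non-degenerate symmetric bilinear form $(\,,\,)$ of signature $(4,2)$, $\mathcal{L}$ its lightcone; $\wedge^2\mathbb{R}^{4,2}\cong\mathfrak{o}(4,2)$ via $a\wedge b\,(c)=(a,c)b-(b,c)a$. Lie sphere transformations are elements of $\mathrm{O}(4,2)$. $\Sigma$ is a smooth 2-manifold, $d$ the trivial connection on $\underline{\mathbb{R}}^{4,2}=\Sigma\times\mathbb{R}^{4,2}$; $W^{(1)}$ is spanned by sections of a subbundle $W$ and their derivatives. $\mathcal{Z}$ is the Grassmannian of isotropic 2-planes; a smooth $f:\Sigma\to\mathcal{Z}$ (a rank 2 subbundle) is a Legendre map if $f^{(1)}\le f^\perp$ and no non-zero $X\in T\Sigma$ satisfies $d_X\sigma\in f$ for all $\sigma\in\Gamma f$. A curvature sphere at $p$ is a line $s(p)\le f(p)$ killed by $\sigma\mapsto d_X\sigma\bmod f$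 for all $X$ in some non-zero (maximal) subspace of $T_p\Sigma$; $f$ is umbilic-free if there are exactly two at each point, forming rank 1 bundles $s_1,s_2$ with curvature subbundles $T_1,T_2$. A gauge potential is a closed $\eta\in\Omega^1(f\wedge f^\perp)$ with $[\eta\wedge\eta]=0$ such that $q(X,Y)=\mathrm{tr}(\sigma\mapsto\eta(X)d_Y\sigma:f\to f)$ is non-zero (of constant signature by standing assumption); $f$ is an $\Omega$-surface if $q$ is non-degenerate on a dense open set. The gauge orbit is $\{\eta-d\tau:\tau\in\Gamma(\wedge^2f)\}$. With $S_1=\langle\sigma_1,d_Y\sigma_1,d_Yd_Y\sigma_1\rangle$, $S_2=\langle\sigma_2,d_X\sigma_2,d_Xd_X\sigma_2\rangle$ ($\sigma_i\in\Gamma s_i$, $X\in\Gamma T_1$, $Y\in\Gamma T_2$), the middle potential $\eta^{mid}$ is the unique member of the gauge orbit whose $S_1\wedge S_2$-component takes values in $\wedge^2f$; the middle pencil is $\{d+t\eta^{mid}\}_{t\in\mathbb{R}}$, a family of flat metric connections. A degree 1 polynomial conserved quantity is $p(t)=p_0+tp_1$ with $p_1\ne0$ and $(d+t\eta^{mid})p(t)=0$ for all $t$. For $t\in\mathbb{R}$, $T(t):\Sigma\to\mathrm{O}(4,2)$ is a local gauge transformation with $T(t)\cdot(d+t\eta^{mid})=d$ (where $g\cdot\nabla=g\circ\nabla\circ g^{-1}$), unique up to left multiplication by constants; $f^t=T(t)f$ is a Calapso transform. ($T(t)p(t)$ is constant.) Laguerre geometry of a non-zero null $\mathfrak{q}_\infty$: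 choose $\mathfrak{q}_0\in\mathcal{L}$ with $(\mathfrak{q}_0,\mathfrak{q}_\infty)=-1$ and $\mathfrak{p}\in\langle\mathfrak{q}_0,\mathfrak{q}_\infty\rangle^\perp$ with $(\mathfrak{p},\mathfrak{p})=-1$; $\langle\mathfrak{q}_0,\mathfrak{q}_\infty,\mathfrak{p}\rangle^\perp\cong\mathbb{R}^3$. $f$ projects to $x:\Sigma\to\mathbb{R}^3$ with unit normal $n:\Sigma\to S^2$ (and is its Legendre lift) if $f=\langle\mathfrak{f},\mathfrak{t}\rangle$ with $\mathfrak{f}=x+\mathfrak{q}_0+\frac12(x,x)\mathfrak{q}_\infty$, $\mathfrak{t}=n+\mathfrak{p}+(n,x)\mathfrak{q}_\infty$. $x$ is $L$-isothermic if $I\!I\!I=(dn,dn)$ is non-degenerate and there is a non-zero quadratic differential $q$, holomorphic for the complex structure of $I\!I\!I$ (real, trace-free with $q^{2,0}$ holomorphic), with $I\!I^{2,0}=\mu q^{2,0}$ for a real function $\mu$, where $I\!I=-(dx,dn)$; equivalently $x$ admits curvature line coordinates that are conformal for $I\!I\!I$. *)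

theory Defs
  imports "HOL-Analysis.Analysis"
begin

section \<open>Smooth surfaces\<close>

text \<open>For open \<open>S\<close>: \<open>k\<close> times continuously differentiable.\<close>

primrec Ck_on ::
  "nat \<Rightarrow> 'a::real_normed_vector set \<Rightarrow> ('a \<Rightarrow> 'b::real_normed_vector) \<Rightarrow> bool" where
  "Ck_on 0 S f \<longleftrightarrow> continuous_on S f"
| "Ck_on (Suc k) S f \<longleftrightarrow>
     (\<forall>x\<in>S. f differentiable (at x)) \<and>
     (\<forall>v. Ck_on k S (\<lambda>x. frechet_derivative f (at x) v))"

definition smooth_on ::
  "'a::real_normed_vector set \<Rightarrow> ('a \<Rightarrow> 'b::real_normed_vector) \<Rightarrow> bool" where
  "smooth_on S f \<longleftrightarrow> (\<forall>k. Ck_on k S f)"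

text \<open>A chart is a pair of its domain and the coordinate map (irrelevant off the domain).
  The surface itself is the whole type \<open>'m\<close>; Hausdorff and second countable are imposed
  by type classes.\<close>

type_synonym 'm chart = "'m set \<times> ('m \<Rightarrow> real ^ 2)"

definition smooth_atlas ::
  "('m::{t2_space, second_countable_topology}) chart set \<Rightarrow> bool" where
  "smooth_atlas A \<longleftrightarrow>
     (\<forall>(D, \<phi>)\<in>A. open D \<and> open (\<phi> ` D) \<and> homeomorphism D (\<phi> ` D) \<phi> (inv_into D \<phi>)) \<and>
     (\<Union>(D, \<phi>)\<in>A. D) = UNIV \<and>
     (\<forall>(D, \<phi>)\<in>A. \<forall>(D', \<phi>')\<in>A. smooth_on (\<phi> ` (D \<inter> D')) (\<phi>' \<circ> inv_into D \<phi>))"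

definition smooth_map ::
  "('m::{t2_space, second_countable_topology}) chart set \<Rightarrow> 'm set
     \<Rightarrow> ('m \<Rightarrow> 'v::real_normed_vector) \<Rightarrow> bool" where
  "smooth_map A N g \<longleftrightarrow> (\<forall>(D, \<phi>)\<in>A. smooth_on (\<phi> ` (D \<inter> N)) (g \<circ> inv_into D \<phi>))"

definition smooth_at ::
  "('m::{t2_space, second_countable_topology}) chart set \<Rightarrow> 'm
     \<Rightarrow> ('m \<Rightarrow> 'v::real_normed_vector) \<Rightarrow> bool" where
  "smooth_at A p g \<longleftrightarrow> (\<exists>N. open N \<and> p \<in> N \<and> smooth_map A N g)"

text \<open>A tangent vector at \<open>p\<close> is the operation of differentiating functions at \<open>p\<close> along
  some coordinate direction; the value 0 on functions not smooth near \<open>p\<close> is a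
  normalisation that makes the operator independent of the chart used to write it.\<close>

type_synonym 'm tangent = "('m \<Rightarrow> real) \<Rightarrow> real"

definition tangent_space ::
  "('m::{t2_space, second_countable_topology}) chart set \<Rightarrow> 'm \<Rightarrow> 'm tangent set" where
  "tangent_space A p =
     {X. \<exists>(D, \<phi>)\<in>A. \<exists>v. p \<in> D \<and>
        X = (\<lambda>g. if smooth_at A p g
                 then frechet_derivative (g \<circ> inv_into D \<phi>) (at (\<phi> p)) v else 0)}"

definition zero_vec :: "'m tangent" where
  "zero_vec = (\<lambda>g. 0)"

definition lin_comb :: "real \<Rightarrow> 'm tangent \<Rightarrow> real \<Rightarrow> 'm tangent \<Rightarrow> 'm tangent" where
  "lin_comb a X b Y = (\<lambda>g. a * X g + b * Y g)"

text \<open>The trivial connection: \<open>dd X \<sigma>\<close> is the derivative of the vector valued function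
  \<open>\<sigma>\<close> along the tangent vector \<open>X\<close>.\<close>

definition dd :: "'m tangent \<Rightarrow> ('m \<Rightarrow> 'v::euclidean_space) \<Rightarrow> 'v" where
  "dd X \<sigma> = (\<Sum>b\<in>Basis. X (\<lambda>r. \<sigma> r \<bullet> b) *\<^sub>R b)"

definition vector_field ::
  "('m::{t2_space, second_countable_topology}) chart set \<Rightarrow> 'm set
     \<Rightarrow> ('m \<Rightarrow> 'm tangent) \<Rightarrow> bool" where
  "vector_field A N X \<longleftrightarrow>
     (\<forall>r\<in>N. X r \<in> tangent_space A r) \<and>
     (\<forall>V g. open V \<and> V \<subseteq> N \<and> smooth_map A V g \<longrightarrow> smooth_map A V (\<lambda>r. X r g))"

definition lie_bracket ::
  "('m::{t2_space, second_countable_topology}) chart set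
     \<Rightarrow> ('m \<Rightarrow> 'm tangent) \<Rightarrow> ('m \<Rightarrow> 'm tangent) \<Rightarrow> 'm \<Rightarrow> 'm tangent" where
  "lie_bracket A X Y p =
     (\<lambda>g. if smooth_at A p g then X p (\<lambda>r. Y r g) - Y p (\<lambda>r. X r g) else 0)"

definition tangent_line_subbundle ::
  "('m::{t2_space, second_countable_topology}) chart set \<Rightarrow> ('m \<Rightarrow> 'm tangent set) \<Rightarrow> bool" where
  "tangent_line_subbundle A L \<longleftrightarrow>
     (\<forall>p. \<exists>N X. open N \<and> p \<in> N \<and> vector_field A N X \<and>
        (\<forall>r\<in>N. X r \<noteq> zero_vec \<and> L r = {lin_comb a (X r) 0 (X r) | a. True}))"

definition bilinear_at ::
  "('m::{t2_space, second_countable_topology}) chart set \<Rightarrow> 'm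
     \<Rightarrow> ('m tangent \<Rightarrow> 'm tangent \<Rightarrow> real) \<Rightarrow> bool" where
  "bilinear_at A p b \<longleftrightarrow>
     (\<forall>X\<in>tangent_space A p. \<forall>Y\<in>tangent_space A p. \<forall>Z\<in>tangent_space A p. \<forall>s t.
        b (lin_comb s X t Y) Z = s * b X Z + t * b Y Z \<and>
        b Z (lin_comb s X t Y) = s * b Z X + t * b Z Y)"

definition symmetric_at ::
  "('m::{t2_space, second_countable_topology}) chart set \<Rightarrow> 'm
     \<Rightarrow> ('m tangent \<Rightarrow> 'm tangent \<Rightarrow> real) \<Rightarrow> bool" where
  "symmetric_at A p b \<longleftrightarrow>
     (\<forall>X\<in>tangent_space A p. \<forall>Y\<in>tangent_space A p. b X Y = b Y X)"

definition nondegenerate_at ::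
  "('m::{t2_space, second_countable_topology}) chart set \<Rightarrow> 'm
     \<Rightarrow> ('m tangent \<Rightarrow> 'm tangent \<Rightarrow> real) \<Rightarrow> bool" where
  "nondegenerate_at A p b \<longleftrightarrow>
     (\<forall>X\<in>tangent_space A p. X \<noteq> zero_vec \<longrightarrow> (\<exists>Y\<in>tangent_space A p. b X Y \<noteq> 0))"

text \<open>Sylvester normal form at every point, with the same signs at all points.\<close>

definition constant_signature ::
  "('m::{t2_space, second_countable_topology}) chart set
     \<Rightarrow> ('m \<Rightarrow> 'm tangent \<Rightarrow> 'm tangent \<Rightarrow> real) \<Rightarrow> bool" where
  "constant_signature A q \<longleftrightarrow>
     (\<exists>s1 s2. \<forall>p. \<exists>X Y. tangent_space A p = {lin_comb a X b Y | a b. True} \<and>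
        q p X Y = 0 \<and> q p Y X = 0 \<and> sgn (q p X X) = s1 \<and> sgn (q p Y Y) = s2)"


section \<open>The space of signature (4,2)\<close>

type_synonym R42 = "(real ^ 4) \<times> (real ^ 2)"

definition lform :: "R42 \<Rightarrow> R42 \<Rightarrow> real" where
  "lform a b = fst a \<bullet> fst b - snd a \<bullet> snd b"

definition perp :: "R42 set \<Rightarrow> R42 set" where
  "perp W = {v. \<forall>w\<in>W. lform v w = 0}"

definition isotropic :: "R42 set \<Rightarrow> bool" where
  "isotropic W \<longleftrightarrow> (\<forall>v\<in>W. \<forall>w\<in>W. lform v w = 0)"

definition lightcone :: "R42 set" where
  "lightcone = {v. lform v v = 0}"

text \<open>Elements of \<open>\<Lambda>\<^sup>2\<close> are identified with skew endomorphisms.\<close>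

definition wedge :: "R42 \<Rightarrow> R42 \<Rightarrow> R42 \<Rightarrow>\<^sub>L R42" where
  "wedge a b = Blinfun (\<lambda>c. lform a c *\<^sub>R b - lform b c *\<^sub>R a)"

lemma wedge_apply: "blinfun_apply (wedge a b) c = lform a c *\<^sub>R b - lform b c *\<^sub>R a"
proof -
  have "linear (\<lambda>c. lform a c *\<^sub>R b - lform b c *\<^sub>R a)"
    by (rule linearI) (auto simp: lform_def algebra_simps inner_add_right)
  then show ?thesis
    unfolding wedge_def by (simp add: bounded_linear_Blinfun_apply linear_linear)
qed

definition wedge_space :: "R42 set \<Rightarrow> R42 set \<Rightarrow> (R42 \<Rightarrow>\<^sub>L R42) set" where
  "wedge_space V W = span {wedge a b | a b. a \<in> V \<and> b \<in> W}"

text \<open>The Lie sphere transformations.\<close>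

definition O42 :: "(R42 \<Rightarrow>\<^sub>L R42) set" where
  "O42 = {g. \<forall>a b. lform (blinfun_apply g a) (blinfun_apply g b) = lform a b}"

definition smooth_endo ::
  "('m::{t2_space, second_countable_topology}) chart set \<Rightarrow> 'm set
     \<Rightarrow> ('m \<Rightarrow> R42 \<Rightarrow>\<^sub>L R42) \<Rightarrow> bool" where
  "smooth_endo A N L \<longleftrightarrow> (\<forall>c. smooth_map A N (\<lambda>r. blinfun_apply (L r) c))"

definition subbundle ::
  "('m::{t2_space, second_countable_topology}) chart set \<Rightarrow> 'm set \<Rightarrow> nat
     \<Rightarrow> ('m \<Rightarrow> R42 set) \<Rightarrow> bool" where
  "subbundle A U k W \<longleftrightarrow>
     (\<forall>p\<in>U. \<exists>N \<sigma>. open N \<and> p \<in> N \<and> N \<subseteq> U \<and> (\<forall>i<k. smooth_map A N (\<sigma> i)) \<and>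
        (\<forall>r\<in>N. W r = span ((\<lambda>i. \<sigma> i r) ` {..<k}) \<and> dim (W r) = k))"

text \<open>Sections defined near \<open>p\<close>.\<close>

definition local_section ::
  "('m::{t2_space, second_countable_topology}) chart set \<Rightarrow> ('m \<Rightarrow> R42 set) \<Rightarrow> 'm
     \<Rightarrow> ('m \<Rightarrow> R42) \<Rightarrow> bool" where
  "local_section A W p \<sigma> \<longleftrightarrow>
     (\<exists>N. open N \<and> p \<in> N \<and> smooth_map A N \<sigma> \<and> (\<forall>r\<in>N. \<sigma> r \<in> W r))"

definition derived_bundle ::
  "('m::{t2_space, second_countable_topology}) chart set \<Rightarrow> ('m \<Rightarrow> R42 set) \<Rightarrow> 'm \<Rightarrow> R42 set" where
  "derived_bundle A W p =
     span ({\<sigma> p | \<sigma>. local_section A W p \<sigma>} \<union>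
           {dd X \<sigma> | X \<sigma>. X \<in> tangent_space A p \<and> local_section A W p \<sigma>})"


section \<open>Legendre maps and curvature spheres\<close>

definition legendre_map ::
  "('m::{t2_space, second_countable_topology}) chart set \<Rightarrow> 'm set \<Rightarrow> ('m \<Rightarrow> R42 set) \<Rightarrow> bool" where
  "legendre_map A U f \<longleftrightarrow>
     subbundle A U 2 f \<and> (\<forall>p\<in>U. isotropic (f p)) \<and>
     (\<forall>p\<in>U. derived_bundle A f p \<subseteq> perp (f p)) \<and>
     (\<forall>p\<in>U. \<forall>X\<in>tangent_space A p.
        (\<forall>\<sigma>. local_section A f p \<sigma> \<longrightarrow> dd X \<sigma> \<in> f p) \<longrightarrow> X = zero_vec)"

text \<open>The largest subspace of tangent directions along which \<open>\<sigma> \<mapsto> dd X \<sigma>\<close> mod \<open>f\<close> kills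
  the line \<open>l\<close> in \<open>f p\<close>.\<close>

definition curvature_space ::
  "('m::{t2_space, second_countable_topology}) chart set \<Rightarrow> ('m \<Rightarrow> R42 set) \<Rightarrow> 'm \<Rightarrow> R42 set
     \<Rightarrow> 'm tangent set" where
  "curvature_space A f p l =
     {X\<in>tangent_space A p. \<forall>\<sigma>. local_section A f p \<sigma> \<and> \<sigma> p \<in> l \<longrightarrow> dd X \<sigma> \<in> f p}"

definition curvature_sphere ::
  "('m::{t2_space, second_countable_topology}) chart set \<Rightarrow> ('m \<Rightarrow> R42 set) \<Rightarrow> 'm \<Rightarrow> R42 set
     \<Rightarrow> bool" where
  "curvature_sphere A f p l \<longleftrightarrow>
     subspace l \<and> dim l = 1 \<and> l \<subseteq> f p \<and> (\<exists>X\<in>curvature_space A f p l. X \<noteq> zero_vec)"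

definition umbilic_free ::
  "('m::{t2_space, second_countable_topology}) chart set \<Rightarrow> ('m \<Rightarrow> R42 set)
     \<Rightarrow> ('m \<Rightarrow> R42 set) \<Rightarrow> ('m \<Rightarrow> R42 set)
     \<Rightarrow> ('m \<Rightarrow> 'm tangent set) \<Rightarrow> ('m \<Rightarrow> 'm tangent set) \<Rightarrow> bool" where
  "umbilic_free A f s1 s2 T1 T2 \<longleftrightarrow>
     (\<forall>p. {l. curvature_sphere A f p l} = {s1 p, s2 p} \<and> s1 p \<noteq> s2 p) \<and>
     subbundle A UNIV 1 s1 \<and> subbundle A UNIV 1 s2 \<and>
     (\<forall>p. T1 p = curvature_space A f p (s1 p) \<and> T2 p = curvature_space A f p (s2 p)) \<and>
     tangent_line_subbundle A T1 \<and> tangent_line_subbundle A T2"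


section \<open>Gauge potentials\<close>

type_synonym 'm form1 = "'m \<Rightarrow> 'm tangent \<Rightarrow> R42 \<Rightarrow>\<^sub>L R42"

definition one_form ::
  "('m::{t2_space, second_countable_topology}) chart set \<Rightarrow> 'm form1 \<Rightarrow> bool" where
  "one_form A \<eta> \<longleftrightarrow>
     (\<forall>p. \<forall>X\<in>tangent_space A p. \<forall>Y\<in>tangent_space A p. \<forall>a b.
        \<eta> p (lin_comb a X b Y) = a *\<^sub>R \<eta> p X + b *\<^sub>R \<eta> p Y) \<and>
     (\<forall>N X. open N \<and> vector_field A N X \<longrightarrow> smooth_endo A N (\<lambda>r. \<eta> r (X r)))"

text \<open>\<open>d\<eta>(X,Y) = d\<^sub>X(\<eta>(Y)) - d\<^sub>Y(\<eta>(X)) - \<eta>([X,Y])\<close>, tested on constant vectors.\<close>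

definition closed_form ::
  "('m::{t2_space, second_countable_topology}) chart set \<Rightarrow> 'm form1 \<Rightarrow> bool" where
  "closed_form A \<eta> \<longleftrightarrow>
     (\<forall>N X Y. open N \<and> vector_field A N X \<and> vector_field A N Y \<longrightarrow>
        (\<forall>r\<in>N. \<forall>c.
           dd (X r) (\<lambda>s. blinfun_apply (\<eta> s (Y s)) c)
           - dd (Y r) (\<lambda>s. blinfun_apply (\<eta> s (X s)) c)
           - blinfun_apply (\<eta> r (lie_bracket A X Y r)) c = 0))"

definition trace_on :: "R42 set \<Rightarrow> (R42 \<Rightarrow> R42) \<Rightarrow> real" where
  "trace_on W L =
     (let B = (SOME B. independent B \<and> span B = W) in \<Sum>b\<in>B. representation B (L b) b)"

text \<open>The quadratic differential of \<open>\<eta>\<close>. As \<open>\<eta>(X)\<close> vanishes on \<open>f\<close>, the vector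
  \<open>\<eta>(X) d\<^sub>Y \<sigma>\<close> depends only on the value of the section \<open>\<sigma>\<close> at the point.\<close>

definition gauge_q ::
  "('m::{t2_space, second_countable_topology}) chart set \<Rightarrow> ('m \<Rightarrow> R42 set) \<Rightarrow> 'm form1
     \<Rightarrow> 'm \<Rightarrow> 'm tangent \<Rightarrow> 'm tangent \<Rightarrow> real" where
  "gauge_q A f \<eta> p X Y =
     trace_on (f p)
       (\<lambda>v. blinfun_apply (\<eta> p X) (dd Y (SOME \<sigma>. local_section A f p \<sigma> \<and> \<sigma> p = v)))"

text \<open>\<open>[\<eta> \<and> \<eta>](X,Y) = 2 [\<eta>(X), \<eta>(Y)]\<close>.\<close>

definition gauge_potential ::
  "('m::{t2_space, second_countable_topology}) chart set \<Rightarrow> ('m \<Rightarrow> R42 set) \<Rightarrow> 'm form1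
     \<Rightarrow> bool" where
  "gauge_potential A f \<eta> \<longleftrightarrow>
     one_form A \<eta> \<and>
     (\<forall>p. \<forall>X\<in>tangent_space A p. \<eta> p X \<in> wedge_space (f p) (perp (f p))) \<and>
     closed_form A \<eta> \<and>
     (\<forall>p. \<forall>X\<in>tangent_space A p. \<forall>Y\<in>tangent_space A p.
        (\<eta> p X o\<^sub>L \<eta> p Y) - (\<eta> p Y o\<^sub>L \<eta> p X) = 0) \<and>
     (\<exists>p. \<exists>X\<in>tangent_space A p. \<exists>Y\<in>tangent_space A p. gauge_q A f \<eta> p X Y \<noteq> 0) \<and>
     constant_signature A (gauge_q A f \<eta>)"

definition Omega_surface ::
  "('m::{t2_space, second_countable_topology}) chart set \<Rightarrow> ('m \<Rightarrow> R42 set) \<Rightarrow> 'm form1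
     \<Rightarrow> bool" where
  "Omega_surface A f \<eta> \<longleftrightarrow>
     legendre_map A UNIV f \<and> gauge_potential A f \<eta> \<and>
     (\<exists>G. open G \<and> closure G = UNIV \<and> (\<forall>p\<in>G. nondegenerate_at A p (gauge_q A f \<eta> p)))"

text \<open>The bundle \<open>\<langle>\<sigma>, d\<^sub>Y \<sigma>, d\<^sub>Y d\<^sub>Y \<sigma>\<rangle>\<close> for sections \<open>\<sigma>\<close> of \<open>s\<close> and \<open>Y\<close> of \<open>T\<close>.\<close>

definition cyclide_bundle ::
  "('m::{t2_space, second_countable_topology}) chart set \<Rightarrow> ('m \<Rightarrow> R42 set)
     \<Rightarrow> ('m \<Rightarrow> 'm tangent set) \<Rightarrow> 'm \<Rightarrow> R42 set" where
  "cyclide_bundle A s T p =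
     span (\<Union>{{\<sigma> p, dd (Y p) \<sigma>, dd (Y p) (\<lambda>r. dd (Y r) \<sigma>)} | \<sigma> Y.
        local_section A s p \<sigma> \<and>
        (\<exists>N. open N \<and> p \<in> N \<and> vector_field A N Y \<and> (\<forall>r\<in>N. Y r \<in> T r))})"

definition in_gauge_orbit ::
  "('m::{t2_space, second_countable_topology}) chart set \<Rightarrow> ('m \<Rightarrow> R42 set)
     \<Rightarrow> 'm form1 \<Rightarrow> 'm form1 \<Rightarrow> bool" where
  "in_gauge_orbit A f \<eta> \<eta>' \<longleftrightarrow>
     (\<exists>\<tau>. smooth_endo A UNIV \<tau> \<and> (\<forall>p. \<tau> p \<in> wedge_space (f p) (f p)) \<and>
        (\<forall>p. \<forall>X\<in>tangent_space A p. \<forall>c.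
           blinfun_apply (\<eta>' p X) c
             = blinfun_apply (\<eta> p X) c - dd X (\<lambda>r. blinfun_apply (\<tau> r) c)))"

text \<open>Below \<open>\<beta>\<close> is the component of \<open>\<eta>'(X)\<close> in \<open>S\<^sub>1 \<and> S\<^sub>2\<close> with respect to
  \<open>\<Lambda>\<^sup>2 = (\<Lambda>\<^sup>2S\<^sub>1 \<oplus> \<Lambda>\<^sup>2S\<^sub>2) \<oplus> S\<^sub>1 \<and> S\<^sub>2\<close>. Note the crossed pairing of the curvature spheres
  with the curvature subbundles in \<open>S\<^sub>1\<close> and \<open>S\<^sub>2\<close>.\<close>

definition middle_potential ::
  "('m::{t2_space, second_countable_topology}) chart set \<Rightarrow> ('m \<Rightarrow> R42 set)
     \<Rightarrow> ('m \<Rightarrow> R42 set) \<Rightarrow> ('m \<Rightarrow> R42 set)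
     \<Rightarrow> ('m \<Rightarrow> 'm tangent set) \<Rightarrow> ('m \<Rightarrow> 'm tangent set)
     \<Rightarrow> 'm form1 \<Rightarrow> 'm form1 \<Rightarrow> bool" where
  "middle_potential A f s1 s2 T1 T2 \<eta> \<eta>' \<longleftrightarrow>
     in_gauge_orbit A f \<eta> \<eta>' \<and>
     (\<forall>p. \<forall>X\<in>tangent_space A p.
        let S1 = cyclide_bundle A s1 T2 p; S2 = cyclide_bundle A s2 T1 p in
        \<exists>\<alpha>\<in>span (wedge_space S1 S1 \<union> wedge_space S2 S2). \<exists>\<beta>\<in>wedge_space S1 S2.
          \<eta>' p X = \<alpha> + \<beta> \<and> \<beta> \<in> wedge_space (f p) (f p))"

text \<open>\<open>p\<close> is a degree 1 polynomial conserved quantity of the pencil \<open>d + t \<eta>\<close>.\<close>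

definition linear_conserved_quantity ::
  "('m::{t2_space, second_countable_topology}) chart set \<Rightarrow> 'm form1
     \<Rightarrow> (real \<Rightarrow> 'm \<Rightarrow> R42) \<Rightarrow> bool" where
  "linear_conserved_quantity A \<eta> p \<longleftrightarrow>
     (\<exists>p0 p1. smooth_map A UNIV p0 \<and> smooth_map A UNIV p1 \<and> (\<exists>r. p1 r \<noteq> 0) \<and>
        (\<forall>t r. p t r = p0 r + t *\<^sub>R p1 r)) \<and>
     (\<forall>t r. \<forall>X\<in>tangent_space A r. dd X (p t) + t *\<^sub>R blinfun_apply (\<eta> r X) (p t r) = 0)"

text \<open>\<open>T\<close> is a gauge transformation over \<open>U\<close> with \<open>T \<circ> (d + t \<eta>) \<circ> T\<^sup>-\<^sup>1 = d\<close>.\<close>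

definition trivialising_gauge ::
  "('m::{t2_space, second_countable_topology}) chart set \<Rightarrow> 'm set \<Rightarrow> 'm form1 \<Rightarrow> real
     \<Rightarrow> ('m \<Rightarrow> R42 \<Rightarrow>\<^sub>L R42) \<Rightarrow> bool" where
  "trivialising_gauge A U \<eta> t T \<longleftrightarrow>
     smooth_endo A U T \<and> (\<forall>r\<in>U. T r \<in> O42) \<and>
     (\<forall>r\<in>U. \<forall>X\<in>tangent_space A r. \<forall>\<sigma>. smooth_at A r \<sigma> \<longrightarrow>
        blinfun_apply (T r)
          (dd X (\<lambda>s. inv (blinfun_apply (T s)) (\<sigma> s))
           + t *\<^sub>R blinfun_apply (\<eta> r X) (inv (blinfun_apply (T r)) (\<sigma> r)))
        = dd X \<sigma>)"

definition calapso_transform ::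
  "('m \<Rightarrow> R42 \<Rightarrow>\<^sub>L R42) \<Rightarrow> ('m \<Rightarrow> R42 set) \<Rightarrow> 'm \<Rightarrow> R42 set" where
  "calapso_transform T f = (\<lambda>r. blinfun_apply (T r) ` f r)"


section \<open>Laguerre geometry\<close>

definition laguerre_frame :: "R42 \<Rightarrow> R42 \<Rightarrow> R42 \<Rightarrow> bool" where
  "laguerre_frame qinf q0 \<pp> \<longleftrightarrow>
     qinf \<noteq> 0 \<and> qinf \<in> lightcone \<and> q0 \<in> lightcone \<and> lform q0 qinf = -1 \<and>
     \<pp> \<in> perp {q0, qinf} \<and> lform \<pp> \<pp> = -1"

text \<open>Euclidean 3-space is the positive definite subspace \<open>\<langle>q0, qinf, \<pp>\<rangle>\<^sup>\<bottom>\<close>.\<close>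

definition legendre_lift ::
  "('m::{t2_space, second_countable_topology}) chart set \<Rightarrow> 'm set \<Rightarrow> R42 \<Rightarrow> R42 \<Rightarrow> R42
     \<Rightarrow> ('m \<Rightarrow> R42 set) \<Rightarrow> ('m \<Rightarrow> R42) \<Rightarrow> ('m \<Rightarrow> R42) \<Rightarrow> bool" where
  "legendre_lift A U qinf q0 \<pp> f x n \<longleftrightarrow>
     legendre_map A U f \<and> smooth_map A U x \<and> smooth_map A U n \<and>
     (\<forall>r\<in>U. x r \<in> perp {q0, qinf, \<pp>} \<and> n r \<in> perp {q0, qinf, \<pp>} \<and> lform (n r) (n r) = 1) \<and>
     (\<forall>r\<in>U. \<forall>X\<in>tangent_space A r. lform (dd X x) (n r) = 0) \<and>
     (\<forall>r\<in>U. f r = span {x r + q0 + (lform (x r) (x r) / 2) *\<^sub>R qinf,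
                         n r + \<pp> + lform (n r) (x r) *\<^sub>R qinf})"

definition second_form :: "('m \<Rightarrow> R42) \<Rightarrow> ('m \<Rightarrow> R42) \<Rightarrow> 'm tangent \<Rightarrow> 'm tangent \<Rightarrow> real" where
  "second_form x n X Y = - lform (dd X x) (dd Y n)"

definition third_form :: "('m \<Rightarrow> R42) \<Rightarrow> 'm tangent \<Rightarrow> 'm tangent \<Rightarrow> real" where
  "third_form n X Y = lform (dd X n) (dd Y n)"

text \<open>\<open>z\<close> is a local complex coordinate on \<open>N\<close> in which the metric \<open>g\<close> is \<open>\<rho> |dz|\<^sup>2\<close>. Such
  coordinates are holomorphic or antiholomorphic for the complex structure of \<open>g\<close>; no
  orientation is needed, since passing to the conjugate coordinate conjugates (2,0)-parts
  and changes neither holomorphicity below nor a relation \<open>II\<^sup>2\<^sup>,\<^sup>0 = \<mu> q\<^sup>2\<^sup>,\<^sup>0\<close> with real \<open>\<mu>\<close>.\<close>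

definition conformal_coordinate ::
  "('m::{t2_space, second_countable_topology}) chart set
     \<Rightarrow> ('m \<Rightarrow> 'm tangent \<Rightarrow> 'm tangent \<Rightarrow> real) \<Rightarrow> 'm set \<Rightarrow> ('m \<Rightarrow> complex) \<Rightarrow> bool" where
  "conformal_coordinate A g N z \<longleftrightarrow>
     open N \<and> smooth_map A N z \<and> inj_on z N \<and>
     (\<forall>r\<in>N. bij_betw (\<lambda>X. dd X z) (tangent_space A r) UNIV) \<and>
     (\<forall>r\<in>N. \<exists>\<rho>>0. \<forall>X\<in>tangent_space A r. \<forall>Y\<in>tangent_space A r.
        g r X Y = \<rho> * Re (dd X z * cnj (dd Y z)))"

text \<open>The tangent vector at \<open>r\<close> with \<open>dz = w\<close>; for \<open>w = 1\<close> and \<open>w = \<i>\<close> these are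
  \<open>\<partial>\<^sub>u\<close> and \<open>\<partial>\<^sub>v\<close>, where \<open>z = u + \<i>v\<close>.\<close>

definition coord_vec ::
  "('m::{t2_space, second_countable_topology}) chart set \<Rightarrow> ('m \<Rightarrow> complex) \<Rightarrow> 'm \<Rightarrow> complex
     \<Rightarrow> 'm tangent" where
  "coord_vec A z r w = inv_into (tangent_space A r) (\<lambda>X. dd X z) w"

text \<open>The coefficient \<open>b(\<partial>\<^sub>z,\<partial>\<^sub>z)\<close> of \<open>b\<^sup>2\<^sup>,\<^sup>0 = b(\<partial>\<^sub>z,\<partial>\<^sub>z) dz\<^sup>2\<close>, where
  \<open>\<partial>\<^sub>z = (\<partial>\<^sub>u - \<i>\<partial>\<^sub>v)/2\<close>.\<close>

definition part20 ::
  "('m::{t2_space, second_countable_topology}) chart set \<Rightarrow> ('m \<Rightarrow> complex) \<Rightarrow> 'm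
     \<Rightarrow> ('m tangent \<Rightarrow> 'm tangent \<Rightarrow> real) \<Rightarrow> complex" where
  "part20 A z r b =
     (let u = coord_vec A z r 1; v = coord_vec A z r \<i>
      in Complex ((b u u - b v v) / 4) (- b u v / 2))"

definition trace_free ::
  "('m::{t2_space, second_countable_topology}) chart set \<Rightarrow> ('m \<Rightarrow> complex) \<Rightarrow> 'm
     \<Rightarrow> ('m tangent \<Rightarrow> 'm tangent \<Rightarrow> real) \<Rightarrow> bool" where
  "trace_free A z r b \<longleftrightarrow>
     b (coord_vec A z r 1) (coord_vec A z r 1) + b (coord_vec A z r \<i>) (coord_vec A z r \<i>) = 0"

text \<open>\<open>q\<close> is a real quadratic differential over \<open>U\<close>, trace-free with holomorphic
  (2,0)-part for the complex structure of \<open>g\<close>.\<close>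

definition holomorphic_quadratic_differential ::
  "('m::{t2_space, second_countable_topology}) chart set \<Rightarrow> 'm set
     \<Rightarrow> ('m \<Rightarrow> 'm tangent \<Rightarrow> 'm tangent \<Rightarrow> real)
     \<Rightarrow> ('m \<Rightarrow> 'm tangent \<Rightarrow> 'm tangent \<Rightarrow> real) \<Rightarrow> bool" where
  "holomorphic_quadratic_differential A U g q \<longleftrightarrow>
     (\<forall>r\<in>U. bilinear_at A r (q r) \<and> symmetric_at A r (q r)) \<and>
     (\<forall>r\<in>U. \<exists>N z. r \<in> N \<and> N \<subseteq> U \<and> conformal_coordinate A g N z \<and>
        (\<forall>s\<in>N. trace_free A z s (q s)) \<and>
        (\<lambda>w. part20 A z (inv_into N z w) (q (inv_into N z w))) holomorphic_on (z ` N))"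

definition L_isothermic ::
  "('m::{t2_space, second_countable_topology}) chart set \<Rightarrow> 'm set
     \<Rightarrow> ('m \<Rightarrow> R42) \<Rightarrow> ('m \<Rightarrow> R42) \<Rightarrow> bool" where
  "L_isothermic A U x n \<longleftrightarrow>
     (\<forall>r\<in>U. nondegenerate_at A r (third_form n)) \<and>
     (\<exists>q \<mu>. holomorphic_quadratic_differential A U (\<lambda>r. third_form n) q \<and>
        (\<exists>r\<in>U. \<exists>X\<in>tangent_space A r. \<exists>Y\<in>tangent_space A r. q r X Y \<noteq> 0) \<and>
        (\<forall>N z. N \<subseteq> U \<and> conformal_coordinate A (\<lambda>r. third_form n) N z \<longrightarrow>
           (\<forall>r\<in>N. part20 A z r (second_form x n) = complex_of_real (\<mu> r) * part20 A z r (q r))))"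

end

theory Submission
  imports Defs
begin

text \<open>Write \<open>f = \<langle>F, G\<rangle>\<close> with the point sphere map \<open>F\<close> and the tangent plane map \<open>G\<close>, and \<open>p(t) = qinf + t p\<^sub>1\<close>.
  The theorem rests on the fact that \<open>p\<^sub>1\<close> is a multiple of \<open>G\<close>. Once this is known, \<open>T = T(t)\<close> maps \<open>f\<close> to
  a Legendre map, because the potential vanishes on \<open>f\<close> and so \<open>d(T\<sigma>) = T(d\<sigma>)\<close> for sections \<open>\<sigma>\<close> of \<open>f\<close>.
  Moreover \<open>(TF, qinf) = (F, p(t)) = -1\<close> and \<open>(TG, qinf) = (G, p(t)) = 0\<close>, so that the normalised frame of
  \<open>Tf\<close> is \<open>TF + b TG\<close>, \<open>k\<^sup>-\<^sup>1 TG\<close> for functions \<open>k\<close> and \<open>b\<close> determined by the products with \<open>\<pp>\<close>. Here \<open>k\<close> has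
  no zeros because \<open>p(t)\<close> is nowhere in \<open>f\<close>. As \<open>II = - (dF, dG)\<close> and \<open>III = (dG, dG)\<close>, the fundamental forms
  of the transform are \<open>III' = k\<^sup>-\<^sup>2 III\<close> and \<open>II' = k\<^sup>-\<^sup>1 (II - b III)\<close>. Thus the conformal structure is the
  same, \<open>II'\<^sup>2\<^sup>,\<^sup>0 = k\<^sup>-\<^sup>1 II\<^sup>2\<^sup>,\<^sup>0\<close>, and the holomorphic quadratic differential of the surface serves for the
  transform as well (\<open>L_isothermic_rescale\<close>, \<open>calapso_L_isothermic\<close>). Its zeros would be umbilic points, so
  it does not vanish identically on any nonempty open set.\<close>

text \<open>That \<open>p\<^sub>1\<close> is a multiple of \<open>G\<close> (\<open>conserved_quantity_form\<close>) uses the shape of the middle potential. With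
  sections \<open>\<sigma>\<^sub>i\<close> of the curvature spheres and fields \<open>X\<close>, \<open>Y\<close> along the curvature directions, it is
  \<open>\<eta>(Z) = a(Z) \<sigma>\<^sub>1 \<and> d\<^sub>Y\<sigma>\<^sub>1 + b(Z) \<sigma>\<^sub>2 \<and> d\<^sub>X\<sigma>\<^sub>2 + c(Z) \<sigma>\<^sub>1 \<and> \<sigma>\<^sub>2\<close> (\<open>mid_form\<close>): its components in \<open>\<Lambda>\<^sup>2S\<^sub>1\<close> and \<open>\<Lambda>\<^sup>2S\<^sub>2\<close>
  annihilate the curvature spheres, and this excludes second derivatives. If \<open>a\<close> or \<open>b\<close> vanished at a point,
  the quadratic form \<open>q\<close>, which is invariant in the gauge orbit (\<open>gauge_q_mid\<close>), would have rank at most one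
  there. But \<open>q\<close> is nondegenerate at some points and its signature is constant. The terms of degree 2 in
  \<open>t\<close> of the conservation law say that \<open>\<eta> p\<^sub>1 = 0\<close>. As \<open>a\<close> and \<open>b\<close> are not zero and \<open>d\<^sub>Y\<sigma>\<^sub>1\<close>, \<open>d\<^sub>X\<sigma>\<^sub>2\<close> are independent
  modulo \<open>f\<close>, it follows that \<open>p\<^sub>1\<close> is orthogonal to \<open>f\<close> (\<open>annihilated_perp\<close>). Being null, it lies in \<open>f\<close>, since
  \<open>f\<^sup>\<bottom> / f\<close> is positive definite; being orthogonal to \<open>qinf\<close>, it is a multiple of \<open>G\<close>.\<close>

section \<open>Calculus of smooth maps\<close>

lemma Ck_on_cong:
  fixes f g :: "'a::real_normed_vector \<Rightarrow> 'b::real_normed_vector"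
  assumes "open S" "Ck_on k S f" "\<And>x. x \<in> S \<Longrightarrow> f x = g x"
  shows "Ck_on k S g"
  using assms(2,3)
proof (induction k arbitrary: f g)
  case 0
  then show ?case using continuous_on_cong by fastforce
next
  case (Suc k)
  have *: "(g has_derivative frechet_derivative f (at x)) (at x)" if "x \<in> S" for x
    using has_derivative_transform_within_open[OF _ \<open>open S\<close> that, of f _ UNIV g] Suc.prems that
    by (auto simp: frechet_derivative_works)
  have eq: "frechet_derivative f (at x) = frechet_derivative g (at x)" if "x \<in> S" for x
    using *[OF that] frechet_derivative_at by blast
  have "Ck_on k S (\<lambda>x. frechet_derivative g (at x) v)" for v
    by (rule Suc.IH[of "\<lambda>x. frechet_derivative f (at x) v"]) (use Suc.prems eq in auto)
  then show ?case using * by (auto simp: differentiable_def)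
qed

lemma Ck_on_subset: "Ck_on k S f \<Longrightarrow> S' \<subseteq> S \<Longrightarrow> Ck_on k S' f"
  by (induction k arbitrary: f) (auto intro: continuous_on_subset)

lemma Ck_on_SucD:
  "Ck_on (Suc k) S f \<Longrightarrow> Ck_on k S f"
proof (induction k arbitrary: f)
  case 0
  then show ?case
    by (auto intro!: continuous_at_imp_continuous_on differentiable_imp_continuous_within)
next
  case (Suc k)
  have "\<forall>x\<in>S. f differentiable at x" using Suc.prems by simp
  moreover have "Ck_on k S (\<lambda>x. frechet_derivative f (at x) v)" for v
    by (rule Suc.IH) (use Suc.prems in simp)
  ultimately show ?case by simp
qed

lemma Ck_on_const: "Ck_on k S (\<lambda>x. c)"
  by (induction k arbitrary: c) auto

lemma Ck_on_add:
  assumes "open S"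
  shows "Ck_on k S f \<Longrightarrow> Ck_on k S g \<Longrightarrow> Ck_on k S (\<lambda>x. f x + g x)"
proof (induction k arbitrary: f g)
  case 0
  then show ?case by (auto intro: continuous_intros)
next
  case (Suc k)
  have *: "((\<lambda>x. f x + g x) has_derivative
      (\<lambda>v. frechet_derivative f (at x) v + frechet_derivative g (at x) v)) (at x)"
    if "x \<in> S" for x
    using Suc.prems that by (auto intro!: has_derivative_add simp: frechet_derivative_works[symmetric])
  have "Ck_on k S (\<lambda>x. frechet_derivative (\<lambda>x. f x + g x) (at x) v)" for v
    by (rule Ck_on_cong[OF assms Suc.IH[of "\<lambda>x. frechet_derivative f (at x) v" "\<lambda>x. frechet_derivative g (at x) v"]])
       (use Suc.prems frechet_derivative_at[OF *] in \<open>auto dest: fun_cong\<close>)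
  then show ?case using * by (auto simp: differentiable_def)
qed

lemma Ck_on_bounded_linear:
  assumes "open S" "bounded_linear L"
  shows "Ck_on k S f \<Longrightarrow> Ck_on k S (\<lambda>x. L (f x))"
proof (induction k arbitrary: f)
  case 0
  then show ?case using assms(2) by (auto intro: bounded_linear.continuous_on)
next
  case (Suc k)
  have *: "((\<lambda>x. L (f x)) has_derivative (\<lambda>v. L (frechet_derivative f (at x) v))) (at x)"
    if "x \<in> S" for x
    using Suc.prems that
    by (auto intro!: bounded_linear.has_derivative[OF assms(2)] simp: frechet_derivative_works[symmetric])
  have "Ck_on k S (\<lambda>x. frechet_derivative (\<lambda>x. L (f x)) (at x) v)" for v
    by (rule Ck_on_cong[OF assms(1) Suc.IH[of "\<lambda>x. frechet_derivative f (at x) v"]])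
       (use Suc.prems frechet_derivative_at[OF *] in \<open>auto dest: fun_cong\<close>)
  then show ?case using * by (auto simp: differentiable_def)
qed

lemma Ck_on_bilinear:
  assumes "open S" "bounded_bilinear B"
  shows "Ck_on k S f \<Longrightarrow> Ck_on k S g \<Longrightarrow> Ck_on k S (\<lambda>x. B (f x) (g x))"
proof (induction k arbitrary: f g)
  case 0
  then show ?case using assms(2) by (auto intro: bounded_bilinear.continuous_on)
next
  case (Suc k)
  have *: "((\<lambda>x. B (f x) (g x)) has_derivative
      (\<lambda>v. B (f x) (frechet_derivative g (at x) v) + B (frechet_derivative f (at x) v) (g x))) (at x)"
    if "x \<in> S" for x
    using Suc.prems that
    by (auto intro!: bounded_bilinear.FDERIV[OF assms(2)] simp: frechet_derivative_works[symmetric])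
  have "Ck_on k S (\<lambda>x. B (f x) (frechet_derivative g (at x) v) + B (frechet_derivative f (at x) v) (g x))" for v
    using Suc.prems Ck_on_SucD[of k S f] Ck_on_SucD[of k S g]
    by (intro Ck_on_add assms(1) Suc.IH) simp_all
  then have "Ck_on k S (\<lambda>x. frechet_derivative (\<lambda>x. B (f x) (g x)) (at x) v)" for v
    by (rule Ck_on_cong[OF assms(1)]) (use frechet_derivative_at[OF *] in \<open>auto dest: fun_cong\<close>)
  then show ?case using * by (auto simp: differentiable_def)
qed

lemma Ck_on_inverse:
  fixes f :: "'a::real_normed_vector \<Rightarrow> real"
  assumes "open S" "\<And>x. x \<in> S \<Longrightarrow> f x \<noteq> 0"
  shows "Ck_on k S f \<Longrightarrow> Ck_on k S (\<lambda>x. inverse (f x))"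
proof (induction k)
  case 0
  then show ?case using assms by (auto intro: continuous_intros)
next
  case (Suc k)
  have *: "((\<lambda>x. inverse (f x)) has_derivative
      (\<lambda>v. - (inverse (f x) * frechet_derivative f (at x) v * inverse (f x)))) (at x)"
    if "x \<in> S" for x
    using Suc.prems that assms(2)
    by (auto intro!: has_derivative_inverse simp: frechet_derivative_works[symmetric])
  have "Ck_on k S (\<lambda>x. inverse (f x))" using Suc Ck_on_SucD by blast
  then have "Ck_on k S (\<lambda>x. - (inverse (f x) * frechet_derivative f (at x) v * inverse (f x)))" for v
    using Suc.prems
    by (intro Ck_on_bounded_linear[OF assms(1) bounded_linear_minus[OF bounded_linear_ident]]
          Ck_on_bilinear[OF assms(1) bounded_bilinear_mult]) auto
  then have "Ck_on k S (\<lambda>x. frechet_derivative (\<lambda>x. inverse (f x)) (at x) v)" for v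
    by (rule Ck_on_cong[OF assms(1)]) (use frechet_derivative_at[OF *] in \<open>auto dest: fun_cong\<close>)
  then show ?case using * by (auto simp: differentiable_def)
qed

text \<open>Two applications of the mean value theorem express the second difference quotient as a mixed
  derivative at a nearby point. That quotient is symmetric in \<open>v\<close> and \<open>w\<close>.\<close>

lemma second_derivative_as_limit:
  fixes F :: "'a::real_normed_vector \<Rightarrow> real"
  assumes "open S" "a \<in> S" "Ck_on 2 S F"
  shows "((\<lambda>h. (F (a + h *\<^sub>R v + h *\<^sub>R w) - F (a + h *\<^sub>R v) - F (a + h *\<^sub>R w) + F a) / h^2) \<longlongrightarrow>
          frechet_derivative (\<lambda>x. frechet_derivative F (at x) v) (at a) w) (at_right 0)"
proof -
  let ?Dv = "\<lambda>x. frechet_derivative F (at x) v"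
  let ?H = "\<lambda>x. frechet_derivative ?Dv (at x) w"
  have dF: "(F has_derivative frechet_derivative F (at x)) (at x)" if "x \<in> S" for x
    using assms(3) that by (simp add: numeral_2_eq_2 frechet_derivative_works[symmetric])
  have dDv: "(?Dv has_derivative frechet_derivative ?Dv (at x)) (at x)" if "x \<in> S" for x
    using assms(3) that by (simp add: numeral_2_eq_2 frechet_derivative_works[symmetric])
  have cH: "continuous_on S ?H" using assms(3) by (simp add: numeral_2_eq_2)
  show ?thesis
  proof (rule tendstoI)
    fix e :: real assume "e > 0"
    have "isCont ?H a" using cH assms(1,2) continuous_on_eq_continuous_at by blast
    then obtain d1 where d1: "d1 > 0" "\<And>y. dist y a < d1 \<Longrightarrow> dist (?H y) (?H a) < e"
      using \<open>e > 0\<close> unfolding continuous_at_eps_delta by blast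
    obtain d2 where d2: "d2 > 0" "ball a d2 \<subseteq> S" using assms(1,2) open_contains_ball by blast
    \<comment> \<open>for \<open>h < d / c\<close> the parallelogram with sides \<open>hv\<close>, \<open>hw\<close> stays in the ball of radius \<open>d\<close>\<close>
    define d where "d = min d1 d2"
    define c where "c = norm v + norm w + 1"
    have c: "c > 0" unfolding c_def by (simp add: add_nonneg_pos)
    have near: "dist (a + s *\<^sub>R v + t *\<^sub>R w) a < d" if "0 \<le> s" "0 \<le> t" "s \<le> h" "t \<le> h" "0 < h" "h < d / c" for s t h
    proof -
      have "dist (a + s *\<^sub>R v + t *\<^sub>R w) a = norm (s *\<^sub>R v + t *\<^sub>R w)" by (simp add: dist_norm)
      also have "\<dots> \<le> s * norm v + t * norm w" using norm_triangle_ineq[of "s *\<^sub>R v" "t *\<^sub>R w"] that by simp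
      also have "\<dots> \<le> h * norm v + h * norm w" using that by (intro add_mono mult_right_mono) auto
      also have "\<dots> \<le> h * c" using that by (simp add: c_def algebra_simps)
      also have "\<dots> < d" using that c by (simp add: field_simps)
      finally show ?thesis .
    qed
    have inS: "a + s *\<^sub>R v + t *\<^sub>R w \<in> S" if "0 \<le> s" "0 \<le> t" "s \<le> h" "t \<le> h" "0 < h" "h < d / c" for s t h
      using near[OF that] d2(2) by (auto simp: d_def dist_commute)
    have "dist ((F (a + h *\<^sub>R v + h *\<^sub>R w) - F (a + h *\<^sub>R v) - F (a + h *\<^sub>R w) + F a) / h^2) (?H a) < e"
      if h: "0 < h" "h < d / c" for h
    proof -
      let ?\<phi> = "\<lambda>s. F (a + s *\<^sub>R v + h *\<^sub>R w) - F (a + s *\<^sub>R v)"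
      have lines: "((\<lambda>s. a + s *\<^sub>R v + b) has_derivative (\<lambda>r. r *\<^sub>R v)) (at s)" for s b
        by (auto intro!: derivative_eq_intros)
      have d\<phi>: "DERIV ?\<phi> s :> (?Dv (a + s *\<^sub>R v + h *\<^sub>R w) - ?Dv (a + s *\<^sub>R v))" if "0 \<le> s" "s \<le> h" for s
      proof -
        have "a + s *\<^sub>R v + h *\<^sub>R w \<in> S" using inS[of s h h] that h by auto
        from has_derivative_compose[OF lines dF[OF this]]
        have 1: "((\<lambda>s. F (a + s *\<^sub>R v + h *\<^sub>R w)) has_derivative (\<lambda>r. frechet_derivative F (at (a + s *\<^sub>R v + h *\<^sub>R w)) (r *\<^sub>R v))) (at s)" .
        have "a + s *\<^sub>R v + 0 \<in> S" using inS[of s 0 h] that h by auto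
        from has_derivative_compose[OF lines dF[OF this]]
        have 2: "((\<lambda>s. F (a + s *\<^sub>R v)) has_derivative (\<lambda>r. frechet_derivative F (at (a + s *\<^sub>R v)) (r *\<^sub>R v))) (at s)" by simp
        have l: "linear (frechet_derivative F (at x))" if "x \<in> S" for x
          using dF[OF that] has_derivative_linear by blast
        have "(\<lambda>r. frechet_derivative F (at (a + s *\<^sub>R v + h *\<^sub>R w)) (r *\<^sub>R v) - frechet_derivative F (at (a + s *\<^sub>R v)) (r *\<^sub>R v))
            = (*) (?Dv (a + s *\<^sub>R v + h *\<^sub>R w) - ?Dv (a + s *\<^sub>R v))"
          using l[OF \<open>a + s *\<^sub>R v + h *\<^sub>R w \<in> S\<close>] l[of "a + s *\<^sub>R v"] \<open>a + s *\<^sub>R v + 0 \<in> S\<close>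
          by (intro ext) (simp add: linear_scale algebra_simps)
        then show ?thesis unfolding has_field_derivative_def
          using has_derivative_diff[OF 1 2] by simp
      qed
      obtain \<xi> where \<xi>: "0 < \<xi>" "\<xi> < h" "?\<phi> h - ?\<phi> 0 = (h - 0) * (?Dv (a + \<xi> *\<^sub>R v + h *\<^sub>R w) - ?Dv (a + \<xi> *\<^sub>R v))"
        using MVT2[OF h(1) d\<phi>] by blast
      have dD: "DERIV (\<lambda>t. ?Dv (a + \<xi> *\<^sub>R v + t *\<^sub>R w)) t :> ?H (a + \<xi> *\<^sub>R v + t *\<^sub>R w)" if "0 \<le> t" "t \<le> h" for t
      proof -
        have S: "a + \<xi> *\<^sub>R v + t *\<^sub>R w \<in> S" using inS[of \<xi> t h] that h \<xi> by auto
        have "((\<lambda>t. a + \<xi> *\<^sub>R v + t *\<^sub>R w) has_derivative (\<lambda>r. r *\<^sub>R w)) (at t)"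
          by (auto intro!: derivative_eq_intros)
        from has_derivative_compose[OF this dDv[OF S]] show ?thesis
          unfolding has_field_derivative_def
          using has_derivative_linear[OF dDv[OF S]] by (simp add: linear_scale mult_commute_abs)
      qed
      obtain \<zeta> where \<zeta>: "0 < \<zeta>" "\<zeta> < h" "?Dv (a + \<xi> *\<^sub>R v + h *\<^sub>R w) - ?Dv (a + \<xi> *\<^sub>R v + 0 *\<^sub>R w) = (h - 0) * ?H (a + \<xi> *\<^sub>R v + \<zeta> *\<^sub>R w)"
        using MVT2[OF h(1) dD] by blast
      have "(F (a + h *\<^sub>R v + h *\<^sub>R w) - F (a + h *\<^sub>R v) - F (a + h *\<^sub>R w) + F a) = h^2 * ?H (a + \<xi> *\<^sub>R v + \<zeta> *\<^sub>R w)"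
        using \<xi>(3) \<zeta>(3) by (simp add: power2_eq_square)
      moreover have "dist (a + \<xi> *\<^sub>R v + \<zeta> *\<^sub>R w) a < d1"
        using near[of \<xi> \<zeta> h] \<xi> \<zeta> h by (auto simp: d_def)
      ultimately show ?thesis using d1(2) h by simp
    qed
    moreover have "d / c > 0" using c d1 d2 by (simp add: d_def)
    ultimately show "\<forall>\<^sub>F h in at_right 0. dist ((F (a + h *\<^sub>R v + h *\<^sub>R w) - F (a + h *\<^sub>R v) - F (a + h *\<^sub>R w) + F a) / h^2) (?H a) < e"
      unfolding eventually_at_right_field by blast
  qed
qed

lemma mixed_derivatives_commute:
  fixes F :: "'a::real_normed_vector \<Rightarrow> 'b::euclidean_space"
  assumes "open S" "a \<in> S" "Ck_on 2 S F"
  shows "frechet_derivative (\<lambda>x. frechet_derivative F (at x) v) (at a) w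
       = frechet_derivative (\<lambda>x. frechet_derivative F (at x) w) (at a) v"
proof -
  have real: "frechet_derivative (\<lambda>x. frechet_derivative G (at x) v) (at a) w
       = frechet_derivative (\<lambda>x. frechet_derivative G (at x) w) (at a) v"
    if "Ck_on 2 S G" for G :: "'a \<Rightarrow> real"
    using tendsto_unique[OF _ second_derivative_as_limit[OF assms(1,2) that, of v w]]
      second_derivative_as_limit[OF assms(1,2) that, of w v]
    by (simp add: algebra_simps)
  have comp: "frechet_derivative (\<lambda>x. frechet_derivative F (at x) v) (at a) w \<bullet> b
      = frechet_derivative (\<lambda>x. frechet_derivative (\<lambda>x. F x \<bullet> b) (at x) v) (at a) w" for v w b
  proof -
    have "((\<lambda>x. F x \<bullet> b) has_derivative (\<lambda>v. frechet_derivative F (at x) v \<bullet> b)) (at x)" if "x \<in> S" for x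
      using assms(3) that
      by (intro bounded_linear.has_derivative[OF bounded_linear_inner_left])
        (simp add: numeral_2_eq_2 frechet_derivative_works[symmetric])
    then have 1: "frechet_derivative (\<lambda>x. F x \<bullet> b) (at x) v = frechet_derivative F (at x) v \<bullet> b" if "x \<in> S" for x
      using that frechet_derivative_at by metis
    have "((\<lambda>x. frechet_derivative F (at x) v \<bullet> b) has_derivative
        (\<lambda>w. frechet_derivative (\<lambda>x. frechet_derivative F (at x) v) (at a) w \<bullet> b)) (at a)"
      using assms(2,3)
      by (intro bounded_linear.has_derivative[OF bounded_linear_inner_left])
        (simp add: numeral_2_eq_2 frechet_derivative_works[symmetric])
    then have "((\<lambda>x. frechet_derivative (\<lambda>x. F x \<bullet> b) (at x) v) has_derivative
        (\<lambda>w. frechet_derivative (\<lambda>x. frechet_derivative F (at x) v) (at a) w \<bullet> b)) (at a)"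
      by (rule has_derivative_transform_within_open[OF _ assms(1,2)]) (simp add: 1)
    then show ?thesis using frechet_derivative_at by metis
  qed
  show ?thesis
  proof (rule euclidean_eqI)
    fix b :: 'b
    have "Ck_on 2 S (\<lambda>x. F x \<bullet> b)"
      by (rule Ck_on_bounded_linear[OF assms(1) bounded_linear_inner_left assms(3)])
    from real[OF this] show "frechet_derivative (\<lambda>x. frechet_derivative F (at x) v) (at a) w \<bullet> b
       = frechet_derivative (\<lambda>x. frechet_derivative F (at x) w) (at a) v \<bullet> b"
      by (simp add: comp)
  qed
qed

section \<open>Smooth maps and tangent vectors on the surface\<close>

locale surface =
  fixes A :: "('m::{t2_space, second_countable_topology}) chart set"
  assumes atlas: "smooth_atlas A"
begin

lemma open_chart_image:
  assumes "(D, \<phi>) \<in> A" "open N"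
  shows "open (\<phi> ` (D \<inter> N))"
proof -
  have D: "open D" "open (\<phi> ` D)" "homeomorphism D (\<phi> ` D) \<phi> (inv_into D \<phi>)"
    using atlas assms(1) unfolding smooth_atlas_def by auto
  have "openin (top_of_set (\<phi> ` D)) (\<phi> ` (D \<inter> N))"
    by (rule homeomorphism_imp_open_map[OF D(3)]) (use assms(2) in \<open>auto simp: openin_open\<close>)
  then show ?thesis using D(2) openin_open_trans by blast
qed

lemma chart_inj: "(D, \<phi>) \<in> A \<Longrightarrow> inj_on \<phi> D"
  using atlas unfolding smooth_atlas_def homeomorphism_def
  by (auto intro!: inj_on_inverseI[where g = "inv_into D \<phi>"])

lemma chart_inv: "(D, \<phi>) \<in> A \<Longrightarrow> r \<in> D \<Longrightarrow> inv_into D \<phi> (\<phi> r) = r"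
  using chart_inj inv_into_f_f by metis

lemma chart_exists: obtains D \<phi> where "(D, \<phi>) \<in> A" "r \<in> D"
proof -
  have "r \<in> (\<Union>(D, \<phi>)\<in>A. D)" using atlas unfolding smooth_atlas_def by auto
  then show ?thesis using that by auto
qed

subsection \<open>Smooth maps\<close>

lemma smooth_mapI:
  "(\<And>D \<phi> k. (D, \<phi>) \<in> A \<Longrightarrow> Ck_on k (\<phi> ` (D \<inter> N)) (\<lambda>z. g (inv_into D \<phi> z))) \<Longrightarrow> smooth_map A N g"
  unfolding smooth_map_def smooth_on_def comp_def by auto

lemma smooth_mapD:
  "smooth_map A N g \<Longrightarrow> (D, \<phi>) \<in> A \<Longrightarrow> Ck_on k (\<phi> ` (D \<inter> N)) (\<lambda>z. g (inv_into D \<phi> z))"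
  unfolding smooth_map_def smooth_on_def comp_def by auto

lemma smooth_map_subset: "smooth_map A N g \<Longrightarrow> N' \<subseteq> N \<Longrightarrow> smooth_map A N' g"
  by (rule smooth_mapI, rule Ck_on_subset, erule (1) smooth_mapD) auto

lemma smooth_map_cong:
  assumes "open N" "smooth_map A N g" "\<And>r. r \<in> N \<Longrightarrow> g r = g' r"
  shows "smooth_map A N g'"
  by (rule smooth_mapI, rule Ck_on_cong[OF open_chart_image smooth_mapD[OF assms(2)]])
    (use assms(1,3) in \<open>auto simp: chart_inv\<close>)

lemma smooth_map_const [simp]: "smooth_map A N (\<lambda>r. c)"
  by (auto intro!: smooth_mapI Ck_on_const)

lemma smooth_map_add:
  "open N \<Longrightarrow> smooth_map A N g \<Longrightarrow> smooth_map A N h \<Longrightarrow> smooth_map A N (\<lambda>r. g r + h r)"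
  by (rule smooth_mapI, rule Ck_on_add[OF open_chart_image smooth_mapD smooth_mapD])

lemma smooth_map_linear:
  "bounded_linear L \<Longrightarrow> open N \<Longrightarrow> smooth_map A N g \<Longrightarrow> smooth_map A N (\<lambda>r. L (g r))"
  by (rule smooth_mapI, rule Ck_on_bounded_linear[OF open_chart_image _ smooth_mapD])

lemma smooth_map_bilinear:
  "bounded_bilinear B \<Longrightarrow> open N \<Longrightarrow> smooth_map A N g \<Longrightarrow> smooth_map A N h \<Longrightarrow>
    smooth_map A N (\<lambda>r. B (g r) (h r))"
  by (rule smooth_mapI, rule Ck_on_bilinear[OF open_chart_image _ smooth_mapD smooth_mapD])

lemmas smooth_map_scaleR = smooth_map_bilinear[OF bounded_bilinear_scaleR]
lemmas smooth_map_mult = smooth_map_bilinear[OF bounded_bilinear_mult]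
lemmas smooth_map_minus = smooth_map_linear[OF bounded_linear_minus[OF bounded_linear_ident]]

lemma smooth_map_inverse:
  fixes g :: "'m \<Rightarrow> real"
  assumes "open N" "smooth_map A N g" "\<And>r. r \<in> N \<Longrightarrow> g r \<noteq> 0"
  shows "smooth_map A N (\<lambda>r. inverse (g r))"
  by (rule smooth_mapI, rule Ck_on_inverse[OF open_chart_image _ smooth_mapD[OF assms(2)]])
    (use assms(1,3) in \<open>auto simp: chart_inv\<close>)

lemma smooth_map_divide:
  fixes g h :: "'m \<Rightarrow> real"
  assumes "open N" "smooth_map A N g" "smooth_map A N h" "\<And>r. r \<in> N \<Longrightarrow> h r \<noteq> 0"
  shows "smooth_map A N (\<lambda>r. g r / h r)"
  unfolding divide_inverse using assms by (intro smooth_map_mult smooth_map_inverse)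

lemma smooth_map_sum:
  assumes "open N"
  shows "finite I \<Longrightarrow> (\<And>i. i \<in> I \<Longrightarrow> smooth_map A N (g i)) \<Longrightarrow> smooth_map A N (\<lambda>r. \<Sum>i\<in>I. g i r)"
  by (induction I rule: finite_induct) (auto intro: smooth_map_add[OF assms])

lemma smooth_atI: "open N \<Longrightarrow> r \<in> N \<Longrightarrow> smooth_map A N g \<Longrightarrow> smooth_at A r g"
  unfolding smooth_at_def by blast

lemma smooth_atE:
  assumes "smooth_at A r g" "smooth_at A r h"
  obtains N where "open N" "r \<in> N" "smooth_map A N g" "smooth_map A N h"
proof -
  obtain N N' where "open N" "r \<in> N" "smooth_map A N g" "open N'" "r \<in> N'" "smooth_map A N' h"
    using assms unfolding smooth_at_def by blast
  then show ?thesis using that[of "N \<inter> N'"] smooth_map_subset by (metis IntI inf_le1 inf_le2 open_Int)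
qed

lemma smooth_at_linear: "bounded_linear L \<Longrightarrow> smooth_at A r g \<Longrightarrow> smooth_at A r (\<lambda>s. L (g s))"
  using smooth_map_linear unfolding smooth_at_def by blast

lemma smooth_at_cong:
  fixes g h :: "'m \<Rightarrow> 'v::real_normed_vector"
  assumes "open N" "r \<in> N" "\<And>s. s \<in> N \<Longrightarrow> g s = h s"
  shows "smooth_at A r g \<longleftrightarrow> smooth_at A r h"
proof -
  have step: "smooth_at A r h" if g: "smooth_at A r g" and "\<And>s. s \<in> N \<Longrightarrow> g s = h s" for g h :: "'m \<Rightarrow> 'v"
  proof -
    obtain M where "open M" "r \<in> M" "smooth_map A M g" using g smooth_at_def by blast
    have "smooth_map A (M \<inter> N) g" by (rule smooth_map_subset[OF \<open>smooth_map A M g\<close>]) simp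
    then have "smooth_map A (M \<inter> N) h"
      by (rule smooth_map_cong[rotated]) (simp_all add: that open_Int \<open>open M\<close> assms(1))
    then show ?thesis by (rule smooth_atI[rotated -1]) (simp_all add: \<open>open M\<close> \<open>r \<in> M\<close> open_Int assms(1,2))
  qed
  show ?thesis using step[of g h] step[of h g] assms(3) by auto
qed

subsection \<open>Tangent vectors in a chart\<close>

text \<open>Differentiation along \<open>v\<close> in the chart \<open>\<phi>\<close>, set to 0 on functions that are not smooth, as in
  the tangent space.\<close>

definition chart_vec :: "'m set \<Rightarrow> ('m \<Rightarrow> real ^ 2) \<Rightarrow> 'm \<Rightarrow> real ^ 2 \<Rightarrow> 'm tangent" where
  "chart_vec D \<phi> r v = (\<lambda>g. if smooth_at A r g
                 then frechet_derivative (g \<circ> inv_into D \<phi>) (at (\<phi> r)) v else 0)"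

lemma tangentE:
  assumes "X \<in> tangent_space A r"
  obtains D \<phi> v where "(D, \<phi>) \<in> A" "r \<in> D" "X = chart_vec D \<phi> r v"
  using assms unfolding tangent_space_def chart_vec_def by auto

lemma chart_vec_tangent: "(D, \<phi>) \<in> A \<Longrightarrow> r \<in> D \<Longrightarrow> chart_vec D \<phi> r v \<in> tangent_space A r"
  unfolding tangent_space_def chart_vec_def by auto

lemma smooth_at_differentiable:
  assumes "(D, \<phi>) \<in> A" "r \<in> D" "smooth_at A r g"
  shows "((\<lambda>z. g (inv_into D \<phi> z)) has_derivative
     frechet_derivative (\<lambda>z. g (inv_into D \<phi> z)) (at (\<phi> r))) (at (\<phi> r))"
proof -
  obtain N where "open N" "r \<in> N" "smooth_map A N g" using assms smooth_at_def by blast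
  then have "Ck_on 1 (\<phi> ` (D \<inter> N)) (\<lambda>z. g (inv_into D \<phi> z))" using smooth_mapD assms by blast
  then have "(\<lambda>z. g (inv_into D \<phi> z)) differentiable (at (\<phi> r))"
    using \<open>r \<in> N\<close> assms by auto
  then show ?thesis by (simp add: frechet_derivative_works)
qed

lemma dd_chart_vec:
  fixes \<sigma> :: "'m \<Rightarrow> 'v::euclidean_space"
  assumes "(D, \<phi>) \<in> A" "r \<in> D" "smooth_at A r \<sigma>"
  shows "dd (chart_vec D \<phi> r v) \<sigma> = frechet_derivative (\<lambda>z. \<sigma> (inv_into D \<phi> z)) (at (\<phi> r)) v"
proof -
  let ?F' = "frechet_derivative (\<lambda>z. \<sigma> (inv_into D \<phi> z)) (at (\<phi> r))"
  have "chart_vec D \<phi> r v (\<lambda>s. \<sigma> s \<bullet> b) = ?F' v \<bullet> b" for b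
  proof -
    have "smooth_at A r (\<lambda>s. \<sigma> s \<bullet> b)"
      using smooth_at_linear[OF bounded_linear_inner_left assms(3)] .
    moreover have d: "((\<lambda>z. \<sigma> (inv_into D \<phi> z) \<bullet> b) has_derivative (\<lambda>v. ?F' v \<bullet> b)) (at (\<phi> r))"
      by (intro bounded_linear.has_derivative[OF bounded_linear_inner_left] smooth_at_differentiable assms)
    ultimately show ?thesis unfolding chart_vec_def comp_def
      using fun_cong[OF frechet_derivative_at[OF d], of v] by simp
  qed
  then show ?thesis unfolding dd_def by (simp add: euclidean_representation)
qed

lemma dd_real: "dd X (g :: 'm \<Rightarrow> real) = X g"
  by (simp add: dd_def)

lemma tangent_cong:
  assumes "X \<in> tangent_space A r" "open N" "r \<in> N" "\<And>s. s \<in> N \<Longrightarrow> g s = h s"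
  shows "X g = X h"
proof -
  obtain D \<phi> v where X: "(D, \<phi>) \<in> A" "r \<in> D" "X = chart_vec D \<phi> r v" using tangentE assms(1) by blast
  show ?thesis
  proof (cases "smooth_at A r g")
    case True
    have "((\<lambda>z. h (inv_into D \<phi> z)) has_derivative
        frechet_derivative (\<lambda>z. g (inv_into D \<phi> z)) (at (\<phi> r))) (at (\<phi> r))"
      by (rule has_derivative_transform_within_open[OF smooth_at_differentiable[OF X(1,2) True]
            open_chart_image[OF X(1) assms(2)]]) (use X assms chart_inv in auto)
    then show ?thesis
      using smooth_at_cong[OF assms(2,3,4)] frechet_derivative_at unfolding X(3) chart_vec_def comp_def
      by fastforce
  next
    case False
    then show ?thesis using smooth_at_cong[OF assms(2,3,4)] unfolding X(3) chart_vec_def by simp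
  qed
qed

lemma dd_cong:
  assumes "X \<in> tangent_space A r" "open N" "r \<in> N" "\<And>s. s \<in> N \<Longrightarrow> g s = h s"
  shows "dd X g = dd X h"
proof -
  have "X (\<lambda>s. g s \<bullet> b) = X (\<lambda>s. h s \<bullet> b)" for b
    by (rule tangent_cong[OF assms(1-3)]) (simp add: assms(4))
  then show ?thesis unfolding dd_def by simp
qed

lemma dd_const [simp]: "X \<in> tangent_space A r \<Longrightarrow> dd X (\<lambda>s. c) = 0"
  by (elim tangentE) (simp add: dd_chart_vec smooth_atI[OF open_UNIV])

lemma dd_linear:
  fixes g :: "'m \<Rightarrow> 'a::euclidean_space" and L :: "'a \<Rightarrow> 'b::euclidean_space"
  assumes "X \<in> tangent_space A r" "bounded_linear L" "smooth_at A r g"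
  shows "dd X (\<lambda>s. L (g s)) = L (dd X g)"
proof -
  obtain D \<phi> v where X: "(D, \<phi>) \<in> A" "r \<in> D" "X = chart_vec D \<phi> r v" using tangentE assms(1) by blast
  have "((\<lambda>z. L (g (inv_into D \<phi> z))) has_derivative
     (\<lambda>v. L (frechet_derivative (\<lambda>z. g (inv_into D \<phi> z)) (at (\<phi> r)) v))) (at (\<phi> r))"
    by (intro bounded_linear.has_derivative[OF assms(2)] smooth_at_differentiable X assms(3))
  from frechet_derivative_at[OF this]
  show ?thesis using X(1,2) assms smooth_at_linear[OF assms(2,3)] unfolding X(3)
    by (simp add: dd_chart_vec fun_eq_iff)
qed

lemma dd_bilinear:
  fixes g :: "'m \<Rightarrow> 'a::euclidean_space" and h :: "'m \<Rightarrow> 'b::euclidean_space"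
    and B :: "'a \<Rightarrow> 'b \<Rightarrow> 'c::euclidean_space"
  assumes "bounded_bilinear B" "X \<in> tangent_space A r" "smooth_at A r g" "smooth_at A r h"
  shows "dd X (\<lambda>s. B (g s) (h s)) = B (dd X g) (h r) + B (g r) (dd X h)"
proof -
  obtain D \<phi> v where X: "(D, \<phi>) \<in> A" "r \<in> D" "X = chart_vec D \<phi> r v" using tangentE assms(2) by blast
  obtain N where "open N" "r \<in> N" "smooth_map A N g" "smooth_map A N h" using smooth_atE assms(3,4) by blast
  then have sm: "smooth_at A r (\<lambda>s. B (g s) (h s))"
    using smooth_map_bilinear[OF assms(1)] smooth_atI by blast
  from frechet_derivative_at[OF bounded_bilinear.FDERIV[OF assms(1) smooth_at_differentiable smooth_at_differentiable,
        OF X(1,2) assms(3) X(1,2) assms(4)]]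
  show ?thesis using X(1,2) assms sm chart_inv[OF X(1,2)] unfolding X(3)
    by (simp add: dd_chart_vec fun_eq_iff add.commute)
qed

lemmas dd_scaleR = dd_bilinear[OF bounded_bilinear_scaleR]

lemma dd_add:
  fixes g h :: "'m \<Rightarrow> 'a::euclidean_space"
  assumes "X \<in> tangent_space A r" "smooth_at A r g" "smooth_at A r h"
  shows "dd X (\<lambda>s. g s + h s) = dd X g + dd X h"
proof -
  obtain D \<phi> v where X: "(D, \<phi>) \<in> A" "r \<in> D" "X = chart_vec D \<phi> r v" using tangentE assms(1) by blast
  obtain N where "open N" "r \<in> N" "smooth_map A N g" "smooth_map A N h" using smooth_atE assms by blast
  then have sm: "smooth_at A r (\<lambda>s. g s + h s)" using smooth_map_add smooth_atI by blast
  from frechet_derivative_at[OF has_derivative_add[OF smooth_at_differentiable smooth_at_differentiable,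
        OF X(1,2) assms(2) X(1,2) assms(3)]]
  show ?thesis using X(1,2) assms sm unfolding X(3) by (simp add: dd_chart_vec fun_eq_iff)
qed

lemma dd_lin_comb: "dd (lin_comb a X b Y) g = a *\<^sub>R dd X g + b *\<^sub>R dd Y g"
  by (simp add: dd_def lin_comb_def scaleR_add_left sum.distrib scaleR_sum_right)

text \<open>By the chain rule for the transition map, any chart at the point represents all its tangent
  vectors. This allows second derivatives along two tangent vectors to be computed in one chart.\<close>

lemma tangent_in_chart:
  assumes "X \<in> tangent_space A r" "(D, \<phi>) \<in> A" "r \<in> D"
  obtains v where "X = chart_vec D \<phi> r v"
proof -
  obtain D' \<phi>' v' where X: "(D', \<phi>') \<in> A" "r \<in> D'" "X = chart_vec D' \<phi>' r v'" using tangentE assms(1) by blast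
  let ?c = "\<phi> \<circ> inv_into D' \<phi>'"
  let ?w = "frechet_derivative ?c (at (\<phi>' r)) v'"
  have r: "\<phi>' r \<in> \<phi>' ` (D' \<inter> D)" using X(2) assms(3) by blast
  have "smooth_on (\<phi>' ` (D' \<inter> D)) ?c"
    using atlas X(1) assms(2) unfolding smooth_atlas_def by fast
  then have "Ck_on 1 (\<phi>' ` (D' \<inter> D)) ?c" unfolding smooth_on_def by blast
  then have c: "(?c has_derivative frechet_derivative ?c (at (\<phi>' r))) (at (\<phi>' r))"
    using r by (auto simp: frechet_derivative_works[symmetric])
  have "open D" using atlas assms(2) unfolding smooth_atlas_def by auto
  then have op: "open (\<phi>' ` (D' \<inter> D))" using open_chart_image[OF X(1)] by blast
  have "X = chart_vec D \<phi> r ?w"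
  proof
    fix g :: "'m \<Rightarrow> real"
    show "X g = chart_vec D \<phi> r ?w g"
    proof (cases "smooth_at A r g")
      case True
      have cr: "?c (\<phi>' r) = \<phi> r" using chart_inv X by simp
      have "((\<lambda>z. (\<lambda>z. g (inv_into D \<phi> z)) (?c z)) has_derivative
         (\<lambda>v. frechet_derivative (\<lambda>z. g (inv_into D \<phi> z)) (at (\<phi> r)) (frechet_derivative ?c (at (\<phi>' r)) v))) (at (\<phi>' r))"
        using has_derivative_compose[OF c, unfolded cr, OF smooth_at_differentiable[OF assms(2,3) True]]
        by (simp only: cr)
      then have "((\<lambda>z. g (inv_into D' \<phi>' z)) has_derivative
         (\<lambda>v. frechet_derivative (\<lambda>z. g (inv_into D \<phi> z)) (at (\<phi> r)) (frechet_derivative ?c (at (\<phi>' r)) v))) (at (\<phi>' r))"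
        by (rule has_derivative_transform_within_open[OF _ op r])
          (use chart_inv assms(2) X(1) in auto)
      from frechet_derivative_at[OF this] show ?thesis
        using True unfolding X(3) chart_vec_def comp_def by (simp add: fun_eq_iff)
    next
      case False
      then show ?thesis unfolding X(3) chart_vec_def by simp
    qed
  qed
  then show ?thesis using that by blast
qed

end

section \<open>Linear algebra of signature (4,2)\<close>

lemma lform_simps [simp]:
  "lform (a + b) c = lform a c + lform b c" "lform a (b + c) = lform a b + lform a c"
  "lform (a - b) c = lform a c - lform b c" "lform a (b - c) = lform a b - lform a c"
  "lform (s *\<^sub>R a) c = s * lform a c" "lform a (s *\<^sub>R c) = s * lform a c"
  "lform (- a) c = - lform a c" "lform a (- c) = - lform a c"
  "lform 0 a = 0" "lform a 0 = 0"
  by (simp_all add: lform_def inner_add_left inner_add_right inner_diff_left inner_diff_right algebra_simps)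

lemma lform_sym: "lform a b = lform b a"
  by (simp add: lform_def inner_commute)

lemma lform_bilinear: "bounded_bilinear lform"
  unfolding bilinear_conv_bounded_bilinear[symmetric] bilinear_def by (intro conjI allI linearI) simp_all

lemma lform_nondegenerate:
  assumes "\<And>b. lform a b = 0" shows "a = 0"
proof -
  have "lform a (fst a, 0) = 0" "lform a (0, snd a) = 0" using assms by auto
  then show ?thesis by (simp add: lform_def prod_eq_iff)
qed

lemma span_insertE:
  assumes "v \<in> span (insert a S)"
  obtains s w where "w \<in> span S" "v = s *\<^sub>R a + w"
proof -
  obtain s where "v - s *\<^sub>R a \<in> span S" using assms span_breakdown_eq by blast
  then show ?thesis using that[of "v - s *\<^sub>R a" s] by simp
qed

lemma span2: "span {a, b} = {s *\<^sub>R a + t *\<^sub>R b | s t. True}"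
  for a b :: "'a::real_vector"
proof -
  have "v \<in> span {a, b} \<Longrightarrow> \<exists>s t. v = s *\<^sub>R a + t *\<^sub>R b" for v
    by (elim span_insertE) auto
  then show ?thesis by (auto intro: span_add span_scale span_base)
qed

lemma O42_inj: "g \<in> O42 \<Longrightarrow> inj (blinfun_apply g)"
proof (rule injI)
  fix a b assume g: "g \<in> O42" and "blinfun_apply g a = blinfun_apply g b"
  then have "blinfun_apply g (a - b) = 0" by (simp add: blinfun.diff_right)
  moreover have "lform (blinfun_apply g (a - b)) (blinfun_apply g c) = lform (a - b) c" for c
    using g unfolding O42_def by blast
  ultimately have "lform (a - b) c = 0" for c by (metis lform_simps(9))
  then show "a = b" using lform_nondegenerate by fastforce
qed

lemma linear_real3_to_real2_kernel:
  fixes L :: "real \<times> real \<times> real \<Rightarrow> real ^ 2"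
  assumes "linear L" obtains v where "v \<noteq> 0" "L v = 0"
proof -
  have "\<not> inj L"
  proof
    assume "inj L"
    then have "dim (range L) = DIM(real \<times> real \<times> real)"
      using dim_image_eq[of L UNIV] assms by (simp add: dim_UNIV)
    then show False using dim_subset_UNIV[of "range L"] by simp
  qed
  then show ?thesis using that linear_injective_0[OF assms] by blast
qed

text \<open>A negative semidefinite span of \<open>w\<close>, \<open>m\<close> and \<open>k\<close> cannot be three-dimensional: projecting to the two
  negative coordinates leaves a kernel, on which the form is positive definite.\<close>

lemma positive_on_perp:
  assumes neg: "lform m m < 0" "lform k k < 0" "lform m k = 0"
    and w: "lform w m = 0" "lform w k = 0" "lform w w \<le> 0"
  shows "w = 0"
proof -
  have "linear (\<lambda>(a, b, c). a *\<^sub>R snd w + b *\<^sub>R snd m + c *\<^sub>R snd k)"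
    by (rule linearI) (auto simp: algebra_simps)
  then obtain v where v: "v \<noteq> 0" "(\<lambda>(a, b, c). a *\<^sub>R snd w + b *\<^sub>R snd m + c *\<^sub>R snd k) v = 0"
    by (rule linear_real3_to_real2_kernel)
  obtain a b c where abc: "v = (a, b, c)" by (cases v) auto
  define u where "u = a *\<^sub>R w + b *\<^sub>R m + c *\<^sub>R k"
  have "snd u = 0" using v abc by (simp add: u_def)
  then have pos: "lform u u = fst u \<bullet> fst u" by (simp add: lform_def)
  have "lform u u = a\<^sup>2 * lform w w + b\<^sup>2 * lform m m + c\<^sup>2 * lform k k"
    using w neg(3) lform_sym[of w m] lform_sym[of w k] lform_sym[of m k]
    by (simp add: u_def power2_eq_square algebra_simps)
  moreover have "a\<^sup>2 * lform w w \<le> 0" "b\<^sup>2 * lform m m \<le> 0" "c\<^sup>2 * lform k k \<le> 0"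
    using neg w by (simp_all add: mult_nonneg_nonpos)
  moreover have "fst u \<bullet> fst u \<ge> 0" by simp
  ultimately have "fst u \<bullet> fst u = 0" "b\<^sup>2 * lform m m = 0" "c\<^sup>2 * lform k k = 0"
    using pos by linarith+
  then have "u = 0" "b = 0" "c = 0" using \<open>snd u = 0\<close> neg by (auto simp: prod_eq_iff)
  moreover have "a \<noteq> 0" if "b = 0" "c = 0" using v(1) abc that by (auto simp: zero_prod_def)
  ultimately show ?thesis by (simp add: u_def)
qed

subsection \<open>Laguerre frames\<close>

locale laguerre =
  fixes qinf q0 \<pp> :: R42
  assumes frame: "laguerre_frame qinf q0 \<pp>"
begin

lemma frame_forms [simp]:
  "lform qinf qinf = 0" "lform q0 q0 = 0" "lform q0 qinf = -1" "lform qinf q0 = -1"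
  "lform \<pp> \<pp> = -1" "lform \<pp> q0 = 0" "lform q0 \<pp> = 0" "lform \<pp> qinf = 0" "lform qinf \<pp> = 0"
  using frame unfolding laguerre_frame_def lightcone_def perp_def
  by (auto simp: lform_sym[of q0 \<pp>] lform_sym[of qinf \<pp>] lform_sym[of qinf q0])

text \<open>Orthogonal projection to the Euclidean 3-space \<open>\<langle>q0, qinf, \<pp>\<rangle>\<^sup>\<bottom>\<close>.\<close>

definition euc :: "R42 \<Rightarrow> R42" where
  "euc v = v + lform v qinf *\<^sub>R q0 + lform v q0 *\<^sub>R qinf + lform v \<pp> *\<^sub>R \<pp>"

lemma euc_perp: "euc v \<in> perp {q0, qinf, \<pp>}"
  by (auto simp: perp_def euc_def)

lemma lform_euc: "lform (euc v) (euc w) = lform v w + lform v qinf * lform w q0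
    + lform v q0 * lform w qinf + lform v \<pp> * lform w \<pp>"
  by (simp add: euc_def lform_sym[of q0 w] lform_sym[of qinf w] lform_sym[of \<pp> w] algebra_simps)

lemma perp_positive:
  assumes "w \<in> perp {q0, qinf, \<pp>}" "lform w w \<le> 0" shows "w = 0"
  by (rule positive_on_perp[of "q0 + qinf" \<pp>]) (use assms in \<open>auto simp: perp_def\<close>)

text \<open>The Euclidean part of such a vector has norm 0, so it vanishes.\<close>

lemma null_in_plane:
  assumes "lform v qinf = 0" "lform v \<pp> = 0" "lform v v = 0"
  shows "v = - lform v q0 *\<^sub>R qinf"
proof -
  have "euc v = 0" by (rule perp_positive[OF euc_perp]) (simp add: lform_euc assms)
  then show ?thesis using assms by (simp add: euc_def eq_neg_iff_add_eq_0)
qed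

end

subsection \<open>Bivectors\<close>

lemma wedge_add_left: "wedge (a + b) c = wedge a c + wedge b c"
  and wedge_add_right: "wedge a (b + c) = wedge a b + wedge a c"
  and wedge_scale_left: "wedge (s *\<^sub>R a) c = s *\<^sub>R wedge a c"
  and wedge_scale_right: "wedge a (s *\<^sub>R c) = s *\<^sub>R wedge a c"
  and wedge_self: "wedge a a = 0"
  and wedge_swap: "wedge a b = - wedge b a"
  by (rule blinfun_eqI; simp add: wedge_apply blinfun.bilinear_simps algebra_simps)+

lemma wedge_span2:
  assumes "\<omega> \<in> wedge_space V V" "V \<subseteq> span {a, b}"
  obtains s where "\<omega> = s *\<^sub>R wedge a b"
proof -
  have "wedge v w \<in> span {wedge a b}" if vw: "v \<in> V" "w \<in> V" for v w
  proof -
    obtain s t s' t' where "v = s *\<^sub>R a + t *\<^sub>R b" "w = s' *\<^sub>R a + t' *\<^sub>R b"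
      using assms(2) vw unfolding span2 by blast
    then have "wedge v w = (s * t' - t * s') *\<^sub>R wedge a b"
      by (simp add: wedge_add_left wedge_add_right wedge_scale_left wedge_scale_right wedge_self
          wedge_swap[of b a] algebra_simps)
    then show ?thesis by (simp add: span_base span_mul)
  qed
  then have "wedge_space V V \<subseteq> span {wedge a b}"
    unfolding wedge_space_def by (intro span_minimal) auto
  then show ?thesis using assms(1) that by (auto simp: span_singleton)
qed

lemma wedge_span3:
  assumes "\<omega> \<in> wedge_space V V" "V \<subseteq> span {a, b, c}"
  shows "\<omega> \<in> span {wedge a b, wedge a c, wedge b c}"
proof -
  have "wedge v w \<in> span {wedge a b, wedge a c, wedge b c}" if vw: "v \<in> V" "w \<in> V" for v w
  proof -
    have *: "\<exists>s t u. v = s *\<^sub>R a + t *\<^sub>R b + u *\<^sub>R c" if "v \<in> V" for v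
    proof -
      have "v \<in> span {a, b, c}" using that assms(2) by blast
      then obtain s w where "w \<in> span {b, c}" "v = s *\<^sub>R a + w" by (rule span_insertE)
      moreover from this obtain t u where "w = t *\<^sub>R b + u *\<^sub>R c" unfolding span2 by blast
      ultimately have "v = s *\<^sub>R a + t *\<^sub>R b + u *\<^sub>R c" by (simp add: algebra_simps)
      then show ?thesis by blast
    qed
    obtain s t u s' t' u' where "v = s *\<^sub>R a + t *\<^sub>R b + u *\<^sub>R c" "w = s' *\<^sub>R a + t' *\<^sub>R b + u' *\<^sub>R c"
      using *[OF vw(1)] *[OF vw(2)] by blast
    then have "wedge v w = (s * t' - t * s') *\<^sub>R wedge a b + (s * u' - u * s') *\<^sub>R wedge a c
        + (t * u' - u * t') *\<^sub>R wedge b c"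
      by (simp add: wedge_add_left wedge_add_right wedge_scale_left wedge_scale_right wedge_self
          wedge_swap[of b a] wedge_swap[of c a] wedge_swap[of c b] algebra_simps)
    then show ?thesis by (simp add: span_base span_mul span_add)
  qed
  then have "wedge_space V V \<subseteq> span {wedge a b, wedge a c, wedge b c}"
    unfolding wedge_space_def by (intro span_minimal) auto
  then show ?thesis using assms(1) by blast
qed

lemma wedge_perp_kills:
  assumes "\<omega> \<in> wedge_space f (perp f)" "isotropic f" "c \<in> f"
  shows "blinfun_apply \<omega> c = 0"
proof -
  have "subspace {\<omega>. blinfun_apply \<omega> c = 0}"
    by (auto simp: subspace_def blinfun.bilinear_simps)
  moreover have "{wedge a b | a b. a \<in> f \<and> b \<in> perp f} \<subseteq> {\<omega>. blinfun_apply \<omega> c = 0}"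
    using assms(2,3) by (auto simp: wedge_apply perp_def isotropic_def lform_sym)
  ultimately show ?thesis using assms(1) span_minimal unfolding wedge_space_def by blast
qed

text \<open>\<open>trace_on\<close> refers to an arbitrarily chosen basis. Decomposing the map into rank one maps with values
  in \<open>W\<close> evaluates the trace without knowing that basis.\<close>

lemma trace_on_rank_one_sum:
  assumes "finite I" "\<And>i. i \<in> I \<Longrightarrow> u i \<in> W" "\<And>v. v \<in> W \<Longrightarrow> L v = (\<Sum>i\<in>I. l i v *\<^sub>R u i)"
    and add: "\<And>i v w. i \<in> I \<Longrightarrow> v \<in> W \<Longrightarrow> w \<in> W \<Longrightarrow> l i (v + w) = l i v + l i w"
    and scale: "\<And>i s v. i \<in> I \<Longrightarrow> v \<in> W \<Longrightarrow> l i (s *\<^sub>R v) = s * l i v"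
    and "subspace W"
  shows "trace_on W L = (\<Sum>i\<in>I. l i (u i))"
proof -
  define B where "B = (SOME B. independent B \<and> span B = W)"
  have "\<exists>B. independent B \<and> span B = W"
    using basis_exists[of W] \<open>subspace W\<close> by (metis span_eq_iff span_mono span_subspace subset_antisym)
  then have B: "independent B" "span B = W" unfolding B_def by (metis (mono_tags, lifting) someI_ex)+
  have fB: "finite B" using B(1) independent_imp_finite by blast
  have BW: "b \<in> W" if "b \<in> B" for b using that B span_base by blast
  have W: "(\<Sum>b\<in>C. c b *\<^sub>R b) \<in> W" if "C \<subseteq> B" for C c
    using that BW \<open>subspace W\<close> by (intro subspace_sum subspace_scale) auto
  have lsum: "l i (\<Sum>b\<in>C. c b *\<^sub>R b) = (\<Sum>b\<in>C. c b * l i b)" if "i \<in> I" "C \<subseteq> B" for i C c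
  proof -
    have "finite C" using that fB finite_subset by blast
    then show ?thesis using that(2)
    proof (induction C rule: finite_induct)
      case empty
      have "0 \<in> W" using \<open>subspace W\<close> subspace_0 by blast
      then show ?case using scale[OF that(1), of 0 0] by simp
    next
      case (insert b C)
      then have "b \<in> W" using BW by auto
      then show ?case using insert W[of C c] BW[of b] add[OF that(1)] scale[OF that(1)]
          subspace_scale[OF \<open>subspace W\<close>] by simp
    qed
  qed
  have "trace_on W L = (\<Sum>b\<in>B. representation B (L b) b)"
    unfolding trace_on_def B_def[symmetric] Let_def ..
  also have "\<dots> = (\<Sum>b\<in>B. \<Sum>i\<in>I. l i b * representation B (u i) b)"
  proof (rule sum.cong[OF refl])
    fix b assume b: "b \<in> B"
    have u: "u i \<in> span B" if "i \<in> I" for i using that assms(2) B by auto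
    have "representation B (L b) b = representation B (\<Sum>i\<in>I. l i b *\<^sub>R u i) b"
      using assms(3) BW[OF b] by simp
    also have "\<dots> = (\<Sum>i\<in>I. representation B (l i b *\<^sub>R u i) b)"
      by (subst representation_sum[OF B(1)]) (auto intro: span_scale u)
    also have "\<dots> = (\<Sum>i\<in>I. l i b * representation B (u i) b)"
      by (intro sum.cong refl) (simp add: representation_scale[OF B(1) u])
    finally show "representation B (L b) b = (\<Sum>i\<in>I. l i b * representation B (u i) b)" .
  qed
  also have "\<dots> = (\<Sum>i\<in>I. \<Sum>b\<in>B. representation B (u i) b * l i b)"
    by (subst sum.swap) (simp add: mult.commute)
  also have "\<dots> = (\<Sum>i\<in>I. l i (u i))"
  proof (rule sum.cong[OF refl])
    fix i assume i: "i \<in> I"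
    have "u i = (\<Sum>b\<in>B. representation B (u i) b *\<^sub>R b)"
      using sum_representation_eq[OF B(1) _ fB subset_refl, of "u i"] assms(2)[OF i] B(2) by simp
    then show "(\<Sum>b\<in>B. representation B (u i) b * l i b) = l i (u i)"
      using lsum[OF i subset_refl, of "representation B (u i)"] by simp
  qed
  finally show ?thesis .
qed

section \<open>Legendre lifts\<close>

context surface
begin

lemma dd_lform:
  assumes "X \<in> tangent_space A r" "smooth_at A r g" "smooth_at A r h"
  shows "dd X (\<lambda>s. lform (g s) (h s)) = lform (dd X g) (h r) + lform (g r) (dd X h)"
  by (rule dd_bilinear[OF lform_bilinear assms])

lemma dd_lform_const:
  assumes "X \<in> tangent_space A r" "smooth_at A r g"
  shows "dd X (\<lambda>s. lform (g s) c) = lform (dd X g) c"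
  using dd_lform[OF assms smooth_atI[OF open_UNIV _ smooth_map_const], of c] assms(1) by simp

text \<open>The product rule when the product is constant: the derivative moves to the other factor.\<close>

lemma dd_lform_zero:
  assumes "X \<in> tangent_space A r" "open N" "r \<in> N" "smooth_map A N g" "smooth_map A N h"
    and "\<And>s. s \<in> N \<Longrightarrow> lform (g s) (h s) = c"
  shows "lform (dd X g) (h r) = - lform (g r) (dd X h)"
proof -
  have "dd X (\<lambda>s. lform (g s) (h s)) = dd X (\<lambda>s. c)"
    by (rule dd_cong[OF assms(1-3) assms(6)])
  then show ?thesis using dd_lform[OF assms(1) smooth_atI smooth_atI] assms by auto
qed

text \<open>Differentiating the contact condition \<open>(dg, h) = 0\<close> gives \<open>(d\<^sub>Xg, d\<^sub>Yh) = - (d\<^sub>Yd\<^sub>Xg, h)\<close> in a chart, and second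
  derivatives commute. For \<open>g\<close> and \<open>h\<close> spanning \<open>f\<close> this is the symmetry of the second fundamental form.\<close>

lemma contact_symmetric:
  assumes "open N" "r \<in> N" "smooth_map A N g" "smooth_map A N h"
    and contact: "\<And>s Z. s \<in> N \<Longrightarrow> Z \<in> tangent_space A s \<Longrightarrow> lform (dd Z g) (h s) = 0"
    and XY: "X \<in> tangent_space A r" "Y \<in> tangent_space A r"
  shows "lform (dd X g) (dd Y h) = lform (dd Y g) (dd X h)"
proof -
  obtain D \<phi> where D: "(D, \<phi>) \<in> A" "r \<in> D" by (rule chart_exists)
  obtain v where v: "X = chart_vec D \<phi> r v" using tangent_in_chart[OF XY(1) D] .
  obtain w where w: "Y = chart_vec D \<phi> r w" using tangent_in_chart[OF XY(2) D] .
  let ?S = "\<phi> ` (D \<inter> N)" and ?g = "\<lambda>z. g (inv_into D \<phi> z)" and ?h = "\<lambda>z. h (inv_into D \<phi> z)"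
  have S: "open ?S" "\<phi> r \<in> ?S" using open_chart_image D assms by auto
  have g: "Ck_on 2 ?S ?g" using smooth_mapD assms D by blast
  have h: "Ck_on 1 ?S ?h" using smooth_mapD assms D by blast
  have dh: "(?h has_derivative frechet_derivative ?h (at (\<phi> r))) (at (\<phi> r))"
    using h S by (auto simp: frechet_derivative_works[symmetric])
  have ddg: "((\<lambda>z. frechet_derivative ?g (at z) v) has_derivative
      frechet_derivative (\<lambda>z. frechet_derivative ?g (at z) v) (at (\<phi> r))) (at (\<phi> r))" for v
    using g S by (auto simp: frechet_derivative_works[symmetric] numeral_2_eq_2)
  have zero: "lform (frechet_derivative ?g (at z) v) (?h z) = 0" if z: "z \<in> ?S" for z v
  proof -
    obtain s where s: "s \<in> D" "s \<in> N" "z = \<phi> s" using z by blast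
    have "lform (dd (chart_vec D \<phi> s v) g) (h s) = 0"
      using contact[OF s(2) chart_vec_tangent[OF D(1) s(1)]] .
    then show ?thesis
      using dd_chart_vec[OF D(1) s(1) smooth_atI[OF assms(1) s(2) assms(3)]] chart_inv[OF D(1) s(1)] s(3)
      by simp
  qed
  have key: "lform (frechet_derivative ?g (at (\<phi> r)) v) (frechet_derivative ?h (at (\<phi> r)) w)
     = - lform (frechet_derivative (\<lambda>z. frechet_derivative ?g (at z) v) (at (\<phi> r)) w) (?h (\<phi> r))" for v w
  proof -
    have "((\<lambda>z. lform (frechet_derivative ?g (at z) v) (?h z)) has_derivative (\<lambda>w. 0)) (at (\<phi> r))"
      by (rule has_derivative_transform_within_open[OF has_derivative_const[of 0] S]) (simp add: zero)
    from has_derivative_unique[OF this bounded_bilinear.FDERIV[OF lform_bilinear ddg dh]]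
    show ?thesis by (simp add: fun_eq_iff add_eq_0_iff2)
  qed
  have "lform (frechet_derivative ?g (at (\<phi> r)) v) (frechet_derivative ?h (at (\<phi> r)) w)
      = lform (frechet_derivative ?g (at (\<phi> r)) w) (frechet_derivative ?h (at (\<phi> r)) v)"
    unfolding key using mixed_derivatives_commute[OF S g, of v w] by simp
  then show ?thesis unfolding v w
    using dd_chart_vec[OF D smooth_atI[OF assms(1-3)]] dd_chart_vec[OF D smooth_atI[OF assms(1,2,4)]] by simp
qed

end

locale lift = surface A + laguerre qinf q0 \<pp>
  for A :: "('m::{t2_space, second_countable_topology}) chart set" and qinf q0 \<pp> :: R42 +
  fixes U :: "'m set" and f :: "'m \<Rightarrow> R42 set" and x n :: "'m \<Rightarrow> R42"
  assumes openU: "open U" and lift: "legendre_lift A U qinf q0 \<pp> f x n"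
begin

lemma legendre: "legendre_map A U f"
  using lift unfolding legendre_lift_def by blast

text \<open>The point spheres \<open>F\<close> and the oriented tangent planes \<open>G\<close> form a global frame of \<open>f\<close>; \<open>G\<close> spans the
  intersection of \<open>f\<close> with the hyperplane orthogonal to \<open>qinf\<close>.\<close>

definition F where "F r = x r + q0 + (lform (x r) (x r) / 2) *\<^sub>R qinf"
definition G where "G r = n r + \<pp> + lform (n r) (x r) *\<^sub>R qinf"

lemma f_span: "r \<in> U \<Longrightarrow> f r = span {F r, G r}"
  using lift unfolding legendre_lift_def F_def G_def by blast

lemma smooth_x: "smooth_map A U x" and smooth_n: "smooth_map A U n"
  using lift unfolding legendre_lift_def by blast+

lemma smooth_F: "smooth_map A U F"
  unfolding F_def[abs_def]
  by (intro smooth_map_add smooth_map_scaleR smooth_map_divide smooth_map_bilinear[OF lform_bilinear]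
        smooth_map_const openU smooth_x) simp

lemma smooth_G: "smooth_map A U G"
  unfolding G_def[abs_def]
  by (intro smooth_map_add smooth_map_scaleR smooth_map_bilinear[OF lform_bilinear]
        smooth_map_const openU smooth_x smooth_n)

lemma smooth_at_FG: "r \<in> U \<Longrightarrow> smooth_at A r F" "r \<in> U \<Longrightarrow> smooth_at A r G"
  using smooth_atI openU smooth_F smooth_G by blast+

lemma FG_mem: "r \<in> U \<Longrightarrow> F r \<in> f r" "r \<in> U \<Longrightarrow> G r \<in> f r"
  by (auto simp: f_span intro: span_base)

lemma xn_forms:
  assumes "r \<in> U"
  shows "lform (x r) qinf = 0" "lform (x r) q0 = 0" "lform (x r) \<pp> = 0"
    "lform (n r) qinf = 0" "lform (n r) q0 = 0" "lform (n r) \<pp> = 0" "lform (n r) (n r) = 1"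
  using lift assms unfolding legendre_lift_def perp_def by auto

lemma FG_forms:
  assumes "r \<in> U"
  shows "lform (F r) qinf = -1" "lform (F r) \<pp> = 0" "lform (G r) qinf = 0" "lform (G r) \<pp> = -1"
  using xn_forms[OF assms] by (simp_all add: F_def G_def)

lemma f_isotropic: "r \<in> U \<Longrightarrow> isotropic (f r)"
  using legendre unfolding legendre_map_def by blast

lemma FG_null:
  assumes "r \<in> U" shows "lform (F r) (F r) = 0" "lform (F r) (G r) = 0" "lform (G r) (F r) = 0" "lform (G r) (G r) = 0"
  using f_isotropic[OF assms] FG_mem[OF assms] unfolding isotropic_def by blast+

text \<open>Since \<open>F\<close> and \<open>G\<close> pair with \<open>qinf\<close> and \<open>\<pp>\<close> as a dual basis up to sign, the coefficients of an
  element of \<open>f\<close> are inner products with these constants.\<close>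

lemma f_coeffs:
  assumes "r \<in> U" "v \<in> f r"
  shows "v = - lform v qinf *\<^sub>R F r - lform v \<pp> *\<^sub>R G r"
proof -
  obtain a b where v: "v = a *\<^sub>R F r + b *\<^sub>R G r" using assms f_span span2 by blast
  then have "lform v qinf = - a" "lform v \<pp> = - b" using FG_forms[OF assms(1)] by simp_all
  then show ?thesis using v by simp
qed

lemma f_subspace: "r \<in> U \<Longrightarrow> subspace (f r)"
  by (simp add: f_span)

lemma f_sub_perp: "r \<in> U \<Longrightarrow> v \<in> f r \<Longrightarrow> v \<in> perp (f r)"
  using f_isotropic unfolding isotropic_def perp_def by blast

lemma perp_fD: "v \<in> perp (f r) \<Longrightarrow> w \<in> f r \<Longrightarrow> lform v w = 0" "v \<in> perp (f r) \<Longrightarrow> w \<in> f r \<Longrightarrow> lform w v = 0"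
  by (auto simp: perp_def lform_sym[of w v])

lemma dd_perp:
  assumes "r \<in> U" "X \<in> tangent_space A r" "local_section A f r \<sigma>"
  shows "dd X \<sigma> \<in> perp (f r)"
proof -
  have "dd X \<sigma> \<in> derived_bundle A f r" unfolding derived_bundle_def
    by (rule span_base) (use assms in blast)
  then show ?thesis using legendre assms(1) unfolding legendre_map_def by blast
qed

lemma section_FG: "r \<in> U \<Longrightarrow> local_section A f r F" "r \<in> U \<Longrightarrow> local_section A f r G"
  unfolding local_section_def using openU smooth_F smooth_G FG_mem by blast+

lemma dFG_perp:
  assumes "r \<in> U" "X \<in> tangent_space A r" shows "dd X F \<in> perp (f r)" "dd X G \<in> perp (f r)"
  using dd_perp assms section_FG by blast+

lemma dFG_const:
  assumes "r \<in> U" "X \<in> tangent_space A r"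
  shows "lform (dd X F) qinf = 0" "lform (dd X F) \<pp> = 0" "lform (dd X G) qinf = 0" "lform (dd X G) \<pp> = 0"
  using dd_lform_zero[OF assms(2) openU assms(1) smooth_F smooth_map_const]
    dd_lform_zero[OF assms(2) openU assms(1) smooth_G smooth_map_const] FG_forms assms
  by simp_all

text \<open>In the frame \<open>F\<close>, \<open>G\<close> the derivatives of the coefficients only contribute elements of \<open>f\<close>. So modulo \<open>f\<close>
  the derivative of a section depends on its value alone.\<close>

lemma section_dd:
  assumes "r \<in> U" "X \<in> tangent_space A r" "local_section A f r \<sigma>"
  shows "dd X \<sigma> - (- lform (\<sigma> r) qinf *\<^sub>R dd X F - lform (\<sigma> r) \<pp> *\<^sub>R dd X G) \<in> f r"
proof -
  obtain N where N: "open N" "r \<in> N" "smooth_map A N \<sigma>" "\<And>s. s \<in> N \<Longrightarrow> \<sigma> s \<in> f s"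
    using assms(3) unfolding local_section_def by blast
  let ?g = "\<lambda>s. - lform (\<sigma> s) qinf" and ?k = "\<lambda>s. - lform (\<sigma> s) \<pp>"
  have sm: "smooth_map A N ?g" "smooth_map A N ?k"
    by (intro smooth_map_minus smooth_map_bilinear[OF lform_bilinear] N smooth_map_const)+
  then have at: "smooth_at A r ?g" "smooth_at A r ?k" using smooth_atI N by blast+
  have NU: "open (N \<inter> U)" "r \<in> N \<inter> U" using N openU assms(1) by auto
  have gF: "smooth_at A r (\<lambda>s. ?g s *\<^sub>R F s)" "smooth_at A r (\<lambda>s. ?k s *\<^sub>R G s)"
    by (rule smooth_atI[OF NU smooth_map_scaleR[OF NU(1) smooth_map_subset[OF sm(1)] smooth_map_subset[OF smooth_F]]], simp, simp)
      (rule smooth_atI[OF NU smooth_map_scaleR[OF NU(1) smooth_map_subset[OF sm(2)] smooth_map_subset[OF smooth_G]]], simp, simp)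
  have "dd X \<sigma> = dd X (\<lambda>s. ?g s *\<^sub>R F s + ?k s *\<^sub>R G s)"
    by (rule dd_cong[OF assms(2), of "N \<inter> U"]) (use N openU assms(1) f_coeffs[of _ "\<sigma> _"] in auto)
  also have "\<dots> = (dd X ?g *\<^sub>R F r + ?g r *\<^sub>R dd X F) + (dd X ?k *\<^sub>R G r + ?k r *\<^sub>R dd X G)"
    by (simp only: dd_add[OF assms(2) gF] dd_scaleR[OF assms(2) at(1) smooth_at_FG(1)[OF assms(1)]]
      dd_scaleR[OF assms(2) at(2) smooth_at_FG(2)[OF assms(1)]])
  finally have "dd X \<sigma> - (- lform (\<sigma> r) qinf *\<^sub>R dd X F - lform (\<sigma> r) \<pp> *\<^sub>R dd X G)
      = dd X ?g *\<^sub>R F r + dd X ?k *\<^sub>R G r" by simp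
  then show ?thesis unfolding f_span[OF assms(1)] span2 by blast
qed

lemma lform_section_dd:
  assumes "r \<in> U" "X \<in> tangent_space A r" "local_section A f r \<sigma>" "w \<in> perp (f r)"
  shows "lform w (dd X \<sigma>) = - lform (\<sigma> r) qinf * lform w (dd X F) - lform (\<sigma> r) \<pp> * lform w (dd X G)"
  using perp_fD(1)[OF assms(4) section_dd[OF assms(1-3)]] by simp

text \<open>The form on \<open>f\<^sup>\<bottom> / f\<close> is positive definite: subtracting the right combination of \<open>F\<close> and \<open>G\<close> leaves a
  null vector orthogonal to \<open>qinf\<close> and \<open>\<pp>\<close>, hence a multiple of \<open>qinf\<close>, which pairs nontrivially with \<open>F\<close>.\<close>

lemma perp_null_mem:
  assumes "r \<in> U" "v \<in> perp (f r)" "lform v v = 0" shows "v \<in> f r"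
proof -
  let ?w = "v + lform v qinf *\<^sub>R F r + lform v \<pp> *\<^sub>R G r"
  have v: "lform v (F r) = 0" "lform v (G r) = 0" "lform (F r) v = 0" "lform (G r) v = 0"
    using perp_fD assms FG_mem by blast+
  have "?w = - lform ?w q0 *\<^sub>R qinf"
    by (rule null_in_plane) (use FG_forms[OF assms(1)] FG_null[OF assms(1)] assms(3) v in simp_all)
  then have "lform ?w (F r) = - lform ?w q0 * lform qinf (F r)" by (metis lform_simps(5))
  then have "lform ?w q0 = 0"
    using v FG_null[OF assms(1)] FG_forms[OF assms(1)] lform_sym[of qinf "F r"] by simp
  then have "?w = 0" using \<open>?w = - lform ?w q0 *\<^sub>R qinf\<close> by simp
  moreover have "v = ?w + (- lform v qinf) *\<^sub>R F r + (- lform v \<pp>) *\<^sub>R G r" by simp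
  ultimately have "v = (- lform v qinf) *\<^sub>R F r + (- lform v \<pp>) *\<^sub>R G r" by (metis add_0)
  then show ?thesis unfolding f_span[OF assms(1)] span2 by blast
qed

subsection \<open>Fundamental forms\<close>

text \<open>\<open>F\<close> and \<open>G\<close> differ from \<open>x\<close> and \<open>n\<close> by constants and multiples of the null vector \<open>qinf\<close>,
  to which all derivatives are orthogonal.\<close>

lemma dd_xn:
  assumes "r \<in> U" "X \<in> tangent_space A r"
  shows "\<exists>c. dd X F = dd X x + c *\<^sub>R qinf" "\<exists>c. dd X G = dd X n + c *\<^sub>R qinf"
proof -
  have const: "smooth_at A r (\<lambda>r. c)" for c :: "'v::real_normed_vector"
    by (rule smooth_atI[OF open_UNIV]) auto
  have ax: "smooth_map A U (\<lambda>r. lform (x r) (x r) / 2)" "smooth_map A U (\<lambda>r. lform (n r) (x r))"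
    by (intro smooth_map_divide smooth_map_bilinear[OF lform_bilinear] openU smooth_x smooth_n smooth_map_const, simp)
       (intro smooth_map_bilinear[OF lform_bilinear] openU smooth_x smooth_n)
  have s1: "smooth_at A r (\<lambda>r. x r + q0)" "smooth_at A r (\<lambda>r. n r + \<pp>)"
    using smooth_map_add[OF openU smooth_x smooth_map_const] smooth_map_add[OF openU smooth_n smooth_map_const]
      smooth_atI[OF openU assms(1)] by blast+
  have s2: "smooth_at A r (\<lambda>r. (lform (x r) (x r) / 2) *\<^sub>R qinf)" "smooth_at A r (\<lambda>r. lform (n r) (x r) *\<^sub>R qinf)"
    using smooth_map_scaleR[OF openU ax(1) smooth_map_const] smooth_map_scaleR[OF openU ax(2) smooth_map_const]
      smooth_atI[OF openU assms(1)] by blast+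
  have s3: "smooth_at A r x" "smooth_at A r n" using smooth_atI[OF openU assms(1)] smooth_x smooth_n by blast+
  have s4: "smooth_at A r (\<lambda>r. lform (x r) (x r) / 2)" "smooth_at A r (\<lambda>r. lform (n r) (x r))"
    using smooth_atI[OF openU assms(1)] ax by blast+
  have "dd X F = dd X x + dd X (\<lambda>r. lform (x r) (x r) / 2) *\<^sub>R qinf"
    unfolding F_def[abs_def] dd_add[OF assms(2) s1(1) s2(1)] dd_add[OF assms(2) s3(1) const]
      dd_scaleR[OF assms(2) s4(1) const] dd_const[OF assms(2)] by simp
  then show "\<exists>c. dd X F = dd X x + c *\<^sub>R qinf" by blast
  have "dd X G = dd X n + dd X (\<lambda>r. lform (n r) (x r)) *\<^sub>R qinf"
    unfolding G_def[abs_def] dd_add[OF assms(2) s1(2) s2(2)] dd_add[OF assms(2) s3(2) const]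
      dd_scaleR[OF assms(2) s4(2) const] dd_const[OF assms(2)] by simp
  then show "\<exists>c. dd X G = dd X n + c *\<^sub>R qinf" by blast
qed

lemma forms_FG:
  assumes "r \<in> U" "X \<in> tangent_space A r" "Y \<in> tangent_space A r"
  shows "second_form x n X Y = - lform (dd X F) (dd Y G)" "third_form n X Y = lform (dd X G) (dd Y G)"
proof -
  obtain a b c where *: "dd X F = dd X x + a *\<^sub>R qinf" "dd X G = dd X n + b *\<^sub>R qinf" "dd Y G = dd Y n + c *\<^sub>R qinf"
    using dd_xn assms by metis
  note q = dFG_const[OF assms(1,2)] dFG_const[OF assms(1,3)]
  have "lform (dd X x) qinf = 0" "lform (dd X n) qinf = 0" "lform (dd Y n) qinf = 0"
    using q * by simp_all
  then have "lform (dd X x) qinf = 0" "lform (dd X n) qinf = 0" "lform qinf (dd Y n) = 0"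
    by (simp_all add: lform_sym[of qinf "dd Y n"])
  then show "second_form x n X Y = - lform (dd X F) (dd Y G)" "third_form n X Y = lform (dd X G) (dd Y G)"
    by (simp_all add: second_form_def third_form_def *)
qed

lemma section_contact_symmetric:
  assumes "r \<in> U" "local_section A f r \<sigma>" "local_section A f r \<rho>"
    and XY: "X \<in> tangent_space A r" "Y \<in> tangent_space A r"
  shows "lform (dd X \<sigma>) (dd Y \<rho>) = lform (dd Y \<sigma>) (dd X \<rho>)"
proof -
  obtain N N' where N: "open N" "r \<in> N" "smooth_map A N \<sigma>" "\<forall>s\<in>N. \<sigma> s \<in> f s"
     "open N'" "r \<in> N'" "smooth_map A N' \<rho>" "\<forall>s\<in>N'. \<rho> s \<in> f s"
    using assms(2,3) unfolding local_section_def by blast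
  let ?M = "N \<inter> N' \<inter> U"
  show ?thesis
  proof (rule contact_symmetric[OF _ _ _ _ _ XY])
    show "open ?M" "r \<in> ?M" using N openU assms(1) by auto
    show "smooth_map A ?M \<sigma>" "smooth_map A ?M \<rho>"
      by (rule smooth_map_subset[OF N(3)], blast) (rule smooth_map_subset[OF N(7)], blast)
    fix s Z assume s: "s \<in> ?M" "Z \<in> tangent_space A s"
    have "local_section A f s \<sigma>" unfolding local_section_def using N s by blast
    then have "dd Z \<sigma> \<in> perp (f s)" using dd_perp s by blast
    then show "lform (dd Z \<sigma>) (\<rho> s) = 0" using perp_fD N s by blast
  qed
qed

end

section \<open>The middle potential\<close>

context surface
begin

lemma smooth_map_continuous:
  assumes "open N" "smooth_map A N g" shows "continuous_on N g"
proof (rule continuous_at_imp_continuous_on, rule ballI)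
  fix r assume r: "r \<in> N"
  obtain D \<phi> where D: "(D, \<phi>) \<in> A" "r \<in> D" by (rule chart_exists)
  have oD: "open D" "homeomorphism D (\<phi> ` D) \<phi> (inv_into D \<phi>)"
    using atlas D(1) unfolding smooth_atlas_def by auto
  have \<phi>: "continuous_on (D \<inter> N) \<phi>"
    by (rule continuous_on_subset[OF homeomorphism_cont1[OF oD(2)]]) simp
  have "Ck_on 0 (\<phi> ` (D \<inter> N)) (\<lambda>z. g (inv_into D \<phi> z))" by (rule smooth_mapD[OF assms(2) D(1)])
  then have "continuous_on (D \<inter> N) (\<lambda>s. g (inv_into D \<phi> (\<phi> s)))"
    using continuous_on_compose[OF \<phi>] by (simp add: comp_def)
  then have "continuous_on (D \<inter> N) g" by (rule continuous_on_eq) (simp add: chart_inv[OF D(1)])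
  then show "isCont g r"
    using continuous_on_interior[of "D \<inter> N" g r] D r interior_open[OF oD(1)] interior_open[OF assms(1)] by simp
qed

lemma vector_field_tangent: "vector_field A N Y \<Longrightarrow> q \<in> N \<Longrightarrow> Y q \<in> tangent_space A q"
  by (simp add: vector_field_def)

lemma nonzero_tangentE:
  assumes "X \<noteq> zero_vec" obtains g where "X g \<noteq> 0"
proof -
  have "\<exists>g. X g \<noteq> 0" using assms by (simp add: zero_vec_def fun_eq_iff)
  then show ?thesis using that by blast
qed

lemma not_smooth_at_zero:
  assumes "X \<in> tangent_space A r" "\<not> smooth_at A r g" shows "X g = 0"
proof -
  obtain D \<phi> v where "X = chart_vec D \<phi> r v" by (rule tangentE[OF assms(1)])
  then show ?thesis using assms(2) by (simp add: chart_vec_def)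
qed

lemma smooth_map_dd:
  assumes "vector_field A N Y" "open M" "M \<subseteq> N" "smooth_map A M \<sigma>"
  shows "smooth_map A M (\<lambda>s. dd (Y s) \<sigma>)"
proof -
  have "smooth_map A M (\<lambda>s. Y s (\<lambda>r. \<sigma> r \<bullet> b))" for b
    using assms smooth_map_linear[OF bounded_linear_inner_left assms(2,4)] unfolding vector_field_def by blast
  then show ?thesis unfolding dd_def
    by (intro smooth_map_sum smooth_map_scaleR assms(2) smooth_map_const) auto
qed

lemma vector_field_subset: "vector_field A N Y \<Longrightarrow> M \<subseteq> N \<Longrightarrow> vector_field A M Y"
  unfolding vector_field_def by (meson subsetD subset_trans)

text \<open>The span defining the cyclide bundle runs over all sections and fields, but replacing \<open>\<sigma>\<close> by \<open>g\<sigma>\<close> and \<open>Y\<close> by \<open>kY\<close> with smooth functions \<open>g\<close> and \<open>k\<close> changes the second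
  derivative only by lower order terms.\<close>

lemma cyclide_bundle_span:
  assumes N: "open N" "r \<in> N" and \<sigma>: "smooth_map A N \<sigma>" and Y: "vector_field A N Y"
    and s: "\<And>q. q \<in> N \<Longrightarrow> s q = span {\<sigma> q}" "\<And>q. q \<in> N \<Longrightarrow> \<sigma> q \<noteq> 0"
    and T: "\<And>q. q \<in> N \<Longrightarrow> T q = {lin_comb a (Y q) 0 (Y q) | a. True}" "Y r \<noteq> zero_vec"
  shows "cyclide_bundle A s T r \<subseteq> span {\<sigma> r, dd (Y r) \<sigma>, dd (Y r) (\<lambda>q. dd (Y q) \<sigma>)}" (is "_ \<subseteq> ?V")
proof -
  have "{\<sigma>' r, dd (Y' r) \<sigma>', dd (Y' r) (\<lambda>q. dd (Y' q) \<sigma>')} \<subseteq> ?V"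
    if sec: "local_section A s r \<sigma>'" and N2: "open N2" "r \<in> N2" "vector_field A N2 Y'" "\<And>q. q \<in> N2 \<Longrightarrow> Y' q \<in> T q"
    for \<sigma>' Y' N2
  proof -
    obtain N1 where N1: "open N1" "r \<in> N1" "smooth_map A N1 \<sigma>'" "\<And>q. q \<in> N1 \<Longrightarrow> \<sigma>' q \<in> s q"
      using sec unfolding local_section_def by blast
    have tan: "Y q \<in> tangent_space A q" if "q \<in> N" for q by (rule vector_field_tangent[OF Y that])
    \<comment> \<open>a function detecting \<open>Y\<close>, which shows that the coefficient \<open>k\<close> of \<open>Y'\<close> is smooth\<close>
    obtain g0 where g0: "Y r g0 \<noteq> 0" using nonzero_tangentE[OF T(2)] .
    have "smooth_at A r g0"
      using not_smooth_at_zero[OF tan[OF N(2)]] g0 by blast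
    then obtain N3 where N3: "open N3" "r \<in> N3" "smooth_map A N3 g0" unfolding smooth_at_def by blast
    let ?M = "N \<inter> N1 \<inter> N2 \<inter> N3"
    have oM: "open ?M" by (intro open_Int N(1) N1(1) N3(1) N2(1))
    have g0M: "smooth_map A ?M g0" by (rule smooth_map_subset[OF N3(3)]) blast
    have "smooth_map A ?M (\<lambda>q. dd (Y q) g0)" "smooth_map A ?M (\<lambda>q. dd (Y' q) g0)"
      by (rule smooth_map_dd[OF Y oM _ g0M], blast) (rule smooth_map_dd[OF N2(3) oM _ g0M], blast)
    then have smY: "smooth_map A ?M (\<lambda>q. Y q g0)" "smooth_map A ?M (\<lambda>q. Y' q g0)"
      by (simp_all only: dd_real)
    define M where "M = ?M \<inter> (\<lambda>q. Y q g0) -` (- {0})"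
    have "open M" unfolding M_def
      by (rule continuous_open_preimage[OF smooth_map_continuous[OF oM smY(1)] oM]) auto
    moreover have "r \<in> M" using N(2) N1(2) N3(2) N2(2) g0 by (simp add: M_def)
    moreover have "M \<subseteq> ?M" unfolding M_def by blast
    moreover have "Y q g0 \<noteq> 0" if "q \<in> M" for q using that by (simp add: M_def)
    ultimately have M: "open M" "r \<in> M" "M \<subseteq> ?M" "\<And>q. q \<in> M \<Longrightarrow> Y q g0 \<noteq> 0" by blast+
    have inM: "q \<in> N" "q \<in> N1" "q \<in> N2" if "q \<in> M" for q using that M(3) by blast+
    define g where "g q = (\<sigma>' q \<bullet> \<sigma> q) / (\<sigma> q \<bullet> \<sigma> q)" for q
    define k where "k q = Y' q g0 / Y q g0" for q
    have \<sigma>M: "smooth_map A M \<sigma>" "smooth_map A M \<sigma>'"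
      by (rule smooth_map_subset[OF \<sigma>], use M in blast) (rule smooth_map_subset[OF N1(3)], use M in blast)
    have YM: "vector_field A M Y" by (rule vector_field_subset[OF Y]) (use M in blast)
    have smg: "smooth_map A M g" unfolding g_def
      by (intro smooth_map_divide smooth_map_bilinear[OF bounded_bilinear_inner] M(1) \<sigma>M)
        (simp add: s(2) inM(1))
    have smk: "smooth_map A M k" unfolding k_def
      by (intro smooth_map_divide M(1) M(4) smooth_map_subset[OF smY(1) M(3)] smooth_map_subset[OF smY(2) M(3)])
    have \<sigma>': "\<sigma>' q = g q *\<^sub>R \<sigma> q" if "q \<in> M" for q
    proof -
      have "\<sigma>' q \<in> span {\<sigma> q}" "\<sigma> q \<noteq> 0" using N1(4)[of q] s[of q] inM[OF that] by simp_all
      then show ?thesis by (auto simp: span_singleton g_def)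
    qed
    have Y': "dd (Y' q) \<tau> = k q *\<^sub>R dd (Y q) \<tau>" if q: "q \<in> M" for q and \<tau> :: "'m \<Rightarrow> 'v::euclidean_space"
    proof -
      have "Y' q \<in> T q" "q \<in> N" using N2(4) inM[OF q] by simp_all
      then obtain a where a: "Y' q = lin_comb a (Y q) 0 (Y q)" using T(1)[of q] by blast
      then have "a = k q" using M(4)[OF q] by (simp add: k_def lin_comb_def)
      then show ?thesis using a by (simp add: dd_lin_comb)
    qed
    have at: "smooth_at A q h" if "smooth_map A M h" "q \<in> M" for q and h :: "'m \<Rightarrow> 'w::real_normed_vector"
      by (rule smooth_atI[OF M(1) that(2,1)])
    have tanM: "Y q \<in> tangent_space A q" if "q \<in> M" for q by (rule tan[OF inM(1)[OF that]])
    have smd: "smooth_map A M (\<lambda>q. dd (Y q) \<sigma>)" "smooth_map A M (\<lambda>q. dd (Y q) g)"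
      by (intro smooth_map_dd[OF YM M(1) subset_refl] \<sigma>M smg)+
    have d1: "dd (Y' q) \<sigma>' = (k q * dd (Y q) g) *\<^sub>R \<sigma> q + (k q * g q) *\<^sub>R dd (Y q) \<sigma>" if "q \<in> M" for q
    proof -
      have "dd (Y q) \<sigma>' = dd (Y q) (\<lambda>q. g q *\<^sub>R \<sigma> q)"
        by (rule dd_cong[OF tanM[OF that] M(1) that \<sigma>'])
      also have "\<dots> = dd (Y q) g *\<^sub>R \<sigma> q + g q *\<^sub>R dd (Y q) \<sigma>"
        by (rule dd_scaleR[OF tanM[OF that] at[OF smg that] at[OF \<sigma>M(1) that]])
      finally show ?thesis by (simp add: Y'[OF that] algebra_simps)
    qed
    let ?a = "\<lambda>q. k q * dd (Y q) g" and ?b = "\<lambda>q. k q * g q"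
    have sab: "smooth_map A M ?a" "smooth_map A M ?b"
      by (intro smooth_map_mult M(1) smk smd smg)+
    have "dd (Y r) (\<lambda>q. dd (Y' q) \<sigma>') = dd (Y r) (\<lambda>q. ?a q *\<^sub>R \<sigma> q + ?b q *\<^sub>R dd (Y q) \<sigma>)"
      by (rule dd_cong[OF tanM[OF M(2)] M(1,2) d1])
    also have "\<dots> = (dd (Y r) ?a *\<^sub>R \<sigma> r + ?a r *\<^sub>R dd (Y r) \<sigma>)
        + (dd (Y r) ?b *\<^sub>R dd (Y r) \<sigma> + ?b r *\<^sub>R dd (Y r) (\<lambda>q. dd (Y q) \<sigma>))"
      using dd_add[OF tanM[OF M(2)] at[OF smooth_map_scaleR[OF M(1) sab(1) \<sigma>M(1)] M(2)]
          at[OF smooth_map_scaleR[OF M(1) sab(2) smd(1)] M(2)]]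
        dd_scaleR[OF tanM[OF M(2)] at[OF sab(1) M(2)] at[OF \<sigma>M(1) M(2)]]
        dd_scaleR[OF tanM[OF M(2)] at[OF sab(2) M(2)] at[OF smd(1) M(2)]] by simp
    finally have "dd (Y' r) (\<lambda>q. dd (Y' q) \<sigma>') \<in> ?V"
      by (simp add: Y'[OF M(2)] span_add span_scale span_base)
    then show ?thesis using \<sigma>'[OF M(2)] d1[OF M(2)] by (simp add: span_add span_scale span_base)
  qed
  then show ?thesis unfolding cyclide_bundle_def by (intro span_minimal subspace_span) blast
qed

end

text \<open>Write \<open>S\<^sub>i = \<langle>u\<^sub>i, y\<^sub>i, z\<^sub>i\<rangle>\<close>. As only \<open>z\<^sub>i\<close> pairs nontrivially with \<open>u\<^sub>i\<close>, applying \<open>\<alpha>\<close> to \<open>u\<^sub>i\<close> reads off the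
  coefficients of the two bivectors involving \<open>z\<^sub>i\<close>.\<close>

lemma bivector_killing_null_pair:
  assumes "\<alpha> \<in> span (wedge_space S1 S1 \<union> wedge_space S2 S2)"
    and S: "S1 \<subseteq> span {u1, y1, z1}" "S2 \<subseteq> span {u2, y2, z2}"
    and kill: "blinfun_apply \<alpha> u1 = 0" "blinfun_apply \<alpha> u2 = 0"
    and "lform u1 u1 = 0" "lform y1 u1 = 0" "lform z1 u1 \<noteq> 0"
    and "lform u2 u2 = 0" "lform y2 u2 = 0" "lform z2 u2 \<noteq> 0"
    and "lform u1 u2 = 0" "lform y1 u2 = 0" "lform z1 u2 = 0" "lform y2 u1 = 0" "lform z2 u1 = 0"
    and ind: "u1 \<noteq> 0" "y1 \<notin> span {u1}" "u2 \<noteq> 0" "y2 \<notin> span {u2}"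
  obtains a b where "\<alpha> = a *\<^sub>R wedge u1 y1 + b *\<^sub>R wedge u2 y2"
proof -
  let ?W = "span {wedge u1 y1, wedge u1 z1, wedge y1 z1, wedge u2 y2, wedge u2 z2, wedge y2 z2}"
  have "wedge_space S1 S1 \<subseteq> ?W"
    by (rule subset_trans[OF _ span_mono[of "{wedge u1 y1, wedge u1 z1, wedge y1 z1}"]])
      (rule subsetI, erule wedge_span3[OF _ S(1)], simp)
  moreover have "wedge_space S2 S2 \<subseteq> ?W"
    by (rule subset_trans[OF _ span_mono[of "{wedge u2 y2, wedge u2 z2, wedge y2 z2}"]])
      (rule subsetI, erule wedge_span3[OF _ S(2)], simp)
  ultimately have "span (wedge_space S1 S1 \<union> wedge_space S2 S2) \<subseteq> ?W"
    by (intro span_minimal[OF Un_least subspace_span])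
  then have "\<alpha> \<in> ?W" using assms(1) by (rule subsetD)
  then obtain a1 w1 where 1: "w1 \<in> span {wedge u1 z1, wedge y1 z1, wedge u2 y2, wedge u2 z2, wedge y2 z2}"
    "\<alpha> = a1 *\<^sub>R wedge u1 y1 + w1" by (rule span_insertE)
  obtain a2 w2 where 2: "w2 \<in> span {wedge y1 z1, wedge u2 y2, wedge u2 z2, wedge y2 z2}"
    "w1 = a2 *\<^sub>R wedge u1 z1 + w2" using 1(1) by (rule span_insertE)
  obtain a3 w3 where 3: "w3 \<in> span {wedge u2 y2, wedge u2 z2, wedge y2 z2}"
    "w2 = a3 *\<^sub>R wedge y1 z1 + w3" using 2(1) by (rule span_insertE)
  obtain b1 w4 where 4: "w4 \<in> span {wedge u2 z2, wedge y2 z2}"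
    "w3 = b1 *\<^sub>R wedge u2 y2 + w4" using 3(1) by (rule span_insertE)
  obtain b2 b3 where 5: "w4 = b2 *\<^sub>R wedge u2 z2 + b3 *\<^sub>R wedge y2 z2"
    using 4(1) unfolding span2 by blast
  note \<alpha> = 1(2)[unfolded 2(2) 3(2) 4(2) 5]
  note sym = lform_sym[of u2 u1] lform_sym[of u1 y1] lform_sym[of u1 z1] lform_sym[of u2 y2] lform_sym[of u2 z2]
  have "blinfun_apply \<alpha> u1 = - lform z1 u1 *\<^sub>R (a2 *\<^sub>R u1 + a3 *\<^sub>R y1)"
    unfolding \<alpha> using assms(6-16) by (simp add: blinfun.bilinear_simps wedge_apply sym algebra_simps)
  then have 1: "a2 *\<^sub>R u1 + a3 *\<^sub>R y1 = 0" using kill(1) assms(8) by simp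
  have "blinfun_apply \<alpha> u2 = - lform z2 u2 *\<^sub>R (b2 *\<^sub>R u2 + b3 *\<^sub>R y2)"
    unfolding \<alpha> using assms(6-16) by (simp add: blinfun.bilinear_simps wedge_apply sym algebra_simps)
  then have 2: "b2 *\<^sub>R u2 + b3 *\<^sub>R y2 = 0" using kill(2) assms(11) by simp
  have zero: "a = 0 \<and> b = 0" if "a *\<^sub>R u + b *\<^sub>R y = 0" "u \<noteq> 0" "y \<notin> span {u}" for a b and u y :: R42
  proof -
    have "b = 0"
    proof (rule ccontr)
      assume "b \<noteq> 0"
      have "b *\<^sub>R y = (- a) *\<^sub>R u" using that(1) by (simp add: add_eq_0_iff)
      then have "y = (1 / b) *\<^sub>R ((- a) *\<^sub>R u)" using \<open>b \<noteq> 0\<close> by (metis divide_self scaleR_one scaleR_scaleR times_divide_eq_left mult_1)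
      then show False using that(3) by (metis span_base span_scale singletonI)
    qed
    then show ?thesis using that by simp
  qed
  have "a2 = 0" "a3 = 0" "b2 = 0" "b3 = 0" using zero[OF 1] zero[OF 2] ind by blast+
  then show ?thesis using that[of a1 b1] \<alpha> by simp
qed

text \<open>The setting of the theorem before the conserved quantity enters; \<open>mid\<close> is the middle potential.\<close>

locale omega_lift = lift A qinf q0 \<pp> UNIV f x n
  for A :: "('m::{t2_space, second_countable_topology}) chart set" and qinf q0 \<pp> :: R42 and f x n +
  fixes s1 s2 :: "'m \<Rightarrow> R42 set" and T1 T2 :: "'m \<Rightarrow> 'm tangent set" and \<eta> mid :: "'m form1"
  assumes Omega: "Omega_surface A f \<eta>"
    and umbilic: "umbilic_free A f s1 s2 T1 T2"
    and middle: "middle_potential A f s1 s2 T1 T2 \<eta> mid"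
begin

lemma gauge: "gauge_potential A f \<eta>"
  using Omega unfolding Omega_surface_def by blast

lemma \<eta>_kills: "Z \<in> tangent_space A r \<Longrightarrow> c \<in> f r \<Longrightarrow> blinfun_apply (\<eta> r Z) c = 0"
  using gauge f_isotropic unfolding gauge_potential_def by (intro wedge_perp_kills) auto

text \<open>As \<open>F \<and> G\<close> trivialises \<open>\<Lambda>\<^sup>2f\<close>, the gauge is given by a function \<open>h\<close>. Its derivative is multiplied by
  \<open>F \<and> G\<close>, which annihilates \<open>f\<^sup>\<bottom>\<close>, so only its value matters there.\<close>

lemma mid_gauge:
  obtains h where "\<And>r Z c. Z \<in> tangent_space A r \<Longrightarrow> c \<in> perp (f r) \<Longrightarrow>
    blinfun_apply (mid r Z) c = blinfun_apply (\<eta> r Z) c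
      - h r *\<^sub>R (lform (dd Z F) c *\<^sub>R G r - lform (dd Z G) c *\<^sub>R F r)"
proof -
  have "in_gauge_orbit A f \<eta> mid" using middle unfolding middle_potential_def by blast
  then obtain \<tau> where \<tau>: "smooth_endo A UNIV \<tau>" "\<And>p. \<tau> p \<in> wedge_space (f p) (f p)"
    and mid: "\<And>p Z c. Z \<in> tangent_space A p \<Longrightarrow>
          blinfun_apply (mid p Z) c = blinfun_apply (\<eta> p Z) c - dd Z (\<lambda>r. blinfun_apply (\<tau> r) c)"
    unfolding in_gauge_orbit_def by auto
  \<comment> \<open>since \<open>F \<and> G\<close> sends \<open>qinf\<close> to \<open>- G\<close>, and \<open>(G, \<pp>) = -1\<close>\<close>
  define h where "h r = lform (blinfun_apply (\<tau> r) qinf) \<pp>" for r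
  have "smooth_map A UNIV (\<lambda>r. blinfun_apply (\<tau> r) qinf)" using \<tau>(1) unfolding smooth_endo_def by (rule spec)
  then have smh: "smooth_map A UNIV h"
    unfolding h_def by (intro smooth_map_bilinear[OF lform_bilinear] smooth_map_const open_UNIV)
  have \<tau>h: "\<tau> r = h r *\<^sub>R wedge (F r) (G r)" for r
  proof -
    have "f r \<subseteq> span {F r, G r}" by (simp add: f_span)
    from wedge_span2[OF \<tau>(2) this] obtain k where k: "\<tau> r = k *\<^sub>R wedge (F r) (G r)" .
    then have "h r = k" using FG_forms[of r] by (simp add: h_def blinfun.bilinear_simps wedge_apply)
    then show ?thesis using k by simp
  qed
  have "dd Z (\<lambda>s. blinfun_apply (\<tau> s) c) = h r *\<^sub>R (lform (dd Z F) c *\<^sub>R G r - lform (dd Z G) c *\<^sub>R F r)"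
    if Z: "Z \<in> tangent_space A r" and c: "c \<in> perp (f r)" for r Z c
  proof -
    have FG: "smooth_at A r F" "smooth_at A r G" using smooth_at_FG by simp_all
    have sm: "smooth_map A UNIV (\<lambda>s. lform (F s) c)" "smooth_map A UNIV (\<lambda>s. - lform (G s) c)"
      by (intro smooth_map_minus smooth_map_bilinear[OF lform_bilinear] open_UNIV smooth_F smooth_G smooth_map_const)+
    then have at: "smooth_at A r (\<lambda>s. lform (F s) c)" "smooth_at A r (\<lambda>s. - lform (G s) c)" "smooth_at A r h"
      using smooth_atI[OF open_UNIV] smh by blast+
    have sm2: "smooth_map A UNIV (\<lambda>s. lform (F s) c *\<^sub>R G s)" "smooth_map A UNIV (\<lambda>s. (- lform (G s) c) *\<^sub>R F s)"
      by (intro smooth_map_scaleR open_UNIV sm smooth_F smooth_G)+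
    let ?W = "\<lambda>s. lform (F s) c *\<^sub>R G s + (- lform (G s) c) *\<^sub>R F s"
    have at2: "smooth_at A r (\<lambda>s. lform (F s) c *\<^sub>R G s)" "smooth_at A r (\<lambda>s. (- lform (G s) c) *\<^sub>R F s)" "smooth_at A r ?W"
      using smooth_atI[OF open_UNIV] sm2 smooth_map_add[OF open_UNIV sm2] by blast+
    have "(\<lambda>s. blinfun_apply (\<tau> s) c) = (\<lambda>s. h s *\<^sub>R ?W s)"
      by (simp add: \<tau>h blinfun.bilinear_simps wedge_apply)
    then have "dd Z (\<lambda>s. blinfun_apply (\<tau> s) c) = dd Z h *\<^sub>R ?W r + h r *\<^sub>R dd Z ?W"
      using dd_scaleR[OF Z at(3) at2(3)] by simp
    moreover have c0: "lform (F r) c = 0" "lform (G r) c = 0" using perp_fD(2)[OF c] FG_mem by simp_all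
    moreover have "dd Z (\<lambda>s. - lform (G s) c) = - lform (dd Z G) c"
      using dd_lform_const[OF Z FG(2), of "- c"] by simp
    ultimately show ?thesis
      using dd_add[OF Z at2(1,2)] dd_scaleR[OF Z at(1) FG(2)] dd_scaleR[OF Z at(2) FG(1)]
        dd_lform_const[OF Z FG(1), of c] by simp
  qed
  then show ?thesis using that mid by metis
qed

lemma mid_kills: 
  assumes "Z \<in> tangent_space A r" "c \<in> f r" shows "blinfun_apply (mid r Z) c = 0"
proof -
  have "c \<in> perp (f r)" "lform (dd Z F) c = 0" "lform (dd Z G) c = 0"
    using f_sub_perp dFG_perp[OF _ assms(1)] perp_fD(1) assms(2) by auto
  then show ?thesis using \<eta>_kills[OF assms] by (rule_tac mid_gauge) (simp add: assms(1))
qed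

text \<open>The quadratic form is invariant in the gauge orbit, because the gauge term contributes to the
  trace a multiple of the skew part of \<open>(dF, dG)\<close>, which is symmetric. So \<open>q\<close> may be computed from a given
  expression for the middle potential.\<close>

lemma gauge_q_mid:
  assumes Z: "Z \<in> tangent_space A r" "W \<in> tangent_space A r"
    and \<sigma>: "local_section A f r \<sigma>1" "local_section A f r \<sigma>2"
    and y: "y1 \<in> perp (f r)" "y2 \<in> perp (f r)"
    and mid: "mid r Z = a *\<^sub>R wedge (\<sigma>1 r) y1 + b *\<^sub>R wedge (\<sigma>2 r) y2 + c *\<^sub>R wedge (\<sigma>1 r) (\<sigma>2 r)"
  shows "gauge_q A f \<eta> r Z W = - a * lform y1 (dd W \<sigma>1) - b * lform y2 (dd W \<sigma>2)"
proof -
  obtain h where h: "\<And>r Z c. Z \<in> tangent_space A r \<Longrightarrow> c \<in> perp (f r) \<Longrightarrow>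
    blinfun_apply (mid r Z) c = blinfun_apply (\<eta> r Z) c
      - h r *\<^sub>R (lform (dd Z F) c *\<^sub>R G r - lform (dd Z G) c *\<^sub>R F r)" by (rule mid_gauge) blast
  define \<sigma> where "\<sigma> v = (SOME \<sigma>. local_section A f r \<sigma> \<and> \<sigma> r = v)" for v
  have \<sigma>v: "local_section A f r (\<sigma> v)" "\<sigma> v r = v" if vf: "v \<in> f r" for v
  proof -
    obtain s t where v: "v = s *\<^sub>R F r + t *\<^sub>R G r" using vf f_span[of r] unfolding span2 by auto
    have "smooth_map A UNIV (\<lambda>q. s *\<^sub>R F q + t *\<^sub>R G q)"
      by (intro smooth_map_add smooth_map_scaleR open_UNIV smooth_map_const smooth_F smooth_G)
    moreover have "s *\<^sub>R F q + t *\<^sub>R G q \<in> f q" for q using f_span[of q] unfolding span2 by auto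
    ultimately have "local_section A f r (\<lambda>q. s *\<^sub>R F q + t *\<^sub>R G q) \<and> (\<lambda>q. s *\<^sub>R F q + t *\<^sub>R G q) r = v"
      unfolding local_section_def v using open_UNIV by blast
    then have "\<exists>\<sigma>. local_section A f r \<sigma> \<and> \<sigma> r = v" by (intro exI[of _ "\<lambda>q. s *\<^sub>R F q + t *\<^sub>R G q"])
    then have "local_section A f r (\<sigma> v) \<and> \<sigma> v r = v" unfolding \<sigma>_def by (rule someI_ex)
    then show "local_section A f r (\<sigma> v)" "\<sigma> v r = v" by auto
  qed
  define d where "d w v = lform w (dd W (\<sigma> v))" for w v
  have d: "d w v = - lform v qinf * lform w (dd W F) - lform v \<pp> * lform w (dd W G)"
    if "w \<in> perp (f r)" "v \<in> f r" for w v
    using lform_section_dd[OF _ Z(2) \<sigma>v(1)[OF that(2)] that(1)] \<sigma>v(2)[OF that(2)] by (simp add: d_def)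
  have d\<sigma>: "d w (\<rho> r) = lform w (dd W \<rho>)" if "w \<in> perp (f r)" "local_section A f r \<rho>" for w \<rho>
  proof -
    have "\<rho> r \<in> f r" using that(2) unfolding local_section_def by blast
    then show ?thesis using d[OF that(1)] lform_section_dd[OF _ Z(2) that(2,1)] by simp
  qed
  define u where "u = (!) [\<sigma>1 r, \<sigma>2 r, G r, F r]"
  define l where "l = (!) [\<lambda>v. - a * d y1 v, \<lambda>v. - b * d y2 v, \<lambda>v. h r * d (dd Z F) v, \<lambda>v. - h r * d (dd Z G) v]"
  have four: "{..<4::nat} = {0, 1, 2, 3}" by auto
  have \<sigma>f: "\<sigma>1 r \<in> f r" "\<sigma>2 r \<in> f r" using \<sigma> unfolding local_section_def by blast+
  have P: "dd Z F \<in> perp (f r)" "dd Z G \<in> perp (f r)" using dFG_perp[OF _ Z(1)] by simp_all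
  have "gauge_q A f \<eta> r Z W = trace_on (f r) (\<lambda>v. blinfun_apply (\<eta> r Z) (dd W (\<sigma> v)))"
    unfolding gauge_q_def \<sigma>_def ..
  also have "\<dots> = (\<Sum>i\<in>{..<4::nat}. l i (u i))"
  proof (rule trace_on_rank_one_sum)
    show "u i \<in> f r" if "i \<in> {..<4}" for i
      using that \<sigma>f FG_mem unfolding four by (auto simp: u_def)
    show "blinfun_apply (\<eta> r Z) (dd W (\<sigma> v)) = (\<Sum>i\<in>{..<4}. l i v *\<^sub>R u i)" if v: "v \<in> f r" for v
    proof -
      let ?c = "dd W (\<sigma> v)"
      have cp: "?c \<in> perp (f r)" using dd_perp[OF _ Z(2) \<sigma>v(1)[OF v]] by simp
      have "lform (\<sigma>1 r) ?c = 0" "lform (\<sigma>2 r) ?c = 0" using perp_fD(2)[OF cp] \<sigma>f by simp_all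
      then have m: "blinfun_apply (mid r Z) ?c = - (a * d y1 v) *\<^sub>R \<sigma>1 r - (b * d y2 v) *\<^sub>R \<sigma>2 r"
        unfolding mid by (simp add: blinfun.bilinear_simps wedge_apply d_def)
      have "blinfun_apply (\<eta> r Z) ?c = blinfun_apply (mid r Z) ?c
          + h r *\<^sub>R (d (dd Z F) v *\<^sub>R G r - d (dd Z G) v *\<^sub>R F r)"
        using h[OF Z(1) cp] by (simp add: d_def)
      then show ?thesis unfolding m four by (simp add: l_def u_def algebra_simps numeral_2_eq_2 numeral_3_eq_3)
    qed
    show "l i (v + w) = l i v + l i w" if "i \<in> {..<4}" "v \<in> f r" "w \<in> f r" for i v w
      using that subspace_add[OF f_subspace that(2,3)] unfolding four
      by (auto simp: l_def d y P algebra_simps numeral_2_eq_2 numeral_3_eq_3)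
    show "l i (s *\<^sub>R v) = s * l i v" if "i \<in> {..<4}" "v \<in> f r" for i s v
      using that subspace_scale[OF f_subspace that(2)] unfolding four
      by (auto simp: l_def d y P algebra_simps numeral_2_eq_2 numeral_3_eq_3)
  qed (simp_all add: f_subspace)
  also have "\<dots> = - a * d y1 (\<sigma>1 r) - b * d y2 (\<sigma>2 r) + h r * (d (dd Z F) (G r) - d (dd Z G) (F r))"
    unfolding four by (simp add: l_def u_def algebra_simps numeral_2_eq_2 numeral_3_eq_3)
  also have "d (dd Z F) (G r) = d (dd Z G) (F r)"
    using d\<sigma>[OF P(1) section_FG(2)] d\<sigma>[OF P(2) section_FG(1)]
      section_contact_symmetric[OF _ section_FG(1,2) Z] lform_sym by simp
  finally show ?thesis using d\<sigma>[OF y(1) \<sigma>(1)] d\<sigma>[OF y(2) \<sigma>(2)] by simp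
qed

end

section \<open>Curvature spheres and the shape of the middle potential\<close>

text \<open>Sections \<open>\<sigma>1\<close>, \<open>\<sigma>2\<close> of the curvature spheres and fields \<open>X\<close>, \<open>Y\<close> along the curvature
  directions near a point \<open>r\<close>.\<close>

locale curvature_frame = omega_lift +
  fixes r :: 'a and N :: "'a set" and \<sigma>1 \<sigma>2 :: "'a \<Rightarrow> R42" and X Y :: "'a \<Rightarrow> 'a tangent"
  assumes N: "open N" "r \<in> N"
    and sm1: "smooth_map A N \<sigma>1" and sm2: "smooth_map A N \<sigma>2"
    and XY: "vector_field A N X" "vector_field A N Y"
    and s1: "\<And>q. q \<in> N \<Longrightarrow> s1 q = span {\<sigma>1 q}" "\<And>q. q \<in> N \<Longrightarrow> \<sigma>1 q \<noteq> 0"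
    and s2: "\<And>q. q \<in> N \<Longrightarrow> s2 q = span {\<sigma>2 q}" "\<And>q. q \<in> N \<Longrightarrow> \<sigma>2 q \<noteq> 0"
    and T1: "\<And>q. q \<in> N \<Longrightarrow> T1 q = {lin_comb a (X q) 0 (X q) | a. True}" "\<And>q. q \<in> N \<Longrightarrow> X q \<noteq> zero_vec"
    and T2: "\<And>q. q \<in> N \<Longrightarrow> T2 q = {lin_comb a (Y q) 0 (Y q) | a. True}" "\<And>q. q \<in> N \<Longrightarrow> Y q \<noteq> zero_vec"
begin

abbreviation "u1 \<equiv> \<sigma>1 r"
abbreviation "u2 \<equiv> \<sigma>2 r"
abbreviation "y1 \<equiv> dd (Y r) \<sigma>1"
abbreviation "y2 \<equiv> dd (X r) \<sigma>2"
abbreviation "z1 \<equiv> dd (Y r) (\<lambda>q. dd (Y q) \<sigma>1)"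
abbreviation "z2 \<equiv> dd (X r) (\<lambda>q. dd (X q) \<sigma>2)"

lemma tanXY: "q \<in> N \<Longrightarrow> X q \<in> tangent_space A q" "q \<in> N \<Longrightarrow> Y q \<in> tangent_space A q"
  using vector_field_tangent XY by blast+

lemma sub_f: "s1 q \<subseteq> f q" "s2 q \<subseteq> f q"
proof -
  have "{l. curvature_sphere A f q l} = {s1 q, s2 q}" using umbilic unfolding umbilic_free_def by blast
  then have "curvature_sphere A f q (s1 q)" "curvature_sphere A f q (s2 q)" by blast+
  then show "s1 q \<subseteq> f q" "s2 q \<subseteq> f q" unfolding curvature_sphere_def by blast+
qed

lemma \<sigma>_mem: "q \<in> N \<Longrightarrow> \<sigma>1 q \<in> f q" "q \<in> N \<Longrightarrow> \<sigma>2 q \<in> f q"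
  using sub_f[of q] s1[of q] s2[of q] span_base by blast+

lemma \<sigma>_section: "q \<in> N \<Longrightarrow> local_section A f q \<sigma>1" "q \<in> N \<Longrightarrow> local_section A f q \<sigma>2"
  unfolding local_section_def using N sm1 sm2 \<sigma>_mem by blast+

lemma curvature_directions: "q \<in> N \<Longrightarrow> dd (X q) \<sigma>1 \<in> f q" "q \<in> N \<Longrightarrow> dd (Y q) \<sigma>2 \<in> f q"
proof -
  assume q: "q \<in> N"
  have "X q = lin_comb 1 (X q) 0 (X q)" "Y q = lin_comb 1 (Y q) 0 (Y q)" by (simp_all add: lin_comb_def)
  then have "X q \<in> T1 q" "Y q \<in> T2 q" using T1(1)[OF q] T2(1)[OF q] by blast+
  then have "X q \<in> curvature_space A f q (s1 q)" "Y q \<in> curvature_space A f q (s2 q)"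
    using umbilic unfolding umbilic_free_def by blast+
  moreover have "\<sigma>1 q \<in> s1 q" "\<sigma>2 q \<in> s2 q" using s1(1)[OF q] s2(1)[OF q] by (simp_all add: span_base)
  ultimately show "dd (X q) \<sigma>1 \<in> f q" "dd (Y q) \<sigma>2 \<in> f q"
    using \<sigma>_section[OF q] unfolding curvature_space_def by blast+
qed

lemma u_ne: "u1 \<noteq> 0" "u2 \<noteq> 0" using s1(2) s2(2) N by blast+

lemma u_mem: "u1 \<in> f r" "u2 \<in> f r" using \<sigma>_mem N by blast+

lemma u_indep: "u1 \<notin> span {u2}" "u1 \<noteq> u2"
proof -
  show "u1 \<notin> span {u2}"
  proof
    assume "u1 \<in> span {u2}"
    then obtain c where c: "u1 = c *\<^sub>R u2" by (auto simp: span_singleton)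
    then have "c \<noteq> 0" using u_ne by auto
    then have "u2 = (1 / c) *\<^sub>R u1" using c by simp
    then have "u2 \<in> span {u1}" by (metis span_base span_scale singletonI)
    then have "span {u2} \<subseteq> span {u1}" "span {u1} \<subseteq> span {u2}"
      using \<open>u1 \<in> span {u2}\<close> span_minimal[of "{u2}" "span {u1}"] span_minimal[of "{u1}" "span {u2}"] by simp_all
    then have "s1 r = s2 r" using s1(1) s2(1) N by auto
    then show False using umbilic unfolding umbilic_free_def by blast
  qed
  then show "u1 \<noteq> u2" using span_base by blast
qed

lemma f_span_u: "f r \<subseteq> span {u1, u2}"
proof -
  have "dim (f r) = 2" using legendre unfolding legendre_map_def subbundle_def by blast
  moreover have "independent {u1, u2}" using u_indep u_ne by (simp add: independent_insert)
  moreover have "card {u1, u2} = 2" using u_indep by simp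
  ultimately show ?thesis using card_ge_dim_independent[of "{u1, u2}" "f r"] u_mem by auto
qed

lemma section_dd_comb:
  assumes "Z \<in> tangent_space A r" "local_section A f r \<sigma>"
  obtains a b w where "w \<in> f r" "dd Z \<sigma> = a *\<^sub>R dd Z \<sigma>1 + b *\<^sub>R dd Z \<sigma>2 + w" "\<sigma> r = a *\<^sub>R u1 + b *\<^sub>R u2"
proof -
  have "\<sigma> r \<in> f r" using assms(2) unfolding local_section_def by blast
  then obtain a b where ab: "\<sigma> r = a *\<^sub>R u1 + b *\<^sub>R u2" using f_span_u unfolding span2 by blast
  define e where "e v = - lform v qinf *\<^sub>R dd Z F - lform v \<pp> *\<^sub>R dd Z G" for v
  have e: "e (\<sigma> r) = a *\<^sub>R e u1 + b *\<^sub>R e u2" unfolding e_def ab by (simp add: algebra_simps)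
  have d: "dd Z \<rho> - e (\<rho> r) \<in> f r" if "local_section A f r \<rho>" for \<rho>
    using section_dd[OF _ assms(1) that] by (simp add: e_def)
  let ?w = "(dd Z \<sigma> - e (\<sigma> r)) - (a *\<^sub>R (dd Z \<sigma>1 - e u1) + b *\<^sub>R (dd Z \<sigma>2 - e u2))"
  have f: "subspace (f r)" by (simp add: f_subspace)
  have "?w \<in> f r"
    by (rule subspace_diff[OF f d[OF assms(2)] subspace_add[OF f subspace_scale[OF f d] subspace_scale[OF f d]]])
      (intro \<sigma>_section N)+
  moreover have "dd Z \<sigma> = a *\<^sub>R dd Z \<sigma>1 + b *\<^sub>R dd Z \<sigma>2 + ?w" using e by (simp add: algebra_simps)
  ultimately show ?thesis using that ab by blast
qed

text \<open>If a curvature sphere did not move to first order along the curvature direction of the other one, all sections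
  of \<open>f\<close> would be stationary in that direction, against the immersion condition.\<close>

lemma y_notin: "y1 \<notin> f r" "y2 \<notin> f r"
proof -
  have sub: "a *\<^sub>R v + b *\<^sub>R v' + w \<in> f r" if "v \<in> f r" "v' \<in> f r" "w \<in> f r" for a b v v' w
    using that f_subspace[of r] by (intro subspace_add subspace_scale) auto
  have imm: "Z = zero_vec" if "Z \<in> tangent_space A r" "dd Z \<sigma>1 \<in> f r" "dd Z \<sigma>2 \<in> f r" for Z
  proof -
    have "dd Z \<sigma> \<in> f r" if \<sigma>: "local_section A f r \<sigma>" for \<sigma>
      using sub[OF \<open>dd Z \<sigma>1 \<in> f r\<close> \<open>dd Z \<sigma>2 \<in> f r\<close>]
      by (rule_tac section_dd_comb[OF \<open>Z \<in> tangent_space A r\<close> \<sigma>]) simp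
    then show ?thesis using legendre that(1) unfolding legendre_map_def by blast
  qed
  show "y1 \<notin> f r" using imm[OF tanXY(2)[OF N(2)]] curvature_directions(2)[OF N(2)] T2(2)[OF N(2)] by blast
  show "y2 \<notin> f r" using imm[OF tanXY(1)[OF N(2)]] curvature_directions(1)[OF N(2)] T1(2)[OF N(2)] by blast
qed

lemma y_perp: "y1 \<in> perp (f r)" "y2 \<in> perp (f r)"
  using dd_perp tanXY \<sigma>_section N by blast+

lemma y_norm: "lform y1 y1 \<noteq> 0" "lform y2 y2 \<noteq> 0"
  using perp_null_mem y_perp y_notin by blast+

text \<open>The form \<open>(d\<sigma>1, d\<sigma>2)\<close> is symmetric, and each curvature sphere is stationary modulo \<open>f\<close> along its own
  curvature direction.\<close>

lemma y_orth: "lform y1 y2 = 0" "lform y2 y1 = 0"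
proof -
  have "lform y1 y2 = lform (dd (X r) \<sigma>1) (dd (Y r) \<sigma>2)"
    using section_contact_symmetric[OF _ \<sigma>_section tanXY(2,1)] N by simp
  also have "\<dots> = 0"
    using perp_fD(1)[OF f_sub_perp curvature_directions(2)] curvature_directions(1) N by simp
  finally show "lform y1 y2 = 0" "lform y2 y1 = 0" by (simp_all add: lform_sym[of y2])
qed

lemma u_forms: "lform u1 u1 = 0" "lform u1 u2 = 0" "lform u2 u2 = 0"
    "lform y1 u1 = 0" "lform y1 u2 = 0" "lform y2 u1 = 0" "lform y2 u2 = 0"
  using perp_fD(1)[OF f_sub_perp] perp_fD(1)[OF y_perp(1)] perp_fD(1)[OF y_perp(2)] u_mem by simp_all

text \<open>Moving a derivative to the other factor reduces all four products to those of first derivatives.\<close>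

lemma z_forms: "lform z1 u1 \<noteq> 0" "lform z1 u2 = 0" "lform z2 u1 = 0" "lform z2 u2 \<noteq> 0"
proof -
  have perp: "lform (dd Z \<rho>) v = 0" if "Z \<in> tangent_space A q" "local_section A f q \<rho>" "v \<in> f q" for Z q \<rho> v
    using perp_fD(1)[OF dd_perp[OF _ that(1,2)] that(3)] by simp
  note smY = smooth_map_dd[OF XY(2) N(1) subset_refl sm1] and smX = smooth_map_dd[OF XY(1) N(1) subset_refl sm2]
  have "lform z1 u1 = - lform y1 y1"
    by (rule dd_lform_zero[where c = 0, OF tanXY(2)[OF N(2)] N smY sm1]) (rule perp[OF tanXY(2) \<sigma>_section(1) \<sigma>_mem(1)])
  then show "lform z1 u1 \<noteq> 0" using y_norm by simp
  have "lform z2 u2 = - lform y2 y2"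
    by (rule dd_lform_zero[where c = 0, OF tanXY(1)[OF N(2)] N smX sm2]) (rule perp[OF tanXY(1) \<sigma>_section(2) \<sigma>_mem(2)])
  then show "lform z2 u2 \<noteq> 0" using y_norm by simp
  have "lform z1 u2 = - lform y1 (dd (Y r) \<sigma>2)"
    by (rule dd_lform_zero[where c = 0, OF tanXY(2)[OF N(2)] N smY sm2]) (rule perp[OF tanXY(2) \<sigma>_section(1) \<sigma>_mem(2)])
  then show "lform z1 u2 = 0" using perp_fD(1)[OF y_perp(1) curvature_directions(2)[OF N(2)]] by simp
  have "lform z2 u1 = - lform y2 (dd (X r) \<sigma>1)"
    by (rule dd_lform_zero[where c = 0, OF tanXY(1)[OF N(2)] N smX sm1]) (rule perp[OF tanXY(1) \<sigma>_section(2) \<sigma>_mem(1)])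
  then show "lform z2 u1 = 0" using perp_fD(1)[OF y_perp(2) curvature_directions(1)[OF N(2)]] by simp
qed

text \<open>On \<open>f\<close> the potential vanishes, and so does its component in \<open>\<Lambda>\<^sup>2f\<close>. The remaining component
  lies in \<open>\<Lambda>\<^sup>2S\<^sub>1 \<oplus> \<Lambda>\<^sup>2S\<^sub>2\<close> and annihilates both curvature spheres, which leaves only two terms.\<close>

lemma mid_form:
  assumes "Z \<in> tangent_space A r"
  obtains a b c where "mid r Z = a *\<^sub>R wedge u1 y1 + b *\<^sub>R wedge u2 y2 + c *\<^sub>R wedge u1 u2"
proof -
  let ?S1 = "cyclide_bundle A s1 T2 r" and ?S2 = "cyclide_bundle A s2 T1 r"
  obtain \<alpha> \<beta> where \<alpha>: "\<alpha> \<in> span (wedge_space ?S1 ?S1 \<union> wedge_space ?S2 ?S2)"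
    and \<beta>: "\<beta> \<in> wedge_space (f r) (f r)" and mid: "mid r Z = \<alpha> + \<beta>"
    using middle assms unfolding middle_potential_def Let_def by metis
  obtain c where c: "\<beta> = c *\<^sub>R wedge u1 u2" by (rule wedge_span2[OF \<beta> f_span_u])
  have "\<alpha> = mid r Z - c *\<^sub>R wedge u1 u2" using mid c by simp
  then have kill: "blinfun_apply \<alpha> u1 = 0" "blinfun_apply \<alpha> u2 = 0"
    using mid_kills[OF assms] u_mem u_forms lform_sym[of u2 u1]
    by (simp_all add: blinfun.bilinear_simps wedge_apply)
  have ind: "y1 \<notin> span {u1}" "y2 \<notin> span {u2}"
    using y_notin span_minimal[of "{u1}" "f r"] span_minimal[of "{u2}" "f r"] u_mem f_subspace by auto
  obtain a b where "\<alpha> = a *\<^sub>R wedge u1 y1 + b *\<^sub>R wedge u2 y2"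
    using bivector_killing_null_pair[OF \<alpha> cyclide_bundle_span[OF N sm1 XY(2) s1 T2(1) T2(2)[OF N(2)]]
        cyclide_bundle_span[OF N sm2 XY(1) s2 T1(1) T1(2)[OF N(2)]] kill
        u_forms(1,4) z_forms(1) u_forms(3,7) z_forms(4) u_forms(2,5) z_forms(2) u_forms(6) z_forms(3)
        u_ne(1) ind(1) u_ne(2) ind(2)] .
  then show ?thesis using that mid c by simp
qed

text \<open>If the component of the middle potential in one of the two directions vanished, its quadratic form
  would have rank at most one. Pairing \<open>\<eta>(Z)v = 0\<close> with \<open>y1\<close> and \<open>y2\<close> then isolates the products of \<open>v\<close>
  with the two curvature spheres.\<close>

lemma annihilated_perp:
  assumes basis: "e1 \<in> tangent_space A r" "e2 \<in> tangent_space A r"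
    and q: "gauge_q A f \<eta> r e1 e2 = 0" "gauge_q A f \<eta> r e1 e1 \<noteq> 0" "gauge_q A f \<eta> r e2 e2 \<noteq> 0"
    and v: "\<And>Z. Z \<in> tangent_space A r \<Longrightarrow> blinfun_apply (mid r Z) v = 0"
  shows "lform u1 v = 0" "lform u2 v = 0"
proof -
  obtain a1 b1 c1 where m1: "mid r e1 = a1 *\<^sub>R wedge u1 y1 + b1 *\<^sub>R wedge u2 y2 + c1 *\<^sub>R wedge u1 u2"
    by (rule mid_form[OF basis(1)])
  obtain a2 b2 c2 where m2: "mid r e2 = a2 *\<^sub>R wedge u1 y1 + b2 *\<^sub>R wedge u2 y2 + c2 *\<^sub>R wedge u1 u2"
    by (rule mid_form[OF basis(2)])
  note qf = gauge_q_mid[OF _ _ \<sigma>_section[OF N(2)] y_perp]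
  note q1 = qf[OF basis(1) _ m1] and q2 = qf[OF basis(2) _ m2]
  have a: "a1 \<noteq> 0 \<or> a2 \<noteq> 0"
  proof (rule ccontr)
    assume "\<not> ?thesis"
    then have "b1 * lform y2 (dd e2 \<sigma>2) = 0" "b1 * lform y2 (dd e1 \<sigma>2) \<noteq> 0" "b2 * lform y2 (dd e2 \<sigma>2) \<noteq> 0"
      using q q1[OF basis(1)] q1[OF basis(2)] q2[OF basis(2)] by auto
    then show False by auto
  qed
  have b: "b1 \<noteq> 0 \<or> b2 \<noteq> 0"
  proof (rule ccontr)
    assume "\<not> ?thesis"
    then have "a1 * lform y1 (dd e2 \<sigma>1) = 0" "a1 * lform y1 (dd e1 \<sigma>1) \<noteq> 0" "a2 * lform y1 (dd e2 \<sigma>1) \<noteq> 0"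
      using q q1[OF basis(1)] q1[OF basis(2)] q2[OF basis(2)] by auto
    then show False by auto
  qed
  have zero: "a * lform u1 v = 0 \<and> b * lform u2 v = 0"
    if m: "mid r Z = a *\<^sub>R wedge u1 y1 + b *\<^sub>R wedge u2 y2 + c *\<^sub>R wedge u1 u2" and Z: "Z \<in> tangent_space A r" for Z a b c
  proof -
    have f0: "lform (blinfun_apply (mid r Z) v) y1 = a * lform u1 v * lform y1 y1"
      "lform (blinfun_apply (mid r Z) v) y2 = b * lform u2 v * lform y2 y2"
      unfolding m using y_orth u_forms lform_sym[of u1 y1] lform_sym[of u2 y1] lform_sym[of u1 y2] lform_sym[of u2 y2]
      by (simp_all add: blinfun.bilinear_simps wedge_apply)
    then show ?thesis using v[OF Z] y_norm by simp
  qed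
  show "lform u1 v = 0" "lform u2 v = 0" using zero[OF m1 basis(1)] zero[OF m2 basis(2)] a b by auto
qed

end

context omega_lift
begin

lemma curvature_frame_exists:
  obtains N \<sigma>1 \<sigma>2 X Y where "curvature_frame A qinf q0 \<pp> f x n s1 s2 T1 T2 \<eta> mid r N \<sigma>1 \<sigma>2 X Y"
proof -
  have line: "\<exists>N \<sigma>. open N \<and> r \<in> N \<and> smooth_map A N \<sigma> \<and> (\<forall>q\<in>N. s q = span {\<sigma> q} \<and> \<sigma> q \<noteq> 0)"
    if sb: "subbundle A UNIV 1 s" for s
  proof -
    obtain N \<sigma> where N: "open N" "r \<in> N" "smooth_map A N (\<sigma> (0::nat))"
      "\<forall>q\<in>N. s q = span ((\<lambda>i. \<sigma> i q) ` {..<1::nat}) \<and> dim (s q) = 1"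
      using sb unfolding subbundle_def by (metis UNIV_I zero_less_one)
    have "s q = span {\<sigma> 0 q} \<and> \<sigma> 0 q \<noteq> 0" if "q \<in> N" for q
    proof -
      have "s q = span {\<sigma> 0 q}" "dim (s q) = 1" using N(4) that by (auto simp: lessThan_Suc)
      then show ?thesis by (simp split: if_splits)
    qed
    then have "\<forall>q\<in>N. s q = span {\<sigma> 0 q} \<and> \<sigma> 0 q \<noteq> 0" by blast
    then show ?thesis using N by blast
  qed
  have field: "\<exists>N X. open N \<and> r \<in> N \<and> vector_field A N X \<and>
        (\<forall>q\<in>N. X q \<noteq> zero_vec \<and> T q = {lin_comb a (X q) 0 (X q) | a. True})"
    if "tangent_line_subbundle A T" for T using that unfolding tangent_line_subbundle_def by blast
  have ub: "subbundle A UNIV 1 s1" "subbundle A UNIV 1 s2" "tangent_line_subbundle A T1" "tangent_line_subbundle A T2"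
    using umbilic unfolding umbilic_free_def by blast+
  obtain N1 \<sigma>1 where 1: "open N1" "r \<in> N1" "smooth_map A N1 \<sigma>1" "\<forall>q\<in>N1. s1 q = span {\<sigma>1 q} \<and> \<sigma>1 q \<noteq> 0"
    using line[OF ub(1)] by blast
  obtain N2 \<sigma>2 where 2: "open N2" "r \<in> N2" "smooth_map A N2 \<sigma>2" "\<forall>q\<in>N2. s2 q = span {\<sigma>2 q} \<and> \<sigma>2 q \<noteq> 0"
    using line[OF ub(2)] by blast
  obtain N3 X where 3: "open N3" "r \<in> N3" "vector_field A N3 X"
    "\<forall>q\<in>N3. X q \<noteq> zero_vec \<and> T1 q = {lin_comb a (X q) 0 (X q) | a. True}"
    using field[OF ub(3)] by blast
  obtain N4 Y where 4: "open N4" "r \<in> N4" "vector_field A N4 Y"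
    "\<forall>q\<in>N4. Y q \<noteq> zero_vec \<and> T2 q = {lin_comb a (Y q) 0 (Y q) | a. True}"
    using field[OF ub(4)] by blast
  let ?N = "N1 \<inter> N2 \<inter> N3 \<inter> N4"
  have "smooth_map A ?N \<sigma>1" "smooth_map A ?N \<sigma>2" "vector_field A ?N X" "vector_field A ?N Y"
    by (rule smooth_map_subset[OF 1(3)], blast) (rule smooth_map_subset[OF 2(3)], blast,
      rule vector_field_subset[OF 3(3)], blast, rule vector_field_subset[OF 4(3)], blast)
  moreover have "open ?N" "r \<in> ?N" using 1 2 3 4 by auto
  ultimately have "curvature_frame A qinf q0 \<pp> f x n s1 s2 T1 T2 \<eta> mid r ?N \<sigma>1 \<sigma>2 X Y"
    using 1(4) 2(4) 3(4) 4(4) by unfold_locales simp_all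
  then show ?thesis using that by blast
qed

end

context curvature_frame
begin

lemma gauge_q_lin:
  assumes "Z \<in> tangent_space A r" "W \<in> tangent_space A r" "W' \<in> tangent_space A r"
    and "lin_comb a W b W' \<in> tangent_space A r"
  shows "gauge_q A f \<eta> r Z (lin_comb a W b W') = a * gauge_q A f \<eta> r Z W + b * gauge_q A f \<eta> r Z W'"
proof -
  obtain a' b' c' where m: "mid r Z = a' *\<^sub>R wedge u1 y1 + b' *\<^sub>R wedge u2 y2 + c' *\<^sub>R wedge u1 u2"
    by (rule mid_form[OF assms(1)])
  note q = gauge_q_mid[OF assms(1) _ \<sigma>_section[OF N(2)] y_perp m]
  show ?thesis unfolding q[OF assms(2)] q[OF assms(3)] q[OF assms(4)]
    by (simp add: dd_lin_comb algebra_simps)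
qed

text \<open>The two curvature directions are independent, since \<open>\<sigma>1\<close> is stationary modulo \<open>f\<close> along the first and not
  along the second. So the tangent space is not a line.\<close>

lemma basis_nonzero:
  assumes "tangent_space A r = {lin_comb a e1 b e2 | a b. True}"
  shows "e1 \<noteq> zero_vec" "e2 \<noteq> zero_vec"
proof -
  have *: False if line: "\<And>Z. Z \<in> tangent_space A r \<Longrightarrow> \<exists>c. Z = lin_comb c e 0 e" for e
  proof -
    obtain a b where ab: "X r = lin_comb a e 0 e" "Y r = lin_comb b e 0 e" using line[OF tanXY(1)[OF N(2)]] line[OF tanXY(2)[OF N(2)]] by blast
    have "a \<noteq> 0" using T1(2)[OF N(2)] ab(1) by (auto simp: lin_comb_def zero_vec_def)
    then have "y1 = (b / a) *\<^sub>R dd (X r) \<sigma>1" unfolding ab by (simp add: dd_lin_comb)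
    then have "y1 \<in> f r" using subspace_scale[OF f_subspace curvature_directions(1)] N by simp
    then show False using y_notin by blast
  qed
  have "lin_comb a zero_vec b e2 = lin_comb b e2 0 e2" "lin_comb a e1 b zero_vec = lin_comb a e1 0 e1" for a b
    by (auto simp: lin_comb_def zero_vec_def)
  then show "e1 \<noteq> zero_vec" "e2 \<noteq> zero_vec" using *[of e1] *[of e2] assms by auto
qed

text \<open>If \<open>II = c III\<close>, then a section of \<open>f\<close> can only be stationary modulo \<open>f\<close> in some direction if it is a
  multiple of \<open>F + cG\<close> at the point, and the two curvature spheres would coincide.\<close>

lemma not_umbilic:
  assumes nd: "nondegenerate_at A r (third_form n)"
  shows "\<not> (\<exists>c. \<forall>Z\<in>tangent_space A r. \<forall>W\<in>tangent_space A r. second_form x n Z W = c * third_form n Z W)"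
proof
  assume "\<exists>c. \<forall>Z\<in>tangent_space A r. \<forall>W\<in>tangent_space A r. second_form x n Z W = c * third_form n Z W"
  then obtain c where c: "\<And>Z W. Z \<in> tangent_space A r \<Longrightarrow> W \<in> tangent_space A r \<Longrightarrow>
      second_form x n Z W = c * third_form n Z W" by blast
  have coeff: "lform (\<sigma> r) \<pp> = c * lform (\<sigma> r) qinf"
    if \<sigma>: "local_section A f r \<sigma>" and Z: "Z \<in> tangent_space A r" "Z \<noteq> zero_vec" "dd Z \<sigma> \<in> f r" for \<sigma> Z
  proof -
    obtain W where W: "W \<in> tangent_space A r" "third_form n Z W \<noteq> 0" using nd Z unfolding nondegenerate_at_def by blast
    have "lform (dd W G) (dd Z \<sigma>) = 0" using perp_fD(1)[OF dFG_perp(2) Z(3)] W by simp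
    then have "lform (\<sigma> r) qinf * lform (dd Z F) (dd W G) + lform (\<sigma> r) \<pp> * lform (dd Z G) (dd W G) = 0"
      using lform_section_dd[OF _ Z(1) \<sigma> dFG_perp(2)[OF _ W(1)]] lform_sym[of "dd W G" "dd Z F"] lform_sym[of "dd W G" "dd Z G"] by simp
    moreover have "lform (dd Z F) (dd W G) = - c * third_form n Z W" "lform (dd Z G) (dd W G) = third_form n Z W"
      using forms_FG[OF _ Z(1) W(1)] c[OF Z(1) W(1)] by simp_all
    ultimately have "(lform (\<sigma> r) \<pp> - c * lform (\<sigma> r) qinf) * third_form n Z W = 0" by (simp add: algebra_simps)
    then show ?thesis using W by simp
  qed
  have u: "u = - lform u qinf *\<^sub>R (F r + c *\<^sub>R G r)" if "u \<in> f r" "lform u \<pp> = c * lform u qinf" for u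
    using f_coeffs[OF _ that(1)] that(2) by (simp add: algebra_simps)
  have 1: "u1 = - lform u1 qinf *\<^sub>R (F r + c *\<^sub>R G r)"
    by (intro u u_mem coeff[OF \<sigma>_section(1)[OF N(2)] tanXY(1)[OF N(2)] T1(2)[OF N(2)] curvature_directions(1)[OF N(2)]])
  have 2: "u2 = - lform u2 qinf *\<^sub>R (F r + c *\<^sub>R G r)"
    by (intro u u_mem coeff[OF \<sigma>_section(2)[OF N(2)] tanXY(2)[OF N(2)] T2(2)[OF N(2)] curvature_directions(2)[OF N(2)]])
  then have "lform u2 qinf \<noteq> 0" using u_ne(2) by (metis neg_equal_0_iff_equal scaleR_zero_left)
  then have "(lform u1 qinf / lform u2 qinf) *\<^sub>R (- lform u2 qinf *\<^sub>R (F r + c *\<^sub>R G r)) = - lform u1 qinf *\<^sub>R (F r + c *\<^sub>R G r)"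
    by (simp only: scaleR_scaleR) simp
  then have "u1 = (lform u1 qinf / lform u2 qinf) *\<^sub>R u2" using 1 2 by metis
  then have "u1 \<in> span {u2}" by (metis span_base span_scale singletonI)
  then show False using u_indep by blast
qed

end

section \<open>The conserved quantity\<close>

context omega_lift
begin

text \<open>Nondegeneracy holds at some point, hence, by constancy of the signature, at all points.\<close>

lemma gauge_q_diagonal:
  obtains e1 e2 where "e1 \<in> tangent_space A r" "e2 \<in> tangent_space A r"
    "gauge_q A f \<eta> r e1 e2 = 0" "gauge_q A f \<eta> r e1 e1 \<noteq> 0" "gauge_q A f \<eta> r e2 e2 \<noteq> 0"
proof -
  let ?q = "gauge_q A f \<eta>"
  have "constant_signature A ?q" using gauge unfolding gauge_potential_def by blast
  then obtain c1 c2 where c: "\<And>p. \<exists>e1 e2. tangent_space A p = {lin_comb a e1 b e2 | a b. True} \<and>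
        ?q p e1 e2 = 0 \<and> ?q p e2 e1 = 0 \<and> sgn (?q p e1 e1) = c1 \<and> sgn (?q p e2 e2) = c2"
    unfolding constant_signature_def by blast
  obtain D where "closure D = (UNIV :: 'm set)" and D: "\<And>p. p \<in> D \<Longrightarrow> nondegenerate_at A p (?q p)"
    using Omega unfolding Omega_surface_def by blast
  then obtain p where p: "p \<in> D" by fastforce
  obtain N \<sigma>1 \<sigma>2 X Y where "curvature_frame A qinf q0 \<pp> f x n s1 s2 T1 T2 \<eta> mid p N \<sigma>1 \<sigma>2 X Y"
    by (rule curvature_frame_exists)
  then interpret C: curvature_frame A qinf q0 \<pp> f x n s1 s2 T1 T2 \<eta> mid p N \<sigma>1 \<sigma>2 X Y .
  obtain e1 e2 where e: "tangent_space A p = {lin_comb a e1 b e2 | a b. True}"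
        "?q p e1 e2 = 0" "?q p e2 e1 = 0" "sgn (?q p e1 e1) = c1" "sgn (?q p e2 e2) = c2"
    using c by blast
  have "lin_comb 1 e1 0 e2 \<in> tangent_space A p" "lin_comb 0 e1 1 e2 \<in> tangent_space A p" unfolding e(1) by blast+
  then have te: "e1 \<in> tangent_space A p" "e2 \<in> tangent_space A p" by (simp_all add: lin_comb_def)
  have nz: "?q p e e \<noteq> 0" if "e = e1 \<and> e' = e2 \<or> e = e2 \<and> e' = e1" for e e'
  proof -
    have "e \<noteq> zero_vec" "e \<in> tangent_space A p" "?q p e e' = 0"
      using C.basis_nonzero[OF e(1)] te e(2,3) that by auto
    then obtain W where W: "W \<in> tangent_space A p" "?q p e W \<noteq> 0"
      using D[OF p] unfolding nondegenerate_at_def by blast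
    obtain a b where "W = lin_comb a e1 b e2" using W(1) e(1) by blast
    then have "?q p e W = a * ?q p e e1 + b * ?q p e e2"
      using C.gauge_q_lin[OF \<open>e \<in> _\<close> te] W(1) by blast
    then show ?thesis using W(2) \<open>?q p e e' = 0\<close> that by auto
  qed
  have "c1 \<noteq> 0" "c2 \<noteq> 0" using nz[of e1 e2] nz[of e2 e1] e(4,5) by (auto simp: sgn_zero_iff)
  obtain e1 e2 where r: "tangent_space A r = {lin_comb a e1 b e2 | a b. True}"
        "?q r e1 e2 = 0" "sgn (?q r e1 e1) = c1" "sgn (?q r e2 e2) = c2"
    using c by blast
  have "lin_comb 1 e1 0 e2 \<in> tangent_space A r" "lin_comb 0 e1 1 e2 \<in> tangent_space A r" unfolding r(1) by blast+
  then show ?thesis using that[of e1 e2] r(2-4) \<open>c1 \<noteq> 0\<close> \<open>c2 \<noteq> 0\<close> by (auto simp: lin_comb_def sgn_zero_iff)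
qed

text \<open>Comparing the conditions at \<open>t = 1\<close> and \<open>t = -1\<close> shows that \<open>p\<^sub>1\<close> is annihilated by the potential, null and
  orthogonal to \<open>qinf\<close>. So it is orthogonal to both curvature spheres, that is, a null section of \<open>f\<^sup>\<bottom>\<close>,
  hence of \<open>f\<close>, and there the vectors orthogonal to \<open>qinf\<close> are the multiples of \<open>G\<close>.\<close>

lemma conserved_quantity_form:
  assumes cq: "linear_conserved_quantity A mid p" and p0: "\<forall>r. p 0 r = qinf"
    and null: "\<forall>t r. lform (p t r) (p t r) = 0"
  obtains l where "p t r = qinf + l *\<^sub>R G r"
proof -
  obtain p0' p1 where "smooth_map A UNIV p1" "\<And>t r. p t r = p0' r + t *\<^sub>R p1 r"
    and flat: "\<And>t r Z. Z \<in> tangent_space A r \<Longrightarrow> dd Z (p t) + t *\<^sub>R blinfun_apply (mid r Z) (p t r) = 0"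
    using cq unfolding linear_conserved_quantity_def by blast
  then have p: "p t = (\<lambda>r. qinf + t *\<^sub>R p1 r)" for t using p0 by (metis add.right_neutral scaleR_zero_left)
  have at: "smooth_at A r p1" "\<And>t. smooth_at A r (\<lambda>r. t *\<^sub>R p1 r)" "smooth_at A r (\<lambda>r. qinf)"
    using smooth_atI[OF open_UNIV] \<open>smooth_map A UNIV p1\<close>
      smooth_map_linear[OF bounded_linear_scaleR_right open_UNIV \<open>smooth_map A UNIV p1\<close>] smooth_map_const by blast+
  have kills: "blinfun_apply (mid r Z) (p1 r) = 0" if Z: "Z \<in> tangent_space A r" for Z
  proof -
    have "dd Z (p t) = t *\<^sub>R dd Z p1" for t
      unfolding p using dd_add[OF Z at(3) at(2)[of t]] dd_linear[OF Z bounded_linear_scaleR_right at(1), of t] Z by simp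
    then have flat': "t *\<^sub>R dd Z p1 + t *\<^sub>R (blinfun_apply (mid r Z) qinf + t *\<^sub>R blinfun_apply (mid r Z) (p1 r)) = 0" for t
      using flat[OF Z, of t] by (simp add: p blinfun.bilinear_simps)
    have "2 *\<^sub>R blinfun_apply (mid r Z) (p1 r)
       = (1 *\<^sub>R dd Z p1 + 1 *\<^sub>R (blinfun_apply (mid r Z) qinf + 1 *\<^sub>R blinfun_apply (mid r Z) (p1 r)))
       + ((-1) *\<^sub>R dd Z p1 + (-1) *\<^sub>R (blinfun_apply (mid r Z) qinf + (-1) *\<^sub>R blinfun_apply (mid r Z) (p1 r)))"
      by (simp add: scaleR_2)
    also have "\<dots> = 0" unfolding flat' by simp
    finally show ?thesis by simp
  qed
  have "lform (p 1 r) (p 1 r) = 0" "lform (p (-1) r) (p (-1) r) = 0" using null by blast+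
  then have "2 * lform (p1 r) qinf + lform (p1 r) (p1 r) = 0" "- 2 * lform (p1 r) qinf + lform (p1 r) (p1 r) = 0"
    by (simp_all add: p lform_sym[of qinf "p1 r"])
  then have n1: "lform (p1 r) (p1 r) = 0" "lform (p1 r) qinf = 0" by linarith+
  obtain N \<sigma>1 \<sigma>2 X Y where "curvature_frame A qinf q0 \<pp> f x n s1 s2 T1 T2 \<eta> mid r N \<sigma>1 \<sigma>2 X Y"
    by (rule curvature_frame_exists)
  then interpret C: curvature_frame A qinf q0 \<pp> f x n s1 s2 T1 T2 \<eta> mid r N \<sigma>1 \<sigma>2 X Y .
  obtain e1 e2 where e: "e1 \<in> tangent_space A r" "e2 \<in> tangent_space A r"
    "gauge_q A f \<eta> r e1 e2 = 0" "gauge_q A f \<eta> r e1 e1 \<noteq> 0" "gauge_q A f \<eta> r e2 e2 \<noteq> 0" by (rule gauge_q_diagonal)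
  have "lform (\<sigma>1 r) (p1 r) = 0" "lform (\<sigma>2 r) (p1 r) = 0"
    using C.annihilated_perp(1)[OF e kills] C.annihilated_perp(2)[OF e kills] by simp_all
  note u = this
  have "lform v (p1 r) = 0" if "v \<in> f r" for v
  proof -
    have "v \<in> span {\<sigma>1 r, \<sigma>2 r}" using C.f_span_u that by (rule subsetD)
    then show ?thesis unfolding span2 using u by auto
  qed
  then have "lform (p1 r) v = 0" if "v \<in> f r" for v using that lform_sym[of "p1 r" v] by simp
  then have "p1 r \<in> perp (f r)" by (simp add: perp_def)
  then have "p1 r \<in> f r" using perp_null_mem n1 by blast
  then have "p1 r = (- lform (p1 r) \<pp>) *\<^sub>R G r" using f_coeffs[of r "p1 r"] n1(2) by simp
  then have "p t r = qinf + (t * - lform (p1 r) \<pp>) *\<^sub>R G r" unfolding p by (metis scaleR_scaleR)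
  then show ?thesis using that by blast
qed

end

section \<open>Conformal change of the third fundamental form\<close>

context surface
begin

lemma lin_comb_tangent:
  assumes "X \<in> tangent_space A r" "Y \<in> tangent_space A r" shows "lin_comb a X b Y \<in> tangent_space A r"
proof -
  obtain D \<phi> where D: "(D, \<phi>) \<in> A" "r \<in> D" by (rule chart_exists)
  obtain v where v: "X = chart_vec D \<phi> r v" using tangent_in_chart[OF assms(1) D] .
  obtain w where w: "Y = chart_vec D \<phi> r w" using tangent_in_chart[OF assms(2) D] .
  have "lin_comb a X b Y = chart_vec D \<phi> r (a *\<^sub>R v + b *\<^sub>R w)"
  proof
    fix g :: "'m \<Rightarrow> real"
    show "lin_comb a X b Y g = chart_vec D \<phi> r (a *\<^sub>R v + b *\<^sub>R w) g"
      using has_derivative_linear[OF smooth_at_differentiable[OF D, of g]]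
      by (cases "smooth_at A r g") (simp_all add: v w lin_comb_def chart_vec_def comp_def linear_add linear_scale)
  qed
  then show ?thesis using chart_vec_tangent[OF D] by simp
qed

lemma coord_vec:
  assumes "conformal_coordinate A g N z" "r \<in> N"
  shows "coord_vec A z r w \<in> tangent_space A r" "dd (coord_vec A z r w) z = w"
proof -
  have "bij_betw (\<lambda>X. dd X z) (tangent_space A r) UNIV" using assms unfolding conformal_coordinate_def by blast
  then have "w \<in> (\<lambda>X. dd X z) ` tangent_space A r" by (simp add: bij_betw_def)
  then show "coord_vec A z r w \<in> tangent_space A r" "dd (coord_vec A z r w) z = w"
    unfolding coord_vec_def by (rule inv_into_into, rule f_inv_into_f)
qed

lemma conformal_coordinate_rescale:
  assumes z: "conformal_coordinate A g N z" and N: "open N'" "N' \<subseteq> N"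
    and k: "\<And>r. r \<in> N' \<Longrightarrow> \<exists>c>0. \<forall>X\<in>tangent_space A r. \<forall>Y\<in>tangent_space A r. g' r X Y = c * g r X Y"
  shows "conformal_coordinate A g' N' z"
proof -
  have "\<exists>\<rho>>0. \<forall>X\<in>tangent_space A r. \<forall>Y\<in>tangent_space A r. g' r X Y = \<rho> * Re (dd X z * cnj (dd Y z))"
    if r: "r \<in> N'" for r
  proof -
    obtain \<rho> where \<rho>: "\<rho> > 0" "\<forall>X\<in>tangent_space A r. \<forall>Y\<in>tangent_space A r. g r X Y = \<rho> * Re (dd X z * cnj (dd Y z))"
      using z r N unfolding conformal_coordinate_def by blast
    obtain c where c: "c > 0" "\<forall>X\<in>tangent_space A r. \<forall>Y\<in>tangent_space A r. g' r X Y = c * g r X Y" using k[OF r] by blast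
    have "c * \<rho> > 0" using c \<rho> by simp
    then show ?thesis using c(2) \<rho>(2) by (intro exI[of _ "c * \<rho>"]) simp
  qed
  moreover have "smooth_map A N' z" "inj_on z N'" "\<forall>r\<in>N'. bij_betw (\<lambda>X. dd X z) (tangent_space A r) UNIV"
  proof -
    have "smooth_map A N z" "inj_on z N" "\<forall>r\<in>N. bij_betw (\<lambda>X. dd X z) (tangent_space A r) UNIV"
      using z by (simp_all add: conformal_coordinate_def)
    then show "smooth_map A N' z" "inj_on z N'" "\<forall>r\<in>N'. bij_betw (\<lambda>X. dd X z) (tangent_space A r) UNIV"
      by (simp_all only: smooth_map_subset[OF _ N(2)] inj_on_subset[OF _ N(2)]) (use N(2) in auto)
  qed
  ultimately show ?thesis using N(1) unfolding conformal_coordinate_def by blast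
qed

text \<open>The complex structure and the (2,0)-part only see the third form up to scale, and the second
  up to scale and multiples of the third. So the same holomorphic differential serves both surfaces.
  If it vanished at a point, so would \<open>II\<^sup>2\<^sup>,\<^sup>0\<close>, and the point would be umbilic.\<close>

lemma L_isothermic_rescale:
  assumes L: "L_isothermic A UNIV x n" and V: "open V" "V \<noteq> {}"
    and k: "\<And>r. r \<in> V \<Longrightarrow> k r \<noteq> 0"
    and third: "\<And>r X Y. r \<in> V \<Longrightarrow> X \<in> tangent_space A r \<Longrightarrow> Y \<in> tangent_space A r \<Longrightarrow>
       third_form n' X Y = (k r)\<^sup>2 * third_form n X Y"
    and second: "\<And>r X Y. r \<in> V \<Longrightarrow> X \<in> tangent_space A r \<Longrightarrow> Y \<in> tangent_space A r \<Longrightarrow>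
       second_form x' n' X Y = k r * (second_form x n X Y - b r * third_form n X Y)"
    and sym: "\<And>r X Y. X \<in> tangent_space A r \<Longrightarrow> Y \<in> tangent_space A r \<Longrightarrow> second_form x n X Y = second_form x n Y X"
    and umb: "\<And>r. \<not> (\<exists>c. \<forall>X\<in>tangent_space A r. \<forall>Y\<in>tangent_space A r. second_form x n X Y = c * third_form n X Y)"
  shows "L_isothermic A V x' n'"
proof -
  let ?g = "\<lambda>r. third_form n" and ?g' = "\<lambda>r. third_form n'"
  have nd: "nondegenerate_at A r (third_form n)" for r using L by (simp add: L_isothermic_def)
  have "\<exists>q \<mu>. holomorphic_quadratic_differential A UNIV ?g q \<and>
        (\<exists>r\<in>UNIV. \<exists>X\<in>tangent_space A r. \<exists>Y\<in>tangent_space A r. q r X Y \<noteq> 0) \<and>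
        (\<forall>N z. N \<subseteq> UNIV \<and> conformal_coordinate A ?g N z \<longrightarrow>
           (\<forall>r\<in>N. part20 A z r (second_form x n) = complex_of_real (\<mu> r) * part20 A z r (q r)))"
    using L unfolding L_isothermic_def by (rule conjunct2)
  then obtain q \<mu> where hol: "holomorphic_quadratic_differential A UNIV ?g q"
    and "\<forall>N z. N \<subseteq> UNIV \<and> conformal_coordinate A ?g N z \<longrightarrow>
         (\<forall>r\<in>N. part20 A z r (second_form x n) = complex_of_real (\<mu> r) * part20 A z r (q r))"
    by (elim exE conjE)
  then have \<mu>: "part20 A z r (second_form x n) = complex_of_real (\<mu> r) * part20 A z r (q r)"
    if "conformal_coordinate A ?g N z" "r \<in> N" for N z r using that by simp
  have nd': "nondegenerate_at A r (third_form n')" if r: "r \<in> V" for r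
    using nd[of r] third[OF r] k[OF r] unfolding nondegenerate_at_def by simp
  have hol': "holomorphic_quadratic_differential A V ?g' q"
    unfolding holomorphic_quadratic_differential_def
  proof (intro conjI ballI)
    fix r assume r: "r \<in> V"
    show "bilinear_at A r (q r)" "symmetric_at A r (q r)"
      using hol unfolding holomorphic_quadratic_differential_def by blast+
    obtain N z where N: "r \<in> N" "conformal_coordinate A ?g N z" "\<forall>s\<in>N. trace_free A z s (q s)"
      "(\<lambda>w. part20 A z (inv_into N z w) (q (inv_into N z w))) holomorphic_on (z ` N)"
      using hol unfolding holomorphic_quadratic_differential_def by blast
    have inj: "inj_on z N" "open N" using N(2) unfolding conformal_coordinate_def by blast+
    let ?N = "N \<inter> V"
    have "conformal_coordinate A ?g' ?N z"
    proof (rule conformal_coordinate_rescale[OF N(2)])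
      fix s assume "s \<in> ?N"
      then show "\<exists>c>0. \<forall>X\<in>tangent_space A s. \<forall>Y\<in>tangent_space A s. third_form n' X Y = c * third_form n X Y"
        using third k by (intro exI[of _ "(k s)\<^sup>2"]) simp
    qed (use inj V in auto)
    moreover have "(\<lambda>w. part20 A z (inv_into ?N z w) (q (inv_into ?N z w))) holomorphic_on (z ` ?N)"
    proof (rule holomorphic_transform[OF holomorphic_on_subset[OF N(4)]])
      show "z ` ?N \<subseteq> z ` N" by blast
      fix w assume "w \<in> z ` ?N"
      then obtain s where s: "s \<in> ?N" "w = z s" by blast
      have "inv_into ?N z w = s" "inv_into N z w = s"
        using s inj_on_subset[OF inj(1), of ?N] inj(1) by (auto intro: inv_into_f_f)
      then show "part20 A z (inv_into N z w) (q (inv_into N z w)) = part20 A z (inv_into ?N z w) (q (inv_into ?N z w))"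
        by simp
    qed
    ultimately show "\<exists>N z. r \<in> N \<and> N \<subseteq> V \<and> conformal_coordinate A ?g' N z \<and>
        (\<forall>s\<in>N. trace_free A z s (q s)) \<and>
        (\<lambda>w. part20 A z (inv_into N z w) (q (inv_into N z w))) holomorphic_on (z ` N)"
      using N r by (intro exI[of _ ?N] exI[of _ z]) auto
  qed
  have nz: "\<exists>r\<in>V. \<exists>X\<in>tangent_space A r. \<exists>Y\<in>tangent_space A r. q r X Y \<noteq> 0"
  proof -
    obtain r where r: "r \<in> V" using V by blast
    have "\<exists>X\<in>tangent_space A r. \<exists>Y\<in>tangent_space A r. q r X Y \<noteq> 0"
    proof (rule ccontr)
      assume "\<not> ?thesis"
      then have q0: "q r X Y = 0" if "X \<in> tangent_space A r" "Y \<in> tangent_space A r" for X Y using that by blast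
      obtain N z where N: "r \<in> N" "conformal_coordinate A ?g N z"
        using hol unfolding holomorphic_quadratic_differential_def by blast
      let ?u = "coord_vec A z r 1" and ?v = "coord_vec A z r \<i>"
      note uv = coord_vec[OF N(2,1)]
      have "part20 A z r (q r) = 0" unfolding part20_def Let_def using q0 uv(1) by (simp add: complex_eq_iff)
      then have "part20 A z r (second_form x n) = 0" using \<mu>[OF N(2,1)] by simp
      then have II: "second_form x n ?u ?u = second_form x n ?v ?v" "second_form x n ?u ?v = 0"
        unfolding part20_def Let_def by (simp_all add: complex_eq_iff)
      then have II': "second_form x n ?v ?u = 0" using sym uv(1) by metis
      obtain \<rho> where \<rho>: "\<rho> > 0" "\<And>X Y. X \<in> tangent_space A r \<Longrightarrow> Y \<in> tangent_space A r \<Longrightarrow>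
           third_form n X Y = \<rho> * Re (dd X z * cnj (dd Y z))"
        using N unfolding conformal_coordinate_def by blast
      have inj: "inj_on (\<lambda>X. dd X z) (tangent_space A r)" using N unfolding conformal_coordinate_def bij_betw_def by blast
      have comb: "X = lin_comb (Re (dd X z)) ?u (Im (dd X z)) ?v" if X: "X \<in> tangent_space A r" for X
      proof (rule inj_onD[OF inj _ X lin_comb_tangent[OF uv(1) uv(1)]])
        show "dd X z = dd (lin_comb (Re (dd X z)) ?u (Im (dd X z)) ?v) z"
          by (simp add: dd_lin_comb uv(2) complex_eq_iff)
      qed
      have "second_form x n X Y = (second_form x n ?u ?u / \<rho>) * third_form n X Y"
        if XY: "X \<in> tangent_space A r" "Y \<in> tangent_space A r" for X Y
      proof -
        have bil: "second_form x n (lin_comb a ?u b ?v) (lin_comb a' ?u b' ?v) = (a * a' + b * b') * second_form x n ?u ?u" for a b a' b'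
          using II II' unfolding second_form_def by (simp add: dd_lin_comb algebra_simps)
        have "second_form x n X Y = (Re (dd X z) * Re (dd Y z) + Im (dd X z) * Im (dd Y z)) * second_form x n ?u ?u"
          using bil comb[OF XY(1)] comb[OF XY(2)] by metis
        then show ?thesis using \<rho>(1) \<rho>(2)[OF XY] by simp
      qed
      then show False using umb by blast
    qed
    then show ?thesis using r by blast
  qed
  have p20: "part20 A z r (second_form x' n') = complex_of_real (k r * \<mu> r) * part20 A z r (q r)"
    if N: "N \<subseteq> V" "conformal_coordinate A ?g' N z" "r \<in> N" for N z r
  proof -
    have "open N" using N(2) unfolding conformal_coordinate_def by blast
    have "conformal_coordinate A ?g N z"
    proof (rule conformal_coordinate_rescale[OF N(2) \<open>open N\<close> subset_refl])
      fix s assume "s \<in> N"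
      then have s: "s \<in> V" using N by blast
      show "\<exists>c>0. \<forall>X\<in>tangent_space A s. \<forall>Y\<in>tangent_space A s. third_form n X Y = c * third_form n' X Y"
        using third[OF s] k[OF s] by (intro exI[of _ "inverse ((k s)\<^sup>2)"]) simp
    qed
    note c = this
    let ?u = "coord_vec A z r 1" and ?v = "coord_vec A z r \<i>"
    note uv = coord_vec[OF c N(3)]
    have r: "r \<in> V" using N by blast
    obtain \<rho> where \<rho>: "\<And>X Y. X \<in> tangent_space A r \<Longrightarrow> Y \<in> tangent_space A r \<Longrightarrow>
           third_form n X Y = \<rho> * Re (dd X z * cnj (dd Y z))"
      using c N(3) unfolding conformal_coordinate_def by blast
    have III: "third_form n ?u ?u = \<rho>" "third_form n ?v ?v = \<rho>" "third_form n ?u ?v = 0"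
      using \<rho> uv by simp_all
    have II: "second_form x' n' ?u ?u = k r * (second_form x n ?u ?u - b r * \<rho>)"
        "second_form x' n' ?v ?v = k r * (second_form x n ?v ?v - b r * \<rho>)"
        "second_form x' n' ?u ?v = k r * second_form x n ?u ?v"
      using second[OF r uv(1) uv(1), of 1 1] second[OF r uv(1) uv(1), of \<i> \<i>] second[OF r uv(1) uv(1), of 1 \<i>] III
      by simp_all
    have "part20 A z r (second_form x' n') = complex_of_real (k r) * part20 A z r (second_form x n)"
      unfolding part20_def Let_def II by (simp add: complex_eq_iff diff_divide_distrib[symmetric] right_diff_distrib)
    then show ?thesis using \<mu>[OF c N(3)] by simp
  qed
  have "\<forall>N z. N \<subseteq> V \<and> conformal_coordinate A ?g' N z \<longrightarrow>
      (\<forall>r\<in>N. part20 A z r (second_form x' n') = complex_of_real (k r * \<mu> r) * part20 A z r (q r))"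
    by (intro allI impI ballI, elim conjE) (rule p20)
  with nd' hol' nz show ?thesis unfolding L_isothermic_def
    by (intro conjI ballI exI[of _ q] exI[of _ "\<lambda>r. k r * \<mu> r"])
qed

end

section \<open>Calapso transforms\<close>

context laguerre
begin

lemma euc_linear: "bounded_linear euc"
proof -
  have "linear euc" by (rule linearI) (simp_all add: euc_def algebra_simps)
  then show ?thesis by (simp add: linear_conv_bounded_linear)
qed

end

text \<open>A Legendre map whose frame is normalised against \<open>qinf\<close> and \<open>\<pp>\<close> is the lift of the Euclidean parts of the
  frame vectors: their remaining components are forced by isotropy.\<close>

lemma (in surface) legendre_liftI:
  fixes F G :: "'m \<Rightarrow> R42"
  assumes "laguerre qinf q0 \<pp>" and V: "open V" and leg: "legendre_map A V f"
    and sm: "smooth_map A V F" "smooth_map A V G"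
    and span: "\<And>r. r \<in> V \<Longrightarrow> f r = span {F r, G r}"
    and F: "\<And>r. r \<in> V \<Longrightarrow> lform (F r) qinf = -1" "\<And>r. r \<in> V \<Longrightarrow> lform (F r) \<pp> = 0"
    and G: "\<And>r. r \<in> V \<Longrightarrow> lform (G r) qinf = 0" "\<And>r. r \<in> V \<Longrightarrow> lform (G r) \<pp> = -1"
  shows "\<exists>x n. legendre_lift A V qinf q0 \<pp> f x n \<and>
    (\<forall>r\<in>V. x r + q0 + (lform (x r) (x r) / 2) *\<^sub>R qinf = F r \<and>
             n r + \<pp> + lform (n r) (x r) *\<^sub>R qinf = G r)"
proof -
  interpret laguerre qinf q0 \<pp> by fact
  define x n where "x r = euc (F r)" and "n r = euc (G r)" for r
  have mem: "F r \<in> f r" "G r \<in> f r" if "r \<in> V" for r using span[OF that] by (auto intro: span_base)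
  have iso: "lform v w = 0" if "r \<in> V" "v \<in> f r" "w \<in> f r" for r v w
    using leg that unfolding legendre_map_def isotropic_def by blast
  have null: "lform (F r) (F r) = 0" "lform (G r) (F r) = 0" "lform (G r) (G r) = 0" if "r \<in> V" for r
    using iso[OF that] mem[OF that] by blast+
  have eq: "x r + q0 + (lform (x r) (x r) / 2) *\<^sub>R qinf = F r"
    "n r + \<pp> + lform (n r) (x r) *\<^sub>R qinf = G r" "lform (n r) (n r) = 1" if r: "r \<in> V" for r
    by (simp_all add: x_def n_def lform_euc F[OF r] G[OF r] null[OF r], simp_all add: euc_def F[OF r] G[OF r])
  have smx: "smooth_map A V x" and smn: "smooth_map A V n"
    unfolding x_def[abs_def] n_def[abs_def] by (intro smooth_map_linear[OF euc_linear V] sm)+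
  have orth: "lform (dd X x) (n r) = 0" if r: "r \<in> V" and X: "X \<in> tangent_space A r" for r X
  proof -
    have "local_section A f r F" unfolding local_section_def using V r sm(1) mem by blast
    then have "dd X F \<in> derived_bundle A f r" unfolding derived_bundle_def
      using X by (intro span_base) blast
    then have "lform (dd X F) (G r) = 0" using leg r mem[OF r] unfolding legendre_map_def perp_def by blast
    moreover have "lform (dd X F) qinf = 0" "lform (dd X F) \<pp> = 0"
      using dd_lform_zero[OF X V r sm(1) smooth_map_const F(1)] dd_lform_zero[OF X V r sm(1) smooth_map_const F(2)]
      by (simp_all add: dd_const[OF X])
    moreover have "dd X x = euc (dd X F)"
      unfolding x_def[abs_def] by (rule dd_linear[OF X euc_linear smooth_atI[OF V r sm(1)]])
    ultimately show ?thesis by (simp add: n_def lform_euc G[OF r])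
  qed
  have "legendre_lift A V qinf q0 \<pp> f x n"
    unfolding legendre_lift_def
    using leg smx smn eq span orth euc_perp by (simp add: x_def[symmetric] n_def[symmetric]) (simp add: x_def n_def euc_perp)
  then show ?thesis using eq by blast
qed

text \<open>Here \<open>pt\<close> is the value \<open>p(t)\<close> of the conserved quantity at the parameter of the transform.\<close>

locale calapso = omega_lift +
  fixes V :: "'a set" and t :: real and T :: "'a \<Rightarrow> R42 \<Rightarrow>\<^sub>L R42" and pt :: "'a \<Rightarrow> R42" and l :: "'a \<Rightarrow> real"
  assumes V: "open V" "V \<noteq> {}"
    and T: "trivialising_gauge A V mid t T"
    and pt: "\<And>r. pt r = qinf + l r *\<^sub>R G r"
    and Tpt: "\<And>r. r \<in> V \<Longrightarrow> blinfun_apply (T r) (pt r) = qinf"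
begin

abbreviation "Tf \<equiv> calapso_transform T f"

lemma T_form: "r \<in> V \<Longrightarrow> lform (blinfun_apply (T r) a) (blinfun_apply (T r) b) = lform a b"
  using T unfolding trivialising_gauge_def O42_def by blast

lemma T_inj: "r \<in> V \<Longrightarrow> inj (blinfun_apply (T r))"
  using T O42_inj unfolding trivialising_gauge_def by blast

lemma T_smooth:
  assumes "open M" "M \<subseteq> V" "smooth_map A M \<sigma>"
  shows "smooth_map A M (\<lambda>r. blinfun_apply (T r) (\<sigma> r))"
proof -
  have "smooth_map A V (\<lambda>r. blinfun_apply (T r) b)" for b
    using T unfolding trivialising_gauge_def smooth_endo_def by blast
  then have Tb: "smooth_map A M (\<lambda>r. blinfun_apply (T r) b)" for b using smooth_map_subset assms(2) by blast
  have "blinfun_apply (T r) (\<sigma> r) = (\<Sum>b\<in>Basis. (\<sigma> r \<bullet> b) *\<^sub>R blinfun_apply (T r) b)" for r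
  proof -
    have "blinfun_apply (T r) (\<sigma> r) = blinfun_apply (T r) (\<Sum>b\<in>Basis. (\<sigma> r \<bullet> b) *\<^sub>R b)"
      by (simp only: euclidean_representation)
    then show ?thesis by (simp only: blinfun.sum_right blinfun.scaleR_right)
  qed
  moreover have "smooth_map A M (\<lambda>r. \<Sum>b\<in>Basis. (\<sigma> r \<bullet> b) *\<^sub>R blinfun_apply (T r) b)"
    by (intro smooth_map_sum[OF assms(1)] smooth_map_scaleR[OF assms(1)] Tb
        smooth_map_linear[OF bounded_linear_inner_left assms(1,3)]) simp
  ultimately show ?thesis by simp
qed

text \<open>The potential vanishes on \<open>f\<close>, so on sections of \<open>f\<close> the gauge transformation commutes with
  the trivial connection.\<close>

lemma dd_T:
  assumes r: "r \<in> V" and Z: "Z \<in> tangent_space A r" and \<sigma>: "local_section A f r \<sigma>"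
  shows "dd Z (\<lambda>s. blinfun_apply (T s) (\<sigma> s)) = blinfun_apply (T r) (dd Z \<sigma>)"
proof -
  obtain M where M: "open M" "r \<in> M" "smooth_map A M \<sigma>" "\<forall>s\<in>M. \<sigma> s \<in> f s"
    using \<sigma> unfolding local_section_def by blast
  let ?M = "M \<inter> V" and ?\<tau> = "\<lambda>s. blinfun_apply (T s) (\<sigma> s)"
  have oM: "open ?M" "r \<in> ?M" using M V r by auto
  have "smooth_map A ?M ?\<tau>"
    by (rule T_smooth[OF oM(1) _ smooth_map_subset[OF M(3)]]) auto
  then have at: "smooth_at A r ?\<tau>" using smooth_atI oM by blast
  have inv: "inv (blinfun_apply (T s)) (?\<tau> s) = \<sigma> s" if "s \<in> ?M" for s
    using inv_f_f[OF T_inj] that by blast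
  have "dd Z (\<lambda>s. inv (blinfun_apply (T s)) (?\<tau> s)) = dd Z \<sigma>"
    by (rule dd_cong[OF Z oM inv])
  moreover have "blinfun_apply (mid r Z) (inv (blinfun_apply (T r)) (?\<tau> r)) = 0"
    using mid_kills[OF Z] M inv oM by auto
  moreover have "blinfun_apply (T r)
          (dd Z (\<lambda>s. inv (blinfun_apply (T s)) (?\<tau> s))
           + t *\<^sub>R blinfun_apply (mid r Z) (inv (blinfun_apply (T r)) (?\<tau> r))) = dd Z ?\<tau>"
    using T r Z at unfolding trivialising_gauge_def by blast
  ultimately show ?thesis by simp
qed

definition TF where "TF r = blinfun_apply (T r) (F r)"
definition TG where "TG r = blinfun_apply (T r) (G r)"

lemma smooth_TFG: "smooth_map A V TF" "smooth_map A V TG"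
  unfolding TF_def[abs_def] TG_def[abs_def]
  by (rule T_smooth[OF V(1) subset_refl smooth_map_subset], rule smooth_F smooth_G, simp)+

lemma dd_TFG:
  assumes "r \<in> V" "Z \<in> tangent_space A r"
  shows "dd Z TF = blinfun_apply (T r) (dd Z F)" "dd Z TG = blinfun_apply (T r) (dd Z G)"
  unfolding TF_def[abs_def] TG_def[abs_def] using dd_T[OF assms] section_FG by simp_all

lemma Tf_span: "Tf r = span {TF r, TG r}"
proof -
  have "linear (blinfun_apply (T r))" by (rule blinfun.bounded_linear_right[THEN bounded_linear.linear])
  then show ?thesis
    using linear_span_image[of "blinfun_apply (T r)" "{F r, G r}"]
    by (simp add: calapso_transform_def f_span TF_def TG_def)
qed

lemma TFG_mem: "TF r \<in> Tf r" "TG r \<in> Tf r"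
  by (simp_all add: Tf_span span_base)

lemma Tf_legendre: "legendre_map A V Tf"
  unfolding legendre_map_def
proof (intro conjI ballI impI)
  have lin: "linear (blinfun_apply (T r))" for r by (rule blinfun.bounded_linear_right[THEN bounded_linear.linear])
  have dim: "dim (Tf r) = 2" if "r \<in> V" for r
  proof -
    have "dim (f r) = 2" using legendre unfolding legendre_map_def subbundle_def by blast
    then show ?thesis unfolding calapso_transform_def
      using dim_image_eq[OF lin inj_on_subset[OF T_inj[OF that] subset_UNIV]] by simp
  qed
  show "subbundle A V 2 Tf" unfolding subbundle_def
  proof
    fix r assume "r \<in> V"
    let ?\<sigma> = "\<lambda>i::nat. if i = 0 then TF else TG"
    have "{..<2::nat} = {0, 1}" by auto
    then have "\<forall>q\<in>V. Tf q = span ((\<lambda>i. ?\<sigma> i q) ` {..<2}) \<and> dim (Tf q) = 2"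
      using dim by (simp add: Tf_span)
    moreover have "\<forall>i<2. smooth_map A V (?\<sigma> i)" using smooth_TFG by simp
    ultimately show "\<exists>M \<sigma>. open M \<and> r \<in> M \<and> M \<subseteq> V \<and> (\<forall>i<2::nat. smooth_map A M (\<sigma> i)) \<and>
        (\<forall>q\<in>M. Tf q = span ((\<lambda>i. \<sigma> i q) ` {..<2::nat}) \<and> dim (Tf q) = 2)"
      using V(1) \<open>r \<in> V\<close> by (intro exI[of _ V] exI[of _ ?\<sigma>] conjI subset_refl)
  qed
  show iso: "isotropic (Tf r)" if "r \<in> V" for r
    using f_isotropic[of r] T_form[OF that] unfolding isotropic_def calapso_transform_def by auto
  show "derived_bundle A Tf r \<subseteq> perp (Tf r)" if r: "r \<in> V" for r
    unfolding derived_bundle_def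
  proof (rule span_minimal)
    show "subspace (perp (Tf r))" unfolding perp_def by (auto simp: subspace_def)
    have "dd Z \<rho> \<in> perp (Tf r)" if Z: "Z \<in> tangent_space A r" and \<rho>: "local_section A Tf r \<rho>" for Z \<rho>
    proof -
      obtain M where M: "open M" "r \<in> M" "smooth_map A M \<rho>" "\<forall>s\<in>M. \<rho> s \<in> Tf s"
        using \<rho> unfolding local_section_def by blast
      let ?M = "M \<inter> V"
      have oM: "open ?M" "r \<in> ?M" using M V r by auto
      have \<rho>M: "smooth_map A ?M \<rho>" using M(3) by (rule smooth_map_subset) simp
      have zero: "lform (\<rho> s) v = 0" if "s \<in> ?M" "v \<in> Tf s" for s v
        using M(4) iso that unfolding isotropic_def by blast
      obtain v where v: "v \<in> f r" "\<rho> r = blinfun_apply (T r) v"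
        using M(2,4) unfolding calapso_transform_def by blast
      have "lform (dd Z \<rho>) (TF r) = - lform (\<rho> r) (dd Z TF)" "lform (dd Z \<rho>) (TG r) = - lform (\<rho> r) (dd Z TG)"
        by (rule dd_lform_zero[where c = 0, OF Z oM \<rho>M smooth_map_subset[OF smooth_TFG(1)]], simp, rule zero, simp, rule TFG_mem,
            rule dd_lform_zero[where c = 0, OF Z oM \<rho>M smooth_map_subset[OF smooth_TFG(2)]], simp, rule zero, simp, rule TFG_mem)
      moreover have "lform (\<rho> r) (dd Z TF) = 0" "lform (\<rho> r) (dd Z TG) = 0"
        unfolding dd_TFG[OF r Z] v(2) T_form[OF r] using perp_fD(2)[OF dFG_perp(1)[OF _ Z] v(1)] perp_fD(2)[OF dFG_perp(2)[OF _ Z] v(1)] by simp_all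
      ultimately show ?thesis unfolding perp_def Tf_span span2 by auto
    qed
    moreover have "\<rho> r \<in> perp (Tf r)" if "local_section A Tf r \<rho>" for \<rho>
      using that iso[OF r] unfolding local_section_def isotropic_def perp_def by blast
    ultimately show "{\<sigma> r |\<sigma>. local_section A Tf r \<sigma>} \<union> {dd X \<sigma> |X \<sigma>. X \<in> tangent_space A r \<and> local_section A Tf r \<sigma>}
        \<subseteq> perp (Tf r)" by blast
  qed
  fix r Z assume r: "r \<in> V" and Z: "Z \<in> tangent_space A r"
    and imm: "\<forall>\<sigma>. local_section A Tf r \<sigma> \<longrightarrow> dd Z \<sigma> \<in> Tf r"
  have "dd Z \<sigma> \<in> f r" if \<sigma>: "local_section A f r \<sigma>" for \<sigma>
  proof -
    obtain M where M: "open M" "r \<in> M" "smooth_map A M \<sigma>" "\<forall>s\<in>M. \<sigma> s \<in> f s"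
      using \<sigma> unfolding local_section_def by blast
    have "smooth_map A (M \<inter> V) (\<lambda>s. blinfun_apply (T s) (\<sigma> s))"
      by (rule T_smooth[OF open_Int[OF M(1) V(1)] _ smooth_map_subset[OF M(3)]]) auto
    moreover have "open (M \<inter> V)" "r \<in> M \<inter> V" using M V r by auto
    moreover have "\<forall>s\<in>M \<inter> V. blinfun_apply (T s) (\<sigma> s) \<in> Tf s"
      using M(4) by (simp add: calapso_transform_def)
    ultimately have "local_section A Tf r (\<lambda>s. blinfun_apply (T s) (\<sigma> s))"
      unfolding local_section_def by (intro exI[of _ "M \<inter> V"] conjI)
    then have "dd Z (\<lambda>s. blinfun_apply (T s) (\<sigma> s)) \<in> Tf r"
      by (rule imm[THEN spec, THEN mp])
    then have "blinfun_apply (T r) (dd Z \<sigma>) \<in> blinfun_apply (T r) ` f r"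
      unfolding dd_T[OF r Z \<sigma>] by (simp add: calapso_transform_def)
    then show ?thesis using T_inj[OF r] by (simp add: inj_image_mem_iff)
  qed
  then show "Z = zero_vec" using legendre Z unfolding legendre_map_def by blast
qed

text \<open>The transformed frame has the right products with \<open>qinf\<close>, but not with \<open>\<pp>\<close>; the functions \<open>k\<close> and \<open>b\<close> below
  normalise it.\<close>

definition k where "k r = - lform (TG r) \<pp>"

lemma TFG_forms:
  assumes "r \<in> V" shows "lform (TF r) qinf = -1" "lform (TG r) qinf = 0"
  using T_form[OF assms, of "F r" "pt r", unfolded Tpt[OF assms]] T_form[OF assms, of "G r" "pt r", unfolded Tpt[OF assms]]
    FG_forms[of r] FG_null[of r]
  by (simp_all add: TF_def TG_def pt)

text \<open>Otherwise \<open>TG\<close> would be a multiple of \<open>qinf = T pt\<close>, but \<open>pt\<close> does not lie in \<open>f\<close>.\<close>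

lemma k_nonzero: assumes "r \<in> V" shows "k r \<noteq> 0"
proof
  assume "k r = 0"
  then have "TG r = - lform (TG r) q0 *\<^sub>R qinf"
    using TFG_forms(2)[OF assms] T_form[OF assms, of "G r" "G r"] FG_null[of r]
    by (intro null_in_plane) (simp_all add: k_def TG_def)
  also have "\<dots> = blinfun_apply (T r) (- lform (TG r) q0 *\<^sub>R pt r)"
    by (simp add: Tpt[OF assms] blinfun.bilinear_simps)
  finally have "G r = - lform (TG r) q0 *\<^sub>R pt r" using T_inj[OF assms] by (simp add: TG_def inj_eq)
  then have "lform (G r) v = - lform (TG r) q0 * lform (pt r) v" for v by (metis lform_simps(5))
  from this[of "F r"] this[of \<pp>] show False using FG_forms[of r] FG_null[of r] lform_sym[of qinf "F r"]
    by (simp add: pt)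
qed

definition b where "b r = lform (TF r) \<pp> / k r"
definition TF' where "TF' r = TF r + b r *\<^sub>R TG r"
definition TG' where "TG' r = inverse (k r) *\<^sub>R TG r"

lemma smooth_kb: "smooth_map A V (\<lambda>r. inverse (k r))" "smooth_map A V b"
proof -
  have k: "smooth_map A V k" unfolding k_def[abs_def]
    by (intro smooth_map_minus smooth_map_bilinear[OF lform_bilinear] V(1) smooth_TFG smooth_map_const)
  show "smooth_map A V (\<lambda>r. inverse (k r))" by (rule smooth_map_inverse[OF V(1) k k_nonzero])
  show "smooth_map A V b" unfolding b_def[abs_def]
    by (rule smooth_map_divide[OF V(1) smooth_map_bilinear[OF lform_bilinear V(1) smooth_TFG(1) smooth_map_const] k k_nonzero])
qed

lemma smooth_TFG': "smooth_map A V TF'" "smooth_map A V TG'"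
  unfolding TF'_def[abs_def] TG'_def[abs_def]
  by (intro smooth_map_add smooth_map_scaleR V(1) smooth_TFG smooth_kb)+

lemma TFG'_forms:
  assumes "r \<in> V"
  shows "lform (TF' r) qinf = -1" "lform (TF' r) \<pp> = 0" "lform (TG' r) qinf = 0" "lform (TG' r) \<pp> = -1"
proof -
  have "lform (TG r) \<pp> = - k r" by (simp add: k_def)
  then show "lform (TF' r) qinf = -1" "lform (TF' r) \<pp> = 0" "lform (TG' r) qinf = 0" "lform (TG' r) \<pp> = -1"
    using TFG_forms[OF assms] k_nonzero[OF assms] by (simp_all add: TF'_def TG'_def b_def)
qed

lemma Tf_span': assumes "r \<in> V" shows "Tf r = span {TF' r, TG' r}"
proof
  have k: "TG r = k r *\<^sub>R TG' r" using k_nonzero[OF assms] by (simp add: TG'_def)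
  have TG: "TG r \<in> span {TF' r, TG' r}" by (subst k, rule span_scale, rule span_base) simp
  have "TF' r - b r *\<^sub>R TG r \<in> span {TF' r, TG' r}" by (intro span_diff span_scale[OF TG] span_base) simp
  moreover have "TF r = TF' r - b r *\<^sub>R TG r" by (simp add: TF'_def)
  ultimately have "TF r \<in> span {TF' r, TG' r}" by simp
  with TG show "Tf r \<subseteq> span {TF' r, TG' r}" unfolding Tf_span by (intro span_minimal) auto
  have "TF' r \<in> Tf r" "TG' r \<in> Tf r" unfolding TF'_def TG'_def Tf_span
    by (intro span_add span_scale span_base; simp)+
  then show "span {TF' r, TG' r} \<subseteq> Tf r" unfolding Tf_span by (intro span_minimal) auto
qed

lemma dd_TFG':
  assumes "r \<in> V" "Z \<in> tangent_space A r"
  obtains c d where "dd Z TF' = blinfun_apply (T r) (dd Z F + b r *\<^sub>R dd Z G + c *\<^sub>R G r)"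
    "dd Z TG' = blinfun_apply (T r) (inverse (k r) *\<^sub>R dd Z G + d *\<^sub>R G r)"
proof -
  have at: "smooth_at A r TF" "smooth_at A r TG" "smooth_at A r b" "smooth_at A r (\<lambda>r. inverse (k r))"
    "smooth_at A r (\<lambda>r. b r *\<^sub>R TG r)"
    using smooth_atI[OF V(1) assms(1)] smooth_TFG smooth_kb smooth_map_scaleR[OF V(1) smooth_kb(2) smooth_TFG(2)] by blast+
  have "dd Z TF' = blinfun_apply (T r) (dd Z F + b r *\<^sub>R dd Z G + dd Z b *\<^sub>R G r)"
    unfolding TF'_def[abs_def] dd_add[OF assms(2) at(1,5)] dd_scaleR[OF assms(2) at(3,2)] dd_TFG[OF assms]
    by (simp add: TG_def blinfun.bilinear_simps)
  moreover have "dd Z TG' = blinfun_apply (T r) (inverse (k r) *\<^sub>R dd Z G + dd Z (\<lambda>r. inverse (k r)) *\<^sub>R G r)"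
    unfolding TG'_def[abs_def] dd_scaleR[OF assms(2) at(4,2)] dd_TFG[OF assms]
    by (simp add: TG_def blinfun.bilinear_simps)
  ultimately show ?thesis using that by blast
qed

text \<open>As \<open>T\<close> is orthogonal and the derivatives of \<open>F\<close> and \<open>G\<close> are orthogonal to \<open>G\<close>, the normalisation gives
  \<open>III' = k\<^sup>-\<^sup>2 III\<close> and \<open>II' = k\<^sup>-\<^sup>1 (II - b III)\<close>.\<close>

lemma calapso_L_isothermic:
  assumes L: "L_isothermic A UNIV x n"
  shows "\<exists>x' n'. legendre_lift A V qinf q0 \<pp> Tf x' n' \<and> L_isothermic A V x' n'"
proof -
  obtain x' n' where lift': "legendre_lift A V qinf q0 \<pp> Tf x' n'"
    and eq: "\<forall>r\<in>V. x' r + q0 + (lform (x' r) (x' r) / 2) *\<^sub>R qinf = TF' r \<and>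
             n' r + \<pp> + lform (n' r) (x' r) *\<^sub>R qinf = TG' r"
    using legendre_liftI[OF laguerre_axioms V(1) Tf_legendre smooth_TFG' Tf_span' TFG'_forms] by blast
  interpret L: lift A qinf q0 \<pp> V Tf x' n' by unfold_locales (use V lift' in auto)
  have FG: "L.F r = TF' r" "L.G r = TG' r" if "r \<in> V" for r using eq that by (simp_all add: L.F_def L.G_def)
  have forms: "third_form n' X Y = (inverse (k r))\<^sup>2 * third_form n X Y"
    "second_form x' n' X Y = inverse (k r) * (second_form x n X Y - b r * third_form n X Y)"
    if r: "r \<in> V" and XY: "X \<in> tangent_space A r" "Y \<in> tangent_space A r" for r X Y
  proof -
    obtain c d where X: "dd X TF' = blinfun_apply (T r) (dd X F + b r *\<^sub>R dd X G + c *\<^sub>R G r)"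
      "dd X TG' = blinfun_apply (T r) (inverse (k r) *\<^sub>R dd X G + d *\<^sub>R G r)" by (rule dd_TFG'[OF r XY(1)])
    obtain c' d' where Y: "dd Y TF' = blinfun_apply (T r) (dd Y F + b r *\<^sub>R dd Y G + c' *\<^sub>R G r)"
      "dd Y TG' = blinfun_apply (T r) (inverse (k r) *\<^sub>R dd Y G + d' *\<^sub>R G r)" by (rule dd_TFG'[OF r XY(2)])
    have L: "dd X L.F = dd X TF'" "dd X L.G = dd X TG'" "dd Y L.G = dd Y TG'"
      using dd_cong[OF XY(1) V(1) r FG(1)] dd_cong[OF XY(1) V(1) r FG(2)] dd_cong[OF XY(2) V(1) r FG(2)] by simp_all
    have G: "lform (dd X F) (G r) = 0" "lform (dd X G) (G r) = 0" "lform (G r) (dd Y G) = 0" "lform (G r) (G r) = 0"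
      using perp_fD(1)[OF dFG_perp(1)[OF _ XY(1)] FG_mem(2)] perp_fD(1)[OF dFG_perp(2)[OF _ XY(1)] FG_mem(2)]
        perp_fD(2)[OF dFG_perp(2)[OF _ XY(2)] FG_mem(2)] FG_null[of r] by simp_all
    show "third_form n' X Y = (inverse (k r))\<^sup>2 * third_form n X Y"
      unfolding L.forms_FG(2)[OF r XY] forms_FG(2)[OF UNIV_I XY] L X Y T_form[OF r]
      by (simp add: G power2_eq_square)
    show "second_form x' n' X Y = inverse (k r) * (second_form x n X Y - b r * third_form n X Y)"
      unfolding L.forms_FG(1)[OF r XY] forms_FG[OF UNIV_I XY] L X Y T_form[OF r]
      by (simp add: G algebra_simps)
  qed
  have sym: "second_form x n X Y = second_form x n Y X" if "X \<in> tangent_space A r" "Y \<in> tangent_space A r" for r X Y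
    using forms_FG(1)[OF UNIV_I that] forms_FG(1)[OF UNIV_I that(2,1)]
      section_contact_symmetric[OF UNIV_I section_FG(1)[OF UNIV_I] section_FG(2)[OF UNIV_I] that] by simp
  have umb: "\<not> (\<exists>c. \<forall>X\<in>tangent_space A r. \<forall>Y\<in>tangent_space A r. second_form x n X Y = c * third_form n X Y)" for r
  proof -
    obtain N \<sigma>1 \<sigma>2 X Y where "curvature_frame A qinf q0 \<pp> f x n s1 s2 T1 T2 \<eta> mid r N \<sigma>1 \<sigma>2 X Y"
      by (rule curvature_frame_exists)
    then interpret C: curvature_frame A qinf q0 \<pp> f x n s1 s2 T1 T2 \<eta> mid r N \<sigma>1 \<sigma>2 X Y .
    have "nondegenerate_at A r (third_form n)" using L by (simp add: L_isothermic_def)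
    then show ?thesis by (rule C.not_umbilic)
  qed
  have "L_isothermic A V x' n'"
    by (rule L_isothermic_rescale[OF L V _ forms sym umb]) (simp_all add: k_nonzero)
  then show ?thesis using lift' by blast
qed

end

theorem theorem5p12:
  fixes A :: "('m::{t2_space, second_countable_topology}) chart set"
    and f s1 s2 :: "'m \<Rightarrow> R42 set"
    and T1 T2 :: "'m \<Rightarrow> 'm tangent set"
    and qinf q0 \<pp> :: R42
    and x n :: "'m \<Rightarrow> R42"
    and \<eta> \<eta>mid :: "'m form1"
    and p :: "real \<Rightarrow> 'm \<Rightarrow> R42"
    and t :: real
    and U :: "'m set"
    and T :: "'m \<Rightarrow> R42 \<Rightarrow>\<^sub>L R42"
  assumes "smooth_atlas A"
    and "laguerre_frame qinf q0 \<pp>"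
    and "Omega_surface A f \<eta>"
    and "umbilic_free A f s1 s2 T1 T2"
    and "legendre_lift A UNIV qinf q0 \<pp> f x n"
    and "L_isothermic A UNIV x n"
    and "middle_potential A f s1 s2 T1 T2 \<eta> \<eta>mid"
    and "linear_conserved_quantity A \<eta>mid p"
    and "\<forall>r. p 0 r = qinf"
    and "\<forall>t r. lform (p t r) (p t r) = 0"
    and "open U" and "U \<noteq> {}"
    and "trivialising_gauge A U \<eta>mid t T"
    and "\<forall>r\<in>U. blinfun_apply (T r) (p t r) = qinf"
  shows "\<exists>x' n'. legendre_lift A U qinf q0 \<pp> (calapso_transform T f) x' n' \<and>
                 L_isothermic A U x' n'"
proof -
  interpret omega_lift A qinf q0 \<pp> f x n s1 s2 T1 T2 \<eta> \<eta>mid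
    by unfold_locales (use assms in auto)
  have "\<exists>l. p t r = qinf + l *\<^sub>R G r" for r
    using conserved_quantity_form[OF assms(8,9,10), of t r] by metis
  then obtain l where "\<And>r. p t r = qinf + l r *\<^sub>R G r" by metis
  then interpret calapso A qinf q0 \<pp> f x n s1 s2 T1 T2 \<eta> \<eta>mid U t T "p t" l
    by unfold_locales (use assms in auto)
  show ?thesis by (rule calapso_L_isothermic[OF assms(6)])
qed

end
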